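(* For every real $\alpha\in(1/2,1)$, $$\dim \mathcal{E}_{2,\alpha}=\begin{cases} 7/2-3\alpha & \text{if } 1/2<\alpha\leqslant 5/6,\\ 6(1-\alpha) & \text{if } 5/6<\alpha<1,\end{cases}$$ where $\dim$ denotes Hausdorff dimension.
   Context: Write $\mathbf{e}(z)=\exp(2\pi i z)$ and $\mathsf{T}_d=[0,1]^d$. For $d\geqslant 1$, $\mathbf{x}=(x_1,\ldots,x_d)\in\mathsf{T}_d$ and $N\in\mathbb{N}$ let $S_d(\mathbf{x};N)=\sum_{n=1}^N \mathbf{e}(x_1n+\cdots+x_dn^d)$. For $\alpha\in(1/2,1)$ let $\mathcal{E}_{d,\alpha}=\{\mathbf{x}\in\mathsf{T}_d:\ |S_d(\mathbf{x};N)|\geqslant N^{\alpha}\text{ for infinitely many }N\in\mathbb{N}\}$. *)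

theory Defs
  imports "HOL-Analysis.Analysis"
begin

(* The s-th power of the diameter, with the usual conventions for s = 0: a nonempty set counts 1
   (whereas 0 powr 0 = 0), the empty set counts 0.  Only meaningful for bounded U, since diameter
   is a Sup in the reals. *)
definition diam_pow :: "real \<Rightarrow> 'a::metric_space set \<Rightarrow> ennreal" where
  "diam_pow s U = (if U = {} then 0 else if s = 0 then 1 else ennreal (diameter U powr s))"

definition delta_cover :: "real \<Rightarrow> 'a::metric_space set \<Rightarrow> (nat \<Rightarrow> 'a set) \<Rightarrow> bool" where
  "delta_cover \<delta> A U \<longleftrightarrow> A \<subseteq> (\<Union>i. U i) \<and> (\<forall>i. bounded (U i) \<and> diameter (U i) \<le> \<delta>)"

definition hausdorff_content :: "real \<Rightarrow> real \<Rightarrow> 'a::metric_space set \<Rightarrow> ennreal" where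
  "hausdorff_content s \<delta> A = (INF U\<in>{U. delta_cover \<delta> A U}. \<Sum>i. diam_pow s (U i))"

(* The content increases as \<delta> decreases, so the supremum is the limit as \<delta> tends to 0 from above. *)
definition hausdorff_measure :: "real \<Rightarrow> 'a::metric_space set \<Rightarrow> ennreal" where
  "hausdorff_measure s A = (SUP \<delta>\<in>{0<..}. hausdorff_content s \<delta> A)"

definition hausdorff_dim :: "'a::metric_space set \<Rightarrow> ennreal" where
  "hausdorff_dim A = (INF s\<in>{s. 0 \<le> s \<and> hausdorff_measure s A = 0}. ennreal s)"

definition e :: "real \<Rightarrow> complex" where
  "e z = exp (2 * of_real pi * \<i> * of_real z)"

definition weyl_sum :: "nat \<Rightarrow> (nat \<Rightarrow> real) \<Rightarrow> nat \<Rightarrow> complex" where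
  "weyl_sum d x N = (\<Sum>n=1..N. e (\<Sum>j=1..d. x j * real n ^ j))"

(* The exceptional set for d = 2, in the Euclidean plane.  The coordinates of a vector in real^2 are
   x $ 1 and x $ 2, which are x $ of_nat 1 and x $ of_nat 2 (in the index type 2 = 0). *)
definition large_weyl_set2 :: "real \<Rightarrow> (real^2) set" where
  "large_weyl_set2 \<alpha> =
     {x. (\<forall>i. 0 \<le> x $ i \<and> x $ i \<le> 1) \<and>
         (\<exists>\<^sub>\<infinity>N. norm (weyl_sum 2 (\<lambda>j. x $ of_nat j) N) \<ge> real N powr \<alpha>)}"

end

theory Submission
  imports Defs "HOL-Real_Asymp.Real_Asymp"
begin

text \<open>
  Near a rational point \<open>(a\<^sub>1/q, a\<^sub>2/q)\<close> the Weyl sum of length \<open>N\<close> equals a normalised Gauss sum, of size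
  \<open>q\<^bsup>-1/2\<^esup>\<close>, times a sum with slowly varying phase, up to \<open>O(q\<^bsup>1/2\<^esup> log q)\<close>. By Dirichlet such an
  approximation with \<open>q \<lesssim> N\<close> always exists and the error is then below \<open>N\<^bsup>\<alpha>\<^esup>\<close>. Hence the sum is
  large essentially exactly on the rectangles of size \<open>N\<^bsup>1-2\<alpha>\<^esup>/q \<times> N\<^bsup>-2\<alpha>\<^esup>/q\<close> around the points with
  \<open>q \<lesssim> N\<^bsup>2-2\<alpha>\<^esup>\<close>. Covering each rectangle either by one square or by about \<open>N\<close> squares gives the
  two upper bounds \<open>6(1-\<alpha>)\<close> and \<open>7/2-3\<alpha>\<close>.

  For the lower bound, spread mass uniformly over the \<open>1/N \<times> 1/N\<^sup>2\<close> rectangles with prime denominators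
  \<open>q\<close> close to \<open>N\<^bsup>2-2\<alpha>\<^esup>\<close>. These masses equidistribute, and counting the separated fractions
  \<open>a\<^sub>2/q\<close> alone already gives a Frostman bound of the right exponent, uniformly in \<open>N\<close>. Multiplying
  such densities for a rapidly increasing sequence of \<open>N\<close> preserves the Frostman bound.
\<close>

section \<open>Kuzmin--Landau inequality\<close>

text \<open>Both exponents come from one count. For the largest denominators, q ~ N^(2-2\<alpha>),
  the rectangle has sides about 1/N and 1/N^2, and there are about q^3 = N^(6-6\<alpha>) of them.
  One square of side 1/N for each balances at s = 6(1-\<alpha>); N squares of side 1/N^2 for each
  balance at 2s = 7-6\<alpha>. The second covering is cheaper exactly when s > 1, and the two values
  agree, with s = 1, at \<alpha> = 5/6. The condition \<alpha> > 1/2 enters through the error term: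
  with q of order N it is N^(1/2) log N, which must stay below N^\<alpha>. Odd prime denominators
  serve the lower bound in three ways: the Gauss sum has modulus exactly sqrt q, every a2/q with 0 <
  a2 < q is reduced, and distinct fractions a2/q, b2/q' are at least 1/(q q') apart. Restricting to
  primes costs a logarithm, absorbed in a small power N^\<eta>. The Frostman exponent t is kept
  strictly between the target s and the critical value: one gap pays for N^\<eta>, the other for the
  multiplication of densities.\<close>

lemma e_add: "e (x + y) = e x * e y"
  by (simp add: e_def distrib_left exp_add)

lemma e_minus: "e (- x) = cnj (e x)"
  by (simp add: e_def exp_cnj)

lemma norm_e [simp]: "norm (e x) = 1"
  by (simp add: e_def)

lemma e_cis: "e x = cis (2 * pi * x)"
  by (simp add: e_def cis_conv_exp mult_ac)

lemma e_of_int [simp]: "e (of_int k) = 1"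
  by (metis cis_multiple_2pi e_cis Ints_of_int)

lemma e_0 [simp]: "e 0 = 1"
  by (simp add: e_def)

lemma e_add_int [simp]: "e (x + of_int k) = e x"
  by (simp add: e_add)

lemma norm_cnj_e_sum: "norm (\<Sum>n\<in>A. e (- f n)) = norm (\<Sum>n\<in>A. e (f n))"
proof -
  have "(\<Sum>n\<in>A. e (- f n)) = cnj (\<Sum>n\<in>A. e (f n))"
    by (simp add: e_minus)
  then show ?thesis by (metis complex_mod_cnj)
qed

text \<open>Jordan's inequality: on [0, pi/2] the concave sine lies above its chord.\<close>

lemma sin_pi_ge:
  assumes "0 \<le> x" "x \<le> 1/2"
  shows "2 * x \<le> sin (pi * x)"
proof -
  have "convex_on {0..pi/2} (\<lambda>x. - sin x)"
  proof (rule f''_ge0_imp_convex)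
    show "\<And>x. x \<in> {0..pi/2} \<Longrightarrow> ((\<lambda>x. - sin x) has_real_derivative (- cos x)) (at x)"
      by (auto intro!: derivative_eq_intros)
    show "\<And>x. x \<in> {0..pi/2} \<Longrightarrow> ((\<lambda>x. - cos x) has_real_derivative sin x) (at x)"
      by (auto intro!: derivative_eq_intros)
  qed (auto intro: sin_ge_zero)
  then have "- sin ((1 - 2*x) *\<^sub>R 0 + (2*x) *\<^sub>R (pi/2)) \<le> (1 - 2*x) * (- sin 0) + 2*x * (- sin (pi/2))"
    using assms by (intro convex_onD) auto
  then show ?thesis
    by (simp add: mult_ac)
qed

lemma sin_pi_ge_dist:
  assumes "\<delta> \<le> x" "x \<le> 1 - \<delta>" "0 \<le> \<delta>"
  shows "2 * \<delta> \<le> sin (pi * x)"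
proof (cases "x \<le> 1/2")
  case True
  then show ?thesis using sin_pi_ge[of x] assms by linarith
next
  case False
  have "sin (pi * (1 - x)) = sin (pi * x)"
    by (simp add: right_diff_distrib sin_pi_minus)
  then have "2 * (1 - x) \<le> sin (pi * x)"
    using sin_pi_ge[of "1 - x"] assms False by simp
  moreover have "2 * \<delta> \<le> 2 * (1 - x)"
    using assms by simp
  ultimately show ?thesis by (rule order_trans[rotated])
qed

lemma inverse_one_minus_e:
  assumes "sin (pi * x) \<noteq> 0"
  shows "1 / (1 - e x) = Complex (1/2) (cot (pi * x) / 2)" and "e x \<noteq> 1"
proof -
  let ?s = "sin (pi * x)" and ?c = "cos (pi * x)"
  have ex: "e x = Complex (1 - 2 * ?s^2) (2 * ?s * ?c)"
    using cos_double_sin[of "pi * x"] sin_double[of "pi * x"]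
    by (simp add: e_cis complex_eq_iff mult_ac)
  then show "e x \<noteq> 1"
    using assms by (simp add: complex_eq_iff)
  have cc: "?c * ?c = 1 - ?s * ?s"
    using sin_cos_squared_add[of "pi * x"] by (simp add: power2_eq_square)
  have "(1 - e x) * Complex (1/2) (cot (pi * x) / 2) = 1"
    using assms by (simp add: ex complex_eq_iff cot_def field_simps power2_eq_square cc)
  then show "1 / (1 - e x) = Complex (1/2) (cot (pi * x) / 2)"
    using \<open>e x \<noteq> 1\<close> by (simp add: field_simps)
qed

lemma cot_antimono:
  assumes "0 < x" "x \<le> y" "y < pi"
  shows "cot y \<le> cot x"
proof -
  have "cot x - cot y = sin (y - x) / (sin x * sin y)"
    using sin_gt_zero[of x] sin_gt_zero[of y] assms
    by (simp add: cot_def sin_diff field_simps)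
  moreover have "\<dots> \<ge> 0"
    using sin_gt_zero[of x] sin_gt_zero[of y] sin_ge_zero[of "y - x"] assms by simp
  ultimately show ?thesis by simp
qed

text \<open>The inequality of Kuzmin and Landau: write each term as \<open>(z\<^sub>n - z\<^sub>n\<^sub>+\<^sub>1) u\<^sub>n\<close> with
  \<open>u\<^sub>n = 1 / (1 - e (g n)) = 1/2 + \<i> cot (\<pi> g n) / 2\<close> and sum by parts; the
  variation of the cotangents telescopes because \<open>g\<close> is monotone.\<close>

lemma kuzmin_landau_incseq:
  fixes f :: "nat \<Rightarrow> real"
  defines "g \<equiv> (\<lambda>n. f (Suc n) - f n)"
  assumes "0 < \<delta>"
    and g: "\<And>n. m \<le> n \<Longrightarrow> n < k \<Longrightarrow> \<delta> \<le> g n \<and> g n \<le> 1 - \<delta>"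
    and mono: "\<And>n. m \<le> n \<Longrightarrow> Suc n < k \<Longrightarrow> g n \<le> g (Suc n)"
  shows "norm (\<Sum>n=m..<k. e (f n)) \<le> 1 / \<delta>"
proof (cases "m < k")
  case False
  then show ?thesis using assms(2) by simp
next
  case True
  define u where "u n = 1 / (1 - e (g n))" for n
  have sin_ge: "2 * \<delta> \<le> sin (pi * g n)" if "m \<le> n" "n < k" for n
    using g[OF that] assms(2) by (intro sin_pi_ge_dist) auto
  have sin0: "sin (pi * g n) \<noteq> 0" if "m \<le> n" "n < k" for n
    using sin_ge[OF that] assms(2) by auto
  have u: "u n = Complex (1/2) (cot (pi * g n) / 2)" if "m \<le> n" "n < k" for n
    unfolding u_def by (rule inverse_one_minus_e(1)[OF sin0[OF that]])
  have z: "e (f n) = (e (f n) - e (f (Suc n))) * u n" if "m \<le> n" "n < k" for n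
  proof -
    have "e (f (Suc n)) = e (f n) * e (g n)"
      unfolding e_add[symmetric] by (simp add: g_def)
    then show ?thesis
      using inverse_one_minus_e(2)[OF sin0[OF that]] by (simp add: u_def field_simps)
  qed
  have cot_le: "\<bar>cot (pi * g n)\<bar> \<le> 1 / (2 * \<delta>)" if "m \<le> n" "n < k" for n
  proof -
    have "\<bar>cot (pi * g n)\<bar> = \<bar>cos (pi * g n)\<bar> / \<bar>sin (pi * g n)\<bar>"
      by (simp add: cot_def)
    also have "\<dots> \<le> 1 / (2 * \<delta>)"
      using sin_ge[OF that] assms(2) by (intro frac_le) auto
    finally show ?thesis .
  qed
  have norm_u: "norm (u n) \<le> 1 / (4 * \<delta>)" if "m \<le> n" "n < k" for n
  proof -
    let ?s = "sin (pi * g n)" and ?c = "cos (pi * g n)"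
    have s: "?s > 0" using sin_ge[OF that] assms(2) by linarith
    have "(norm (u n))^2 = (1/2)^2 + (?c / ?s / 2)^2"
      unfolding u[OF that] by (simp add: cmod_def cot_def)
    also have "\<dots> = (1 / (2 * ?s))^2"
      using s sin_cos_squared_add[of "pi * g n"]
      by (simp add: field_simps power2_eq_square)
    finally have "norm (u n) = 1 / (2 * ?s)"
      using s by (simp add: power2_eq_iff_nonneg)
    also have "\<dots> \<le> 1 / (4 * \<delta>)"
      using sin_ge[OF that] assms(2) by (intro frac_le) auto
    finally show ?thesis .
  qed
  have cot_mono: "cot (pi * g (Suc n)) \<le> cot (pi * g n)" if "m \<le> n" "Suc n < k" for n
    using g[of n] g[of "Suc n"] mono[of n] that assms(2) by (intro cot_antimono) auto
  \<comment> \<open>Summation by parts as an induction: with the boundary term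
    \<open>e (f (Suc j)) * u j\<close> added to the partial sum, passing from j to Suc j adds
    exactly \<open>e (f (Suc j)) * (u (Suc j) - u j)\<close>. The boundary term is removed at the
    end at the cost of \<open>norm (u j)\<close>.\<close>
  have *: "norm ((\<Sum>n=m..<Suc j. e (f n)) + e (f (Suc j)) * u j)
     \<le> norm (u m) + (cot (pi * g m) - cot (pi * g j)) / 2" if "m \<le> j" "j < k" for j
    using that
  proof (induction j rule: dec_induct)
    case base
    then have "e (f m) + e (f (Suc m)) * u m = e (f m) * u m"
      using z[of m] by (simp add: algebra_simps)
    then show ?case by (simp add: norm_mult)
  next
    case (step j)
    have "(\<Sum>n=m..<Suc (Suc j). e (f n)) + e (f (Suc (Suc j))) * u (Suc j)
        = (\<Sum>n=m..<Suc j. e (f n)) + e (f (Suc j)) * u (Suc j)"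
      using z[of "Suc j"] step by (simp add: algebra_simps)
    also have "\<dots> = ((\<Sum>n=m..<Suc j. e (f n)) + e (f (Suc j)) * u j) + e (f (Suc j)) * (u (Suc j) - u j)"
      by (simp add: algebra_simps)
    finally have "norm ((\<Sum>n=m..<Suc (Suc j). e (f n)) + e (f (Suc (Suc j))) * u (Suc j))
       \<le> norm ((\<Sum>n=m..<Suc j. e (f n)) + e (f (Suc j)) * u j) + norm (u (Suc j) - u j)"
      by (metis norm_triangle_ineq norm_mult norm_e mult_1)
    \<comment> \<open>The real part of \<open>u\<close> is constantly 1/2, so the increment is
      purely imaginary, and its sign is known because the cotangents decrease.\<close>
    moreover have "norm (u (Suc j) - u j) = (cot (pi * g j) - cot (pi * g (Suc j))) / 2"
      using u[of j] u[of "Suc j"] step cot_mono[of j] by (simp add: cmod_def)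
    moreover have "norm ((\<Sum>n=m..<Suc j. e (f n)) + e (f (Suc j)) * u j)
        \<le> norm (u m) + (cot (pi * g m) - cot (pi * g j)) / 2"
      using step by auto
    ultimately show ?case by argo
  qed
  define j where "j = k - 1"
  have j: "m \<le> j" "j < k" "k = Suc j" using True by (auto simp: j_def)
  have "norm (\<Sum>n=m..<k. e (f n)) \<le> norm ((\<Sum>n=m..<Suc j. e (f n)) + e (f (Suc j)) * u j) + norm (u j)"
    using norm_triangle_ineq4[of "(\<Sum>n=m..<Suc j. e (f n)) + e (f (Suc j)) * u j" "e (f (Suc j)) * u j"] j
    by (simp add: norm_mult)
  also have "\<dots> \<le> 1 / (4 * \<delta>) + (1 / (2 * \<delta>) + 1 / (2 * \<delta>)) / 2 + 1 / (4 * \<delta>)"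
  proof -
    have aux: "x + w \<le> b + (d + d) / 2 + b"
      if "x \<le> v + (y - z) / 2" "v \<le> b" "w \<le> b" "\<bar>y\<bar> \<le> d" "\<bar>z\<bar> \<le> d" for x y z v w b d :: real
      using that unfolding diff_divide_distrib add_divide_distrib by linarith
    show ?thesis
      by (rule aux[OF *[OF j(1,2)] norm_u[OF order_refl True] norm_u[OF j(1,2)]
        cot_le[OF order_refl True] cot_le[OF j(1,2)]])
  qed
  also have "\<dots> = 1 / \<delta>"
    by (simp add: field_simps)
  finally show ?thesis .
qed

text \<open>The phase n - f(n) has increments 1 minus those of f, which increase and lie in the same
  interval; modulo 1 it is -f(n), whose exponential sum is the complex conjugate.\<close>

lemma kuzmin_landau_decseq:
  fixes f :: "nat \<Rightarrow> real"
  assumes "0 < \<delta>"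
    and g: "\<And>n. m \<le> n \<Longrightarrow> n < k \<Longrightarrow> \<delta> \<le> f (Suc n) - f n \<and> f (Suc n) - f n \<le> 1 - \<delta>"
    and mono: "\<And>n. m \<le> n \<Longrightarrow> Suc n < k \<Longrightarrow> f (Suc (Suc n)) - f (Suc n) \<le> f (Suc n) - f n"
  shows "norm (\<Sum>n=m..<k. e (f n)) \<le> 1 / \<delta>"
proof -
  have "norm (\<Sum>n=m..<k. e (real n - f n)) \<le> 1 / \<delta>"
    by (rule kuzmin_landau_incseq) (use assms in \<open>auto simp: algebra_simps\<close>)
  moreover have "e (real n - f n) = e (- f n)" for n
    using e_add_int[of "- f n" "int n"] by (simp add: algebra_simps)
  ultimately show ?thesis
    by (simp add: norm_cnj_e_sum)
qed

text \<open>The increments of a quadratic phase are \<theta> + \<beta>(2n+1), monotone in the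
  direction given by the sign of \<beta>.\<close>

lemma kuzmin_landau_quadratic:
  fixes \<theta> \<beta> :: real
  assumes "0 < \<delta>"
    and g: "\<And>n. m \<le> n \<Longrightarrow> n < k \<Longrightarrow> \<delta> \<le> \<theta> + \<beta> * (2 * real n + 1) \<and> \<theta> + \<beta> * (2 * real n + 1) \<le> 1 - \<delta>"
  shows "norm (\<Sum>n=m..<k. e (\<theta> * real n + \<beta> * (real n)^2)) \<le> 1 / \<delta>"
proof -
  define f where "f n = \<theta> * real n + \<beta> * (real n)^2" for n
  have f: "f (Suc n) - f n = \<theta> + \<beta> * (2 * real n + 1)" for n
    by (simp add: f_def algebra_simps power2_eq_square)
  show ?thesis
  proof (cases "\<beta> \<ge> 0")
    case True
    show ?thesis unfolding f_def[symmetric]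
      by (rule kuzmin_landau_incseq) (use assms True in \<open>auto simp: f mult_left_mono\<close>)
  next
    case False
    show ?thesis unfolding f_def[symmetric]
      by (rule kuzmin_landau_decseq) (use assms False in \<open>auto simp: f mult_left_mono_neg\<close>)
  qed
qed

lemma kuzmin_landau_quadratic_neg:
  fixes \<theta> \<beta> :: real
  assumes "0 < \<delta>"
    and g: "\<And>n. m \<le> n \<Longrightarrow> n < k \<Longrightarrow> \<theta> + \<beta> * (2 * real n + 1) \<le> - \<delta> \<and> \<theta> + \<beta> * (2 * real n + 1) \<ge> \<delta> - 1"
  shows "norm (\<Sum>n=m..<k. e (\<theta> * real n + \<beta> * (real n)^2)) \<le> 1 / \<delta>"
proof -
  have "norm (\<Sum>n=m..<k. e ((-\<theta>) * real n + (-\<beta>) * (real n)^2)) \<le> 1 / \<delta>"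
    using assms(1) by (rule kuzmin_landau_quadratic) (use g in force)
  moreover have "(\<Sum>n=m..<k. e ((-\<theta>) * real n + (-\<beta>) * (real n)^2))
      = (\<Sum>n=m..<k. e (- (\<theta> * real n + \<beta> * (real n)^2)))"
    by simp
  ultimately show ?thesis
    using norm_cnj_e_sum[of "\<lambda>n. \<theta> * real n + \<beta> * (real n)^2"] by simp
qed

section \<open>Quadratic Gauss sums\<close>

lemma e_eq_1_iff: "e x = 1 \<longleftrightarrow> x \<in> \<int>"
proof
  assume "e x = 1"
  then obtain n :: int where "2 * pi * x = of_int (2 * n) * pi"
    by (auto simp: e_def exp_eq_1 mult_ac)
  then have "x = of_int n" by simp
  then show "x \<in> \<int>" by simp
qed (auto elim!: Ints_cases)

lemma e_frac_cong:
  assumes "q > 0" "m mod q = n mod q"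
  shows "e (of_int m / of_int q) = e (of_int n / of_int q)"
proof -
  obtain k where k: "m = n + q * k"
    using assms(2) by (metis mod_eqE)
  have "of_int m / of_int q = (of_int n / of_int q + of_int k :: real)"
    using assms(1) by (simp add: k field_simps)
  then show ?thesis by simp
qed

lemma quadratic_mod: "(a * (x mod q)^2 + b * (x mod q)) mod q = (a * x^2 + b * x) mod (q::int)"
  by (intro mod_add_cong mod_mult_cong refl) (simp_all add: power_mod)

lemma sum_periodic_shift:
  fixes f :: "int \<Rightarrow> complex"
  assumes "q > 0" "\<And>x. f (x mod q) = f x"
  shows "(\<Sum>x\<in>{0..<q}. f (x + h)) = (\<Sum>x\<in>{0..<q}. f x)"
proof (rule sum.reindex_bij_witness[where i = "\<lambda>x. (x - h) mod q" and j = "\<lambda>x. (x + h) mod q"])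
  fix x assume x: "x \<in> {0..<q}"
  show "((x + h) mod q - h) mod q = x" "((x - h) mod q + h) mod q = x"
    using x by (simp_all add: mod_simps)
  show "(x + h) mod q \<in> {0..<q}" "(x - h) mod q \<in> {0..<q}"
    using assms(1) by simp_all
  show "f ((x + h) mod q) = f (x + h)"
    by (rule assms(2))
qed

text \<open>Shifting m by 1 permutes the residues and multiplies the sum by e(k/q), which differs
  from 1 unless q divides k.\<close>

lemma sum_e_orthogonal:
  assumes "q > 0"
  shows "(\<Sum>m\<in>{0..<q}. e (of_int (k * m) / of_int q)) = (if q dvd k then of_int q else 0)"
proof (cases "q dvd k")
  case True
  have "e (of_int (k * m) / of_int q) = 1" for m
    using e_frac_cong[of q "k * m" 0] assms True by (simp add: dvd_imp_mod_0)
  then show ?thesis using True assms by simp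
next
  case False
  define z where "z = e (of_int k / of_int q)"
  let ?S = "\<Sum>m\<in>{0..<q}. e (of_int (k * m) / of_int q)"
  have "?S = (\<Sum>m\<in>{0..<q}. e (of_int (k * (m + 1)) / of_int q))"
    by (rule sum_periodic_shift[symmetric])
      (use assms in \<open>auto intro!: e_frac_cong simp: mod_simps simp del: of_int_mult\<close>)
  also have "\<dots> = z * ?S"
    unfolding sum_distrib_left z_def
    by (intro sum.cong refl) (simp add: e_add[symmetric] algebra_simps add_divide_distrib)
  finally have "(z - 1) * ?S = 0"
    by (simp add: algebra_simps)
  moreover have "z \<noteq> 1"
  proof
    assume "z = 1"
    then obtain n where "of_int k / of_int q = (of_int n :: real)"
      by (auto simp: z_def e_eq_1_iff elim: Ints_cases)
    then have "real_of_int k = of_int (n * q)"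
      using assms by (simp add: field_simps)
    then have "k = n * q" by linarith
    then show False using False by simp
  qed
  ultimately show ?thesis using False by simp
qed

definition gauss_sum :: "int \<Rightarrow> int \<Rightarrow> int \<Rightarrow> complex" where
  "gauss_sum a b q = (\<Sum>m\<in>{0..<q}. e (of_int (a * m^2 + b * m) / of_int q))"

text \<open>Weyl differencing: with n = h + m the phase difference is P(h) + 2ahm for P(x) = a x^2 +
  b x. It is linear in m, so orthogonality leaves only the h with q dividing 2ah.\<close>

lemma gauss_sum_norm_square:
  assumes "q > 0"
  shows "complex_of_real ((norm (gauss_sum a b q))^2) =
    (\<Sum>h\<in>{0..<q}. e (of_int (a * h^2 + b * h) / of_int q) * (if q dvd 2 * a * h then of_int q else 0))"
proof -
  let ?P = "\<lambda>m::int. a * m^2 + b * m"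
  have "complex_of_real ((norm (gauss_sum a b q))^2) = gauss_sum a b q * cnj (gauss_sum a b q)"
    by (rule complex_norm_square)
  also have "\<dots> = (\<Sum>m\<in>{0..<q}. \<Sum>n\<in>{0..<q}. e (of_int (?P n - ?P m) / of_int q))"
    unfolding gauss_sum_def cnj_sum sum_product
    by (subst sum.swap, intro sum.cong refl)
      (simp add: e_minus[symmetric] e_add[symmetric] diff_divide_distrib)
  also have "\<dots> = (\<Sum>m\<in>{0..<q}. \<Sum>h\<in>{0..<q}. e (of_int (?P (h + m) - ?P m) / of_int q))"
  proof (rule sum.cong[OF refl])
    fix m
    have "(?P (x mod q) - ?P m) mod q = (?P x - ?P m) mod q" for x
      by (metis mod_diff_left_eq quadratic_mod)
    then show "(\<Sum>n\<in>{0..<q}. e (of_int (?P n - ?P m) / of_int q))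
        = (\<Sum>h\<in>{0..<q}. e (of_int (?P (h + m) - ?P m) / of_int q))"
      by (intro sum_periodic_shift[symmetric, where f = "\<lambda>n. e (of_int (?P n - ?P m) / of_int q)"]
          assms e_frac_cong)
  qed
  also have "\<dots> = (\<Sum>h\<in>{0..<q}. \<Sum>m\<in>{0..<q}. e (of_int (?P h) / of_int q) * e (of_int (2 * a * h * m) / of_int q))"
    by (subst sum.swap, intro sum.cong refl)
      (simp add: e_add[symmetric] add_divide_distrib[symmetric] algebra_simps power2_eq_square)
  also have "\<dots> = (\<Sum>h\<in>{0..<q}. e (of_int (?P h) / of_int q) * (if q dvd 2 * a * h then of_int q else 0))"
    unfolding sum_distrib_left[symmetric] sum_e_orthogonal[OF assms] ..
  finally show ?thesis .
qed

text \<open>Only h = 0 and h = q/2 can survive the differencing, and each contributes at most q; the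
  factor 2 accounts for even q.\<close>

lemma gauss_sum_norm_le:
  assumes "q > 0" "coprime a q"
  shows "norm (gauss_sum a b q) \<le> sqrt (2 * of_int q)"
proof -
  let ?H = "{h\<in>{0..<q}. q dvd 2 * h}"
  have dvd_iff: "q dvd 2 * a * h \<longleftrightarrow> q dvd 2 * h" for h
    using assms(2) by (metis coprime_commute coprime_dvd_mult_right_iff mult.assoc mult.left_commute)
  have "(norm (gauss_sum a b q))^2 = norm (complex_of_real ((norm (gauss_sum a b q))^2))"
    by (simp del: of_real_power)
  also have "\<dots> \<le> (\<Sum>h\<in>{0..<q}. norm (e (of_int (a * h^2 + b * h) / of_int q) * (if q dvd 2 * h then of_int q else 0)))"
    unfolding gauss_sum_norm_square[OF assms(1)] dvd_iff by (rule norm_sum)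
  also have "\<dots> = (\<Sum>h\<in>?H. real_of_int q)"
    using assms(1) by (subst sum.inter_filter) (auto intro!: sum.cong simp: norm_mult)
  also have "\<dots> = of_int q * real (card ?H)"
    by simp
  also have "card ?H \<le> card {0, q div 2}"
  proof (intro card_mono subsetI)
    fix h assume "h \<in> ?H"
    then obtain k where k: "2 * h = q * k" "0 \<le> h" "h < q" by auto
    then have "q * k < q * 2" "0 \<le> q * k" by linarith+
    then have "k < 2" "0 \<le> k" using assms(1)
      by (auto simp: zero_le_mult_iff)
    then have "k = 0 \<or> k = 1" by auto
    then show "h \<in> {0, q div 2}" using k by auto
  qed auto
  also have "card {0, q div 2} \<le> 2"
    by (simp add: card_insert_if)
  finally have "(norm (gauss_sum a b q))^2 \<le> 2 * of_int q"
    using assms(1) by (simp add: mult.commute)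
  then show ?thesis by (simp add: real_le_rsqrt)
qed

text \<open>For odd q only h = 0 survives, so the modulus is exact. A lower bound for the Gauss sum
  is what the construction of points with large sums rests on.\<close>

lemma gauss_sum_norm_odd:
  assumes "q > 0" "coprime a q" "odd q"
  shows "norm (gauss_sum a b q) = sqrt (of_int q)"
proof -
  have dvd_iff: "q dvd 2 * a * h \<longleftrightarrow> h = 0" if "h \<in> {0..<q}" for h
  proof -
    have "coprime (2 * a) q"
      using assms(2,3) by (simp add: coprime_commute)
    then have "q dvd 2 * a * h \<longleftrightarrow> q dvd h"
      by (metis coprime_commute coprime_dvd_mult_right_iff)
    then show ?thesis
      using that by (auto dest: zdvd_imp_le)
  qed
  have "complex_of_real ((norm (gauss_sum a b q))^2) = (\<Sum>h\<in>{0..<q}. if h = 0 then of_int q else 0)"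
    unfolding gauss_sum_norm_square[OF assms(1)]
    by (intro sum.cong refl) (simp only: dvd_iff, simp)
  also have "\<dots> = complex_of_real (of_int q)"
    using assms(1) by simp
  finally have "(norm (gauss_sum a b q))^2 = of_int q"
    by (simp only: of_real_eq_iff)
  then show ?thesis by (metis norm_ge_zero real_sqrt_unique)
qed

text \<open>Fourier inversion on Z/q: the coefficient of the quadratic phase at frequency j is a
  Gauss sum with shifted linear term, so every coefficient has size at most about q^(-1/2).\<close>

lemma e_quadratic_fourier:
  assumes "q > 0"
  shows "e (of_int (a * n^2 + b * n) / of_int q) =
    (\<Sum>j\<in>{0..<q}. gauss_sum a (b - j) q / of_int q * e (of_int (j * n) / of_int q))"
proof -
  let ?P = "\<lambda>m::int. a * m^2 + b * m"
  have "(\<Sum>j\<in>{0..<q}. gauss_sum a (b - j) q * e (of_int (j * n) / of_int q))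
      = (\<Sum>j\<in>{0..<q}. \<Sum>m\<in>{0..<q}. e (of_int (?P m) / of_int q) * e (of_int ((n - m) * j) / of_int q))"
    unfolding gauss_sum_def sum_distrib_right
    by (intro sum.cong refl)
      (simp add: e_add[symmetric] add_divide_distrib[symmetric] algebra_simps)
  also have "\<dots> = (\<Sum>m\<in>{0..<q}. e (of_int (?P m) / of_int q) * (if q dvd n - m then of_int q else 0))"
    by (subst sum.swap) (simp only: sum_distrib_left[symmetric] sum_e_orthogonal[OF assms])
  also have "\<dots> = (\<Sum>m\<in>{0..<q}. if m = n mod q then e (of_int (?P m) / of_int q) * of_int q else 0)"
  proof (intro sum.cong refl)
    fix m assume "m \<in> {0..<q}"
    then have "q dvd n - m \<longleftrightarrow> m = n mod q"
      by (metis atLeastLessThan_iff mod_eq_dvd_iff mod_pos_pos_trivial)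
    then show "e (of_int (?P m) / of_int q) * (if q dvd n - m then of_int q else 0)
      = (if m = n mod q then e (of_int (?P m) / of_int q) * of_int q else 0)" by simp
  qed
  also have "\<dots> = e (of_int (?P (n mod q)) / of_int q) * of_int q"
    using assms by simp
  also have "e (of_int (?P (n mod q)) / of_int q) = e (of_int (?P n) / of_int q)"
    by (intro e_frac_cong assms quadratic_mod)
  finally show ?thesis
    using assms by (simp add: sum_divide_distrib[symmetric] field_simps)
qed

section \<open>Quadratic Weyl sums and rational approximation\<close>

definition quad_sum :: "real \<Rightarrow> real \<Rightarrow> nat \<Rightarrow> complex" where
  "quad_sum x y N = (\<Sum>n=1..<Suc N. e (x * real n + y * (real n)^2))"

lemma quad_sum_norm_le: "norm (quad_sum x y N) \<le> real N"
  unfolding quad_sum_def by (rule order_trans[OF norm_sum]) simp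

lemma harm_le_ln: "harm n \<le> 1 + ln (real n)" if "n > 0"
  using that
proof (induction n rule: nat_induct_non_zero)
  case (Suc n)
  have "inverse (real (Suc n)) \<le> ln (real (Suc n)) - ln (real n)"
  proof -
    have "ln (real n / real (Suc n)) \<le> real n / real (Suc n) - 1"
      using Suc by (intro ln_le_minus_one) auto
    also have "\<dots> = - inverse (real (Suc n))"
      by (simp add: field_simps)
    finally show ?thesis using Suc by (simp add: ln_div)
  qed
  then show ?case using Suc by (simp add: harm_Suc)
qed (simp add: harm_def)

lemma sum_inverse_dist_le_harm:
  fixes q :: nat
  shows "(\<Sum>j\<in>{1..<int q}. 4 * real q / of_int j + 4 * real q / of_int (int q - j)) \<le> 8 * real q * harm q"
proof -
  have rev: "(\<Sum>j\<in>{1..<int q}. 4 * real q / of_int (int q - j)) = (\<Sum>j\<in>{1..<int q}. 4 * real q / of_int j)"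
    by (rule sum.reindex_bij_witness[where i = "\<lambda>j. int q - j" and j = "\<lambda>j. int q - j"]) auto
  have "(\<Sum>j\<in>{1..<int q}. 4 * real q / of_int j) = (\<Sum>j\<in>{1..<q}. 4 * real q / real j)"
    by (rule sum.reindex_bij_witness[where i = int and j = nat]) auto
  also have "\<dots> \<le> (\<Sum>j\<in>{1..q}. 4 * real q / real j)"
    by (rule sum_mono2) auto
  also have "\<dots> = 4 * real q * harm q"
    by (simp add: harm_def sum_distrib_left divide_inverse)
  finally show ?thesis
    by (simp only: sum.distrib rev)
qed

text \<open>The Fourier expansion of the rational quadratic phase turns the sum into \<open>q\<close> sums
  with slowly varying phase; all but one of them are bounded by Kuzmin--Landau.\<close>

lemma quad_sum_approx:
  fixes q N :: nat and a1 a2 :: int and \<theta> \<beta> :: real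
  assumes q: "q > 0" and cop: "coprime a2 (int q)"
    and \<theta>: "\<bar>\<theta>\<bar> \<le> 1 / (2 * q)" and \<beta>: "\<bar>\<beta>\<bar> * (2 * real N + 1) \<le> 1 / (8 * q)"
  shows "norm (quad_sum (a1 / q + \<theta>) (a2 / q + \<beta>) N - gauss_sum a2 a1 q / q * quad_sum \<theta> \<beta> N)
           \<le> 12 * sqrt q * harm q"
proof -
  define c where "c j = gauss_sum a2 (a1 - j) q / of_int (int q)" for j
  define T where "T j = quad_sum (\<theta> + of_int j / q) \<beta> N" for j :: int
  have iq: "int q > 0" using q by simp
  have expand: "e ((a1 / q + \<theta>) * real n + (a2 / q + \<beta>) * (real n)^2) =
      (\<Sum>j\<in>{0..<int q}. c j * e ((\<theta> + of_int j / q) * real n + \<beta> * (real n)^2))" for n :: nat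
  proof -
    have "(a1 / q + \<theta>) * real n + (a2 / q + \<beta>) * (real n)^2
      = of_int (a2 * (int n)^2 + a1 * int n) / of_int (int q) + (\<theta> * real n + \<beta> * (real n)^2)"
      using q by (simp add: field_simps)
    then have "e ((a1 / q + \<theta>) * real n + (a2 / q + \<beta>) * (real n)^2)
      = (\<Sum>j\<in>{0..<int q}. c j * e (of_int (j * int n) / of_int (int q))) * e (\<theta> * real n + \<beta> * (real n)^2)"
      by (simp only: e_add e_quadratic_fourier[OF iq] c_def)
    also have "\<dots> = (\<Sum>j\<in>{0..<int q}. c j * e ((\<theta> + of_int j / q) * real n + \<beta> * (real n)^2))"
      unfolding sum_distrib_right
      by (intro sum.cong refl) (simp add: mult.assoc e_add[symmetric] algebra_simps)
    finally show ?thesis .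
  qed
  have "quad_sum (a1 / q + \<theta>) (a2 / q + \<beta>) N = (\<Sum>j\<in>{0..<int q}. c j * T j)"
    unfolding quad_sum_def T_def expand sum_distrib_left by (rule sum.swap)
  also have "{0..<int q} = insert 0 {1..<int q}"
    using q by auto
  also have "(\<Sum>j\<in>\<dots>. c j * T j) = c 0 * T 0 + (\<Sum>j\<in>{1..<int q}. c j * T j)"
    by (subst sum.insert) auto
  finally have "quad_sum (a1 / q + \<theta>) (a2 / q + \<beta>) N - gauss_sum a2 a1 q / q * quad_sum \<theta> \<beta> N
      = (\<Sum>j\<in>{1..<int q}. c j * T j)"
    by (simp add: c_def T_def)
  also have "norm \<dots> \<le> (\<Sum>j\<in>{1..<int q}. sqrt (2 * q) / q * (4 * real q / of_int j + 4 * real q / of_int (int q - j)))"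
  proof (rule order_trans[OF norm_sum sum_mono])
    fix j assume j: "j \<in> {1..<int q}"
    have c_le: "norm (c j) \<le> sqrt (2 * q) / q"
      using gauss_sum_norm_le[OF iq cop, of "a1 - j"] q
      by (simp add: c_def norm_divide divide_right_mono)
    \<comment> \<open>A quarter of the distance from j/q to the nearest integer. The perturbation of
      the increments is at most (1/2 + 1/8)/q = (5/8)/q, and k - 5/8 >= k/4 for every integer k >=
      1, applied to k = j and k = q - j.\<close>
    define d where "d = min (of_int j) (real q - of_int j) / (4 * q)"
    have d: "d > 0" using j q by (simp add: d_def)
    have "norm (T j) \<le> 1 / d"
      unfolding T_def quad_sum_def
    proof (rule kuzmin_landau_quadratic[OF d])
      fix n assume n: "1 \<le> n" "n < Suc N"
      have "\<bar>\<beta> * (2 * real n + 1)\<bar> \<le> \<bar>\<beta>\<bar> * (2 * real N + 1)"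
        unfolding abs_mult using n by (intro mult_left_mono) auto
      also note \<beta>
      finally have "\<bar>\<theta> + \<beta> * (2 * real n + 1)\<bar> \<le> 1 / (2 * q) + 1 / (8 * q)"
        using \<theta> by linarith
      also have "\<dots> = (5/8) / q" by (simp add: field_simps)
      finally have B: "\<bar>\<theta> + \<beta> * (2 * real n + 1)\<bar> \<le> (5/8) / q" .
      have "d \<le> (of_int j - 5/8) / q"
      proof -
        have "d \<le> of_int j / (4 * q)" unfolding d_def
          by (intro divide_right_mono) auto
        also have "\<dots> \<le> (of_int j - 5/8) / q"
          using j q by (simp add: field_simps)
        finally show ?thesis .
      qed
      moreover have "d \<le> (real q - of_int j - 5/8) / q"
      proof -
        have "d \<le> (real q - of_int j) / (4 * q)" unfolding d_def
          by (intro divide_right_mono) auto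
        also have "\<dots> = ((real q - of_int j) / 4) / q"
          by simp
        also have "\<dots> \<le> (real q - of_int j - 5/8) / q"
          by (rule divide_right_mono) (use j in auto)
        finally show ?thesis .
      qed
      moreover have "(real q - of_int j - 5/8) / q = 1 - of_int j / q - (5/8) / q"
          "(of_int j - 5/8) / q = of_int j / q - (5/8) / q"
        using q by (simp_all add: field_simps)
      ultimately show "d \<le> \<theta> + of_int j / q + \<beta> * (2 * real n + 1) \<and>
          \<theta> + of_int j / q + \<beta> * (2 * real n + 1) \<le> 1 - d"
        using B by linarith
    qed
    also have "1 / d = 4 * q / min (of_int j) (real q - of_int j)"
      by (simp add: d_def)
    also have "\<dots> \<le> 4 * real q / of_int j + 4 * real q / of_int (int q - j)"
      using j q by (simp add: min_def)
    finally show "norm (c j * T j) \<le> sqrt (2 * q) / q * (4 * real q / of_int j + 4 * real q / of_int (int q - j))"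
      unfolding norm_mult by (intro mult_mono c_le) auto
  qed
  also have "\<dots> \<le> sqrt (2 * q) / q * (8 * real q * harm q)"
    unfolding sum_distrib_left[symmetric] by (intro mult_left_mono sum_inverse_dist_le_harm) auto
  also have "\<dots> = (8 * sqrt 2) * sqrt q * harm q"
    using q by (simp add: real_sqrt_mult)
  also have "\<dots> \<le> 12 * sqrt q * harm q"
  proof (intro mult_right_mono harm_nonneg)
    have "sqrt 2 \<le> 3/2" by (rule real_le_lsqrt) (auto simp: power2_eq_square)
    then show "8 * sqrt 2 \<le> 12" by simp
  qed auto
  finally show ?thesis .
qed

section \<open>First and second derivative tests for slowly varying quadratic phases\<close>

lemma quad_sum_first_derivative:
  assumes "\<theta> \<noteq> 0" "\<bar>\<theta>\<bar> \<le> 1/2" and \<beta>: "\<bar>\<beta>\<bar> * (2 * real N + 1) \<le> \<bar>\<theta>\<bar> / 2"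
  shows "norm (quad_sum \<theta> \<beta> N) \<le> 2 / \<bar>\<theta>\<bar>"
proof -
  \<comment> \<open>The drift is at most half of \<theta>, so the increments keep the sign of
    \<theta> and have modulus between |\<theta>|/2 and 3|\<theta>|/2; the latter is at most 1 -
    |\<theta>|/2 because |\<theta>| <= 1/2.\<close>
  have B: "\<bar>\<beta> * (2 * real n + 1)\<bar> \<le> \<bar>\<theta>\<bar> / 2" if "n < Suc N" for n
  proof -
    have "\<bar>\<beta> * (2 * real n + 1)\<bar> \<le> \<bar>\<beta>\<bar> * (2 * real N + 1)"
      unfolding abs_mult using that by (intro mult_left_mono) auto
    with \<beta> show ?thesis by linarith
  qed
  have "norm (quad_sum \<theta> \<beta> N) \<le> 1 / (\<bar>\<theta>\<bar> / 2)"
  proof (cases "\<theta> > 0")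
    case True
    show ?thesis unfolding quad_sum_def
    proof (rule kuzmin_landau_quadratic)
      fix n assume "n < Suc N"
      from B[OF this] show "\<bar>\<theta>\<bar> / 2 \<le> \<theta> + \<beta> * (2 * real n + 1) \<and> \<theta> + \<beta> * (2 * real n + 1) \<le> 1 - \<bar>\<theta>\<bar> / 2"
        using True assms by linarith
    qed (use assms in auto)
  next
    case False
    show ?thesis unfolding quad_sum_def
    proof (rule kuzmin_landau_quadratic_neg)
      fix n assume "n < Suc N"
      from B[OF this] show "\<theta> + \<beta> * (2 * real n + 1) \<le> - (\<bar>\<theta>\<bar> / 2) \<and> \<bar>\<theta>\<bar> / 2 - 1 \<le> \<theta> + \<beta> * (2 * real n + 1)"
        using False assms by linarith
    qed (use assms in auto)
  qed
  then show ?thesis by simp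
qed

text \<open>A downward closed condition cuts {1..<K} at one place m, with m = K if it always holds.
  It serves to split a sum where increasing phase increments cross a threshold.\<close>

lemma ex_initial_segment:
  fixes K :: nat
  assumes "1 \<le> K" "\<And>n. P (Suc n) \<Longrightarrow> P n"
  shows "\<exists>m. 1 \<le> m \<and> m \<le> K \<and> (\<forall>n. 1 \<le> n \<longrightarrow> n < K \<longrightarrow> (P n \<longleftrightarrow> n < m))"
  using assms(1)
proof (induction K rule: dec_induct)
  case base
  then show ?case by (intro exI[of _ 1]) auto
next
  case (step K)
  then obtain m where m: "1 \<le> m" "m \<le> K" "\<forall>n. 1 \<le> n \<longrightarrow> n < K \<longrightarrow> (P n \<longleftrightarrow> n < m)" by auto
  show ?case
  proof (cases "P K")
    case True
    have "P n" if "n \<le> K" for n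
      using that True by (induction rule: inc_induct) (auto intro: assms(2))
    then show ?thesis by (intro exI[of _ "Suc K"]) auto
  next
    case False
    with m show ?thesis by (intro exI[of _ m]) (auto simp: less_Suc_eq)
  qed
qed

text \<open>The increments rise by 2\<beta> per step. With s = sqrt \<beta> at most 1/s + 1 of them
  lie in [-s, s], and those terms are bounded trivially; on either side Kuzmin--Landau gives 1/s.
  This s balances the two kinds of contribution.\<close>

lemma quad_sum_second_derivative_pos:
  assumes "\<beta> > 0" "\<bar>\<theta>\<bar> \<le> 1/2" and \<beta>: "\<beta> * (2 * real N + 1) \<le> 1 / 8"
  shows "norm (quad_sum \<theta> \<beta> N) \<le> 4 / sqrt \<beta>"
proof (cases "N = 0")
  case True
  then show ?thesis using assms by (simp add: quad_sum_def)
next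
  case False
  define g where "g n = \<theta> + \<beta> * (2 * real n + 1)" for n
  define s where "s = sqrt \<beta>"
  have s: "s > 0" "s^2 = \<beta>" using assms by (auto simp: s_def)
  have "\<beta> * 2 \<le> \<beta> * (2 * real N + 1)"
    using assms False by (intro mult_left_mono) auto
  then have "\<beta> \<le> (1/4)^2" using \<beta> by (simp add: power2_eq_square)
  then have s4: "s \<le> 1/4" unfolding s_def by (intro real_le_lsqrt) auto
  \<comment> \<open>Together with s <= 1/4 this keeps |g n| below 1 - s, the other condition of
    Kuzmin--Landau.\<close>
  have g_le: "\<bar>g n\<bar> \<le> 5/8" if "n < Suc N" for n
  proof -
    have "\<beta> * (2 * real n + 1) \<le> \<beta> * (2 * real N + 1)"
      using that assms by (intro mult_left_mono) auto
    moreover have "\<beta> * (2 * real n + 1) \<ge> 0" using assms by simp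
    ultimately show ?thesis using \<beta> assms(2) unfolding g_def by linarith
  qed
  have g_Suc: "g n \<le> g (Suc n)" for n
    using assms by (simp add: g_def)
  have "\<exists>m. 1 \<le> m \<and> m \<le> Suc N \<and> (\<forall>n. 1 \<le> n \<longrightarrow> n < Suc N \<longrightarrow> (g n < - s \<longleftrightarrow> n < m))"
    by (rule ex_initial_segment) (use g_Suc order_le_less_trans in auto)
  then obtain m1 where m1: "1 \<le> m1" "m1 \<le> Suc N" "\<And>n. 1 \<le> n \<Longrightarrow> n < Suc N \<Longrightarrow> g n < - s \<longleftrightarrow> n < m1" by blast
  have "\<exists>m. 1 \<le> m \<and> m \<le> Suc N \<and> (\<forall>n. 1 \<le> n \<longrightarrow> n < Suc N \<longrightarrow> (g n \<le> s \<longleftrightarrow> n < m))"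
    by (rule ex_initial_segment) (use g_Suc order_trans in auto)
  then obtain m2 where m2: "1 \<le> m2" "m2 \<le> Suc N" "\<And>n. 1 \<le> n \<Longrightarrow> n < Suc N \<Longrightarrow> g n \<le> s \<longleftrightarrow> n < m2" by blast
  have "m1 \<le> m2"
  proof (rule ccontr)
    assume "\<not> m1 \<le> m2"
    then have "g m2 < - s" using m1 m2 by auto
    then have "g m2 \<le> s" using s by linarith
    then show False using m2 \<open>\<not> m1 \<le> m2\<close> m1 by auto
  qed
  have middle: "real (m2 - m1) \<le> 1 / s + 1"
  proof (cases "m1 < m2")
    case True
    have "g (m2 - 1) \<le> s" using m2(3)[of "m2 - 1"] m1 m2 True by auto
    moreover have "\<not> g m1 < - s"
      using m1(1) m1(3)[of m1] m2(2) True by auto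
    ultimately have "g (m2 - 1) - g m1 \<le> 2 * s" by linarith
    moreover have "g (m2 - 1) - g m1 = 2 * (s * s) * (real (m2 - m1) - 1)"
      using True s(2) by (simp add: g_def of_nat_diff algebra_simps power2_eq_square)
    ultimately have "s * (s * (real (m2 - m1) - 1)) \<le> s * 1" by (simp add: algebra_simps)
    then have "s * (real (m2 - m1) - 1) \<le> 1" using s(1) by (simp only: mult_le_cancel_left_pos)
    then show ?thesis using s(1) by (simp add: field_simps)
  next
    case False
    then show ?thesis using s by simp
  qed
  let ?f = "\<lambda>n. e (\<theta> * real n + \<beta> * (real n)^2)"
  have 1: "norm (\<Sum>n=1..<m1. ?f n) \<le> 1 / s"
  proof (rule kuzmin_landau_quadratic_neg[OF s(1)], unfold g_def[symmetric])
    fix n assume "1 \<le> n" "n < m1"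
    then show "g n \<le> - s \<and> s - 1 \<le> g n"
      using m1(3)[of n] m1(2) g_le[of n] s4 by auto
  qed
  have 2: "norm (\<Sum>n=m1..<m2. ?f n) \<le> 1 / s + 1"
    by (rule order_trans[OF norm_sum]) (use middle in simp)
  have 3: "norm (\<Sum>n=m2..<Suc N. ?f n) \<le> 1 / s"
  proof (rule kuzmin_landau_quadratic[OF s(1)], unfold g_def[symmetric])
    fix n assume n: "m2 \<le> n" "n < Suc N"
    then have "\<not> g n \<le> s" using m2(1) m2(3)[of n] by auto
    then show "s \<le> g n \<and> g n \<le> 1 - s"
      using g_le[OF n(2)] s4 by linarith
  qed
  have "quad_sum \<theta> \<beta> N = (\<Sum>n=1..<m1. ?f n) + (\<Sum>n=m1..<m2. ?f n) + (\<Sum>n=m2..<Suc N. ?f n)"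
    unfolding quad_sum_def using m1 m2 \<open>m1 \<le> m2\<close> by (simp add: sum.atLeastLessThan_concat del: sum.op_ivl_Suc)
  also have "norm \<dots> \<le> 1 / s + (1 / s + 1) + 1 / s"
    by (intro norm_triangle_mono 1 2 3)
  also have "\<dots> \<le> 4 / s"
    using s s4 by (simp add: field_simps)
  finally show ?thesis by (simp add: s_def)
qed

lemma quad_sum_second_derivative:
  assumes "\<beta> \<noteq> 0" "\<bar>\<theta>\<bar> \<le> 1/2" "\<bar>\<beta>\<bar> * (2 * real N + 1) \<le> 1 / 8"
  shows "norm (quad_sum \<theta> \<beta> N) \<le> 4 / sqrt \<bar>\<beta>\<bar>"
proof (cases "\<beta> > 0")
  case True
  then show ?thesis using quad_sum_second_derivative_pos[of \<beta> \<theta> N] assms by simp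
next
  case False
  have "norm (quad_sum \<theta> \<beta> N) = norm (quad_sum (-\<theta>) (-\<beta>) N)"
    unfolding quad_sum_def using norm_cnj_e_sum[of "\<lambda>n. \<theta> * real n + \<beta> * (real n)^2"]
    by (simp del: sum.op_ivl_Suc)
  then show ?thesis using quad_sum_second_derivative_pos[of "-\<beta>" "-\<theta>" N] assms False by simp
qed

text \<open>Largeness forces A sqrt q <= 3 T, with A = N^\<alpha> and T the modulus of the slowly
  varying sum. Each upper bound for T yields one conclusion: the trivial bound N limits q, the
  second derivative test limits \<beta>, the first derivative test limits \<theta>. When \<beta> is
  too large for the last, \<theta> is already dominated by N\<beta>. The constants obtained are 9,
  144 and 864; 1000 exceeds them all.\<close>

lemma weyl_large_imp_rational:
  fixes \<alpha> :: real
  assumes "1/2 < \<alpha>" "\<alpha> < 1"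
  shows "\<exists>N0. \<forall>N\<ge>N0. \<forall>x y. real N powr \<alpha> \<le> norm (quad_sum x y N) \<longrightarrow>
    (\<exists>(q::nat) (a1::int) (a2::int). q > 0 \<and> real q \<le> 1000 * real N powr (2 - 2 * \<alpha>) \<and>
      \<bar>x - a1 / q\<bar> \<le> 1000 * real N powr (1 - 2 * \<alpha>) / q \<and>
      \<bar>y - a2 / q\<bar> \<le> 1000 * real N powr (- 2 * \<alpha>) / q)"
proof -
  \<comment> \<open>The approximation error for the largest denominator 24 N; this is where \<alpha>
    > 1/2 is needed.\<close>
  have "eventually (\<lambda>N. 12 * sqrt (24 * real N) * (1 + ln (24 * real N)) \<le> real N powr \<alpha> / 2) sequentially"
    using assms by real_asymp
  then obtain N1 where N1: "\<And>N. N \<ge> N1 \<Longrightarrow> 12 * sqrt (24 * real N) * (1 + ln (24 * real N)) \<le> real N powr \<alpha> / 2"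
    by (auto simp: eventually_sequentially)
  show ?thesis
  proof (rule exI[of _ "max N1 1"], intro allI impI)
    fix N x y
    assume N: "max N1 1 \<le> N" and large: "real N powr \<alpha> \<le> norm (quad_sum x y N)"
    \<comment> \<open>The factor 24 = 8 * 3 comes from the condition on \<beta> in
      \<open>quad_sum_approx\<close>: |\<beta>| < 1/(24 N q) and 2N + 1 <= 3N give 1/(8q).\<close>
    obtain h k where hk: "coprime h k" "0 < k" "k \<le> int (24 * N)" "\<bar>of_int k * y - of_int h\<bar> < 1 / real (24 * N)"
      by (rule Dirichlet_approx_coprime[of "24 * N" y]) (use N in auto)
    define q where "q = nat k"
    have q: "q > 0" "int q = k" "q \<le> 24 * N" using hk by (auto simp: q_def)
    define a1 where "a1 = round (real q * x)"
    define \<theta> where "\<theta> = x - a1 / q"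
    define \<beta> where "\<beta> = y - h / q"
    define A where "A = real N powr \<alpha>"
    define T where "T = norm (quad_sum \<theta> \<beta> N)"
    have Npos: "real N \<ge> 1" using N by simp
    have A: "A > 0" using Npos by (simp add: A_def)
    have "\<bar>real q * x - a1\<bar> \<le> 1/2"
      unfolding a1_def by (metis abs_minus_commute of_int_round_abs_le)
    moreover have "real q * x - a1 = q * \<theta>"
      using q by (simp add: \<theta>_def field_simps)
    ultimately have \<theta>: "\<bar>\<theta>\<bar> \<le> 1 / (2 * q)"
      using q by (simp add: abs_mult field_simps)
    have "of_int k * y - of_int h = q * \<beta>"
      using q by (simp add: \<beta>_def field_simps flip: q(2))
    then have "\<bar>\<beta>\<bar> < 1 / (24 * N) / q"
      using hk(4) q Npos by (simp add: abs_mult field_simps)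
    then have "\<bar>\<beta>\<bar> * (2 * real N + 1) \<le> 1 / (24 * N) / q * (3 * N)"
      using Npos by (intro mult_mono) auto
    also have "\<dots> = 1 / (8 * q)" using Npos by simp
    finally have \<beta>: "\<bar>\<beta>\<bar> * (2 * real N + 1) \<le> 1 / (8 * q)" .
    have xy: "x = a1 / q + \<theta>" "y = h / q + \<beta>" by (auto simp: \<theta>_def \<beta>_def)
    have "norm (quad_sum x y N - gauss_sum h a1 q / q * quad_sum \<theta> \<beta> N) \<le> 12 * sqrt q * harm q"
      unfolding xy by (rule quad_sum_approx) (use q hk \<theta> \<beta> in auto)
    also have "\<dots> \<le> 12 * sqrt (24 * N) * (1 + ln (24 * N))"
    proof (intro mult_mono)
      have "harm q \<le> 1 + ln q" using q by (intro harm_le_ln)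
      also have "ln q \<le> ln (24 * N)" using q Npos by simp
      finally show "harm q \<le> 1 + ln (24 * N)" by simp
    qed (use q in \<open>auto intro: harm_nonneg\<close>)
    also have "\<dots> \<le> A / 2" using N1[of N] N by (simp add: A_def)
    finally have "A / 2 \<le> norm (gauss_sum h a1 q / q * quad_sum \<theta> \<beta> N)"
      using large norm_triangle_ineq2[of "quad_sum x y N" "gauss_sum h a1 q / q * quad_sum \<theta> \<beta> N"]
      unfolding A_def by linarith
    also have "\<dots> = norm (gauss_sum h a1 q) / q * T"
      by (simp add: norm_mult norm_divide T_def)
    also have "\<dots> \<le> sqrt (2 * q) / q * T"
      using gauss_sum_norm_le[of q h a1] q hk(1)
      by (intro mult_right_mono divide_right_mono) (auto simp: T_def)
    also have "\<dots> = sqrt 2 * T / sqrt q"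
      using q by (simp add: real_sqrt_mult field_simps)
    finally have "A * sqrt q \<le> 2 * sqrt 2 * T"
      using q by (simp add: field_simps)
    also have "\<dots> \<le> 3 * T"
    proof (intro mult_right_mono)
      have "sqrt 2 \<le> 3/2" by (rule real_le_lsqrt) (auto simp: power2_eq_square)
      then show "2 * sqrt 2 \<le> 3" by simp
    qed (simp add: T_def)
    finally have AT: "A * sqrt q \<le> 3 * T" .
    have "3 * T \<le> 3 * N" using quad_sum_norm_le[of \<theta> \<beta> N] by (simp add: T_def)
    then have "A * sqrt q \<le> 3 * N" using AT by linarith
    then have sq: "sqrt q \<le> 3 * (N / A)" using A by (simp add: field_simps)
    have NA: "N / A = N powr (1 - \<alpha>)"
      using Npos by (simp add: A_def powr_diff)
    have "real q = (sqrt q)^2" by simp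
    also have "\<dots> \<le> (3 * (N / A))^2"
      using sq by (intro power_mono) auto
    also have "\<dots> = 9 * N powr (2 - 2 * \<alpha>)"
      unfolding NA power_mult_distrib using Npos by (simp add: power2_eq_square flip: powr_add)
    also have "\<dots> \<le> 1000 * N powr (2 - 2 * \<alpha>)" by simp
    finally have c1: "real q \<le> 1000 * N powr (2 - 2 * \<alpha>)" .
    have \<theta>12: "\<bar>\<theta>\<bar> \<le> 1/2"
      using \<theta> q by (rule_tac order_trans[OF \<theta>]) (simp add: field_simps)
    have \<beta>8: "\<bar>\<beta>\<bar> * (2 * real N + 1) \<le> 1 / 8"
      using q by (rule_tac order_trans[OF \<beta>]) (simp add: field_simps)
    have c2': "\<bar>\<beta>\<bar> \<le> 144 / (A^2 * q)"
    proof (cases "\<beta> = 0")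
      case False
      have "T \<le> 4 / sqrt \<bar>\<beta>\<bar>"
        unfolding T_def by (rule quad_sum_second_derivative) (use False \<theta>12 \<beta>8 in auto)
      then have "A * sqrt q \<le> 12 / sqrt \<bar>\<beta>\<bar>" using AT by simp
      then have "A * sqrt q * sqrt \<bar>\<beta>\<bar> \<le> 12" using False by (simp add: field_simps)
      then have "(A * sqrt q * sqrt \<bar>\<beta>\<bar>)^2 \<le> 12^2" using A by (intro power_mono) auto
      then show ?thesis using A q by (simp add: power_mult_distrib field_simps)
    qed (use q A in auto)
    have A2: "1 / A^2 = N powr (- 2 * \<alpha>)"
      using Npos by (simp add: A_def power2_eq_square powr_minus divide_inverse flip: powr_add)
    have NA2: "N / A^2 = N powr (1 - 2 * \<alpha>)"
      using Npos by (simp add: A_def power2_eq_square powr_diff flip: powr_add)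
    have "\<bar>\<beta>\<bar> \<le> 144 * N powr (- 2 * \<alpha>) / q"
      using c2' unfolding A2[symmetric] by simp
    also have "\<dots> \<le> 1000 * N powr (- 2 * \<alpha>) / q"
      by (intro divide_right_mono mult_right_mono) auto
    finally have c2: "\<bar>\<beta>\<bar> \<le> 1000 * N powr (- 2 * \<alpha>) / q" .
    have c3': "\<bar>\<theta>\<bar> \<le> 864 * (N / A^2) / q"
    proof (cases "\<bar>\<beta>\<bar> * (2 * real N + 1) \<le> \<bar>\<theta>\<bar> / 2")
      case True
      show ?thesis
      proof (cases "\<theta> = 0")
        case False
        have "T \<le> 2 / \<bar>\<theta>\<bar>"
          unfolding T_def by (rule quad_sum_first_derivative) (use False \<theta>12 True in auto)
        then have "A * sqrt q \<le> 6 / \<bar>\<theta>\<bar>" using AT by simp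
        \<comment> \<open>The derivative test alone controls only |\<theta>| sqrt q; the bound
          already found for sqrt q supplies the other half of the factor 1/q.\<close>
        then have "A * sqrt q * sqrt q \<le> 6 / \<bar>\<theta>\<bar> * (3 * (N / A))"
          by (intro mult_mono sq) auto
        then have "(A * q) * \<bar>\<theta>\<bar> \<le> (18 * (N / A) / \<bar>\<theta>\<bar>) * \<bar>\<theta>\<bar>"
          by (intro mult_right_mono) (auto simp: mult_ac)
        then have "\<bar>\<theta>\<bar> * A * q \<le> 18 * (N / A)"
          using False by (simp add: mult_ac)
        then have "\<bar>\<theta>\<bar> * q \<le> 18 * (N / A^2)"
          using A by (simp add: field_simps power2_eq_square)
        also have "\<dots> \<le> 864 * (N / A^2)" by (intro mult_right_mono) auto
        finally show ?thesis
          by (subst pos_le_divide_eq) (use q in auto)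
      qed auto
    next
      case False
      then have "\<bar>\<theta>\<bar> \<le> 2 * (\<bar>\<beta>\<bar> * (2 * real N + 1))" by linarith
      also have "\<dots> \<le> 2 * (144 / (A^2 * q) * (3 * N))"
        using Npos by (intro mult_mono c2') auto
      also have "\<dots> = 864 * (N / A^2) / q" by simp
      finally show ?thesis .
    qed
    also have "\<dots> \<le> 1000 * (N / A^2) / q"
      by (intro divide_right_mono mult_right_mono) auto
    finally have c3: "\<bar>\<theta>\<bar> \<le> 1000 * N powr (1 - 2 * \<alpha>) / q"
      unfolding NA2 .
    show "\<exists>(q::nat) (a1::int) (a2::int). q > 0 \<and> real q \<le> 1000 * real N powr (2 - 2 * \<alpha>) \<and>
      \<bar>x - a1 / q\<bar> \<le> 1000 * real N powr (1 - 2 * \<alpha>) / q \<and>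
      \<bar>y - a2 / q\<bar> \<le> 1000 * real N powr (- 2 * \<alpha>) / q"
      using q(1) c1 c2 c3 unfolding \<theta>_def \<beta>_def by blast
  qed
qed

text \<open>So close to the rational point all phases are at most 1/18, hence every term has real
  part at least 1/2 and the slowly varying sum is at least N/2. Since 36 = 6^2, sqrt q <=
  N^(1-\<alpha>)/6, so the main term is at least 3 N^\<alpha>. The error, at most 2 N^(1-\<alpha>)
  (1 + ln N), takes away no more than N^\<alpha>.\<close>

lemma weyl_large_near_rational:
  fixes \<alpha> :: real
  assumes "1/2 < \<alpha>" "\<alpha> < 1"
  shows "\<exists>N0. \<forall>N\<ge>N0. \<forall>(q::nat) (a1::int) (a2::int) x y.
    odd q \<longrightarrow> coprime a2 (int q) \<longrightarrow> real q \<le> real N powr (2 - 2 * \<alpha>) / 36 \<longrightarrow>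
    \<bar>x - a1 / q\<bar> \<le> 1 / (36 * real N) \<longrightarrow> \<bar>y - a2 / q\<bar> \<le> 1 / (36 * (real N)^2) \<longrightarrow>
    real N powr \<alpha> \<le> norm (quad_sum x y N)"
proof -
  have "eventually (\<lambda>N. 2 * real N powr (1 - \<alpha>) * (1 + ln (real N)) \<le> real N powr \<alpha>) sequentially"
    using assms by real_asymp
  then obtain N1 where N1: "\<And>N. N \<ge> N1 \<Longrightarrow> 2 * real N powr (1 - \<alpha>) * (1 + ln (real N)) \<le> real N powr \<alpha>"
    by (auto simp: eventually_sequentially)
  show ?thesis
  proof (intro exI[of _ "max N1 1"] allI impI)
    fix N q :: nat and a1 a2 :: int and x y :: real
    assume N: "max N1 1 \<le> N" and q: "odd q" "coprime a2 (int q)" "real q \<le> real N powr (2 - 2 * \<alpha>) / 36"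
      and x: "\<bar>x - a1 / q\<bar> \<le> 1 / (36 * real N)" and y: "\<bar>y - a2 / q\<bar> \<le> 1 / (36 * (real N)^2)"
    define \<theta> where "\<theta> = x - a1 / q"
    define \<beta> where "\<beta> = y - a2 / q"
    have xy: "x = a1 / q + \<theta>" "y = a2 / q + \<beta>" by (auto simp: \<theta>_def \<beta>_def)
    have \<theta>N: "\<bar>\<theta>\<bar> \<le> 1 / (36 * real N)" and \<beta>N: "\<bar>\<beta>\<bar> \<le> 1 / (36 * (real N)^2)"
      using x y by (simp_all add: \<theta>_def \<beta>_def)
    have Npos: "real N \<ge> 1" using N by simp
    have q0: "q > 0" using q(1) by (cases q) auto
    have "N powr (2 - 2 * \<alpha>) \<le> N powr 1"
      using Npos assms by (intro powr_mono) auto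
    then have qN: "real q \<le> N / 36" using q(3) Npos by simp
    have \<theta>: "\<bar>\<theta>\<bar> \<le> 1 / (2 * q)"
      using q0 qN by (intro order_trans[OF \<theta>N] frac_le) auto
    have "\<bar>\<beta>\<bar> * (2 * real N + 1) \<le> 1 / (36 * (real N)^2) * (3 * N)"
      using Npos \<beta>N by (intro mult_mono) auto
    also have "\<dots> = 1 / (12 * N)"
      using Npos by (simp add: power2_eq_square)
    also have "\<dots> \<le> 1 / (8 * q)"
      using q0 qN by (intro frac_le) auto
    finally have \<beta>: "\<bar>\<beta>\<bar> * (2 * real N + 1) \<le> 1 / (8 * q)" .
    have T: "N / 2 \<le> norm (quad_sum \<theta> \<beta> N)"
    proof -
      have "real N / 2 = (\<Sum>n=1..<Suc N. 1/2)" by simp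
      also have "\<dots> \<le> (\<Sum>n=1..<Suc N. Re (e (\<theta> * real n + \<beta> * (real n)^2)))"
      proof (rule sum_mono)
        fix n assume n: "n \<in> {1..<Suc N}"
        have n': "real n \<le> real N" using n by simp
        have "\<bar>\<theta> * real n\<bar> \<le> 1 / (36 * real N) * N"
          unfolding abs_mult by (rule mult_mono) (use \<theta>N n' in auto)
        then have 1: "\<bar>\<theta> * real n\<bar> \<le> 1 / 36" using Npos by simp
        have "\<bar>\<beta> * (real n)^2\<bar> \<le> 1 / (36 * (real N)^2) * N^2"
          unfolding abs_mult by (rule mult_mono) (use \<beta>N n' in \<open>auto intro: power_mono\<close>)
        then have 2: "\<bar>\<beta> * (real n)^2\<bar> \<le> 1 / 36" using Npos by simp
        have *: "\<bar>\<theta> * real n + \<beta> * (real n)^2\<bar> \<le> 1/6"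
          using 1 2 by linarith
        have "cos (pi / 3) \<le> cos \<bar>2 * pi * (\<theta> * real n + \<beta> * (real n)^2)\<bar>"
        proof (rule cos_monotone_0_pi_le)
          have "\<bar>2 * pi * (\<theta> * real n + \<beta> * (real n)^2)\<bar> = 2 * pi * \<bar>\<theta> * real n + \<beta> * (real n)^2\<bar>"
            by (simp add: abs_mult)
          also have "\<dots> \<le> 2 * pi * (1/6)"
            by (intro mult_left_mono *) auto
          finally show "\<bar>2 * pi * (\<theta> * real n + \<beta> * (real n)^2)\<bar> \<le> pi / 3" by simp
        qed auto
        then show "1/2 \<le> Re (e (\<theta> * real n + \<beta> * (real n)^2))"
          by (simp add: e_cis cos_60)
      qed
      also have "\<dots> = Re (quad_sum \<theta> \<beta> N)" by (simp add: quad_sum_def del: sum.op_ivl_Suc)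
      also have "\<dots> \<le> norm (quad_sum \<theta> \<beta> N)" by (rule complex_Re_le_cmod)
      finally show ?thesis .
    qed
    have sq: "sqrt q \<le> N powr (1 - \<alpha>) / 6"
    proof (rule real_le_lsqrt)
      have "(N powr (1 - \<alpha>) / 6)^2 = N powr (2 - 2 * \<alpha>) / 36"
        using Npos by (simp add: power2_eq_square flip: powr_add)
      then show "real q \<le> (N powr (1 - \<alpha>) / 6)^2" using q(3) by simp
    qed auto
    have NA: "N powr (1 - \<alpha>) = N / N powr \<alpha>"
      using Npos by (simp add: powr_diff)
    have "3 * N powr \<alpha> = (N / 2) / (N powr (1 - \<alpha>) / 6)"
      using Npos by (simp add: NA)
    also have "\<dots> \<le> norm (quad_sum \<theta> \<beta> N) / sqrt q"
      using sq T q0 by (intro frac_le) auto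
    also have "\<dots> = norm (gauss_sum a2 a1 q / q * quad_sum \<theta> \<beta> N)"
      using gauss_sum_norm_odd[of q a2 a1] q q0
      by (simp add: norm_mult norm_divide real_div_sqrt field_simps)
    finally have main: "3 * N powr \<alpha> \<le> norm (gauss_sum a2 a1 q / q * quad_sum \<theta> \<beta> N)" .
    have "norm (quad_sum x y N - gauss_sum a2 a1 q / q * quad_sum \<theta> \<beta> N) \<le> 12 * sqrt q * harm q"
      unfolding xy by (rule quad_sum_approx) (use q q0 \<theta> \<beta> in auto)
    also have "\<dots> \<le> 12 * (N powr (1 - \<alpha>) / 6) * (1 + ln N)"
    proof (intro mult_mono sq order_refl)
      have "harm q \<le> 1 + ln q" using q0 by (intro harm_le_ln)
      also have "ln q \<le> ln N" using q0 qN Npos by simp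
      finally show "harm q \<le> 1 + ln N" by simp
    qed (auto intro: harm_nonneg)
    also have "\<dots> \<le> N powr \<alpha>" using N1[of N] N by simp
    finally have "norm (quad_sum x y N - gauss_sum a2 a1 q / q * quad_sum \<theta> \<beta> N) \<le> N powr \<alpha>" .
    then show "N powr \<alpha> \<le> norm (quad_sum x y N)"
      using main norm_triangle_ineq2[of "gauss_sum a2 a1 q / q * quad_sum \<theta> \<beta> N" "quad_sum x y N"]
        powr_ge_zero[of N \<alpha>]
      unfolding norm_minus_commute[of "gauss_sum a2 a1 q / q * quad_sum \<theta> \<beta> N"] by linarith
  qed
qed

section \<open>Upper bounds for Hausdorff measure of limsup sets\<close>

lemma diam_pow_le:
  assumes "s > 0" "bounded U" "diameter U \<le> d"
  shows "diam_pow s U \<le> ennreal (d powr s)"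
  using assms powr_mono2[of s "diameter U" d] diameter_ge_0[of U]
  by (auto simp: diam_pow_def intro!: ennreal_leI)

text \<open>The easy half of Borel--Cantelli: every tail of the families covers \<open>A\<close>,
  the tails of a convergent series become arbitrarily small, and \<delta> k tends to 0. The index
  type is countable so that a tail can be rearranged into the single sequence that
  \<open>delta_cover\<close> requires.\<close>

lemma hausdorff_measure_limsup_zero:
  fixes A :: "'a::metric_space set" and V :: "nat \<Rightarrow> 'b::countable \<Rightarrow> 'a set"
    and d :: "nat \<Rightarrow> 'b \<Rightarrow> real"
  assumes s: "s > 0"
    and cover: "\<And>m. A \<subseteq> (\<Union>k\<in>{m..}. \<Union>i\<in>I k. V k i)"
    and fin: "\<And>k. finite (I k)"
    and V: "\<And>k i. i \<in> I k \<Longrightarrow> bounded (V k i) \<and> diameter (V k i) \<le> d k i \<and> d k i \<le> \<delta> k"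
    and \<delta>: "\<delta> \<longlonglongrightarrow> 0"
    and c: "\<And>k. (\<Sum>i\<in>I k. d k i powr s) \<le> c k" "summable c"
  shows "hausdorff_measure s A = 0"
proof -
  have "hausdorff_content s \<delta>0 A \<le> ennreal \<epsilon>" if "\<delta>0 > 0" "\<epsilon> > 0" for \<delta>0 \<epsilon> :: real
  proof -
    have c0: "c k \<ge> 0" for k
      by (rule order_trans[OF sum_nonneg c(1)]) simp
    have "eventually (\<lambda>k. \<delta> k < \<delta>0) sequentially"
      using \<delta> that(1) by (rule order_tendstoD)
    moreover have "eventually (\<lambda>m. norm (\<Sum>k. c (k + m)) < \<epsilon>) sequentially"
      using suminf_exist_split[OF that(2) c(2)] by (auto simp: eventually_sequentially)
    ultimately have "eventually (\<lambda>m. norm (\<Sum>k. c (k + m)) < \<epsilon> \<and> (\<forall>k\<ge>m. \<delta> k < \<delta>0)) sequentially"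
      by (auto simp: eventually_sequentially) (meson le_trans nle_le)
    then obtain m where m: "norm (\<Sum>k. c (k + m)) < \<epsilon>" "\<And>k. k \<ge> m \<Longrightarrow> \<delta> k < \<delta>0"
      by (auto simp: eventually_sequentially)
    \<comment> \<open>Codes that stand for no index give the empty set, which costs 0 by the
      definition of \<open>diam_pow\<close>.\<close>
    define W where "W k j = (if j \<in> to_nat ` I (k + m) then V (k + m) (from_nat j) else {})" for k j
    define U where "U n = (case prod_decode n of (k, j) \<Rightarrow> W k j)" for n
    have "delta_cover \<delta>0 A U"
      unfolding delta_cover_def
    proof (intro conjI allI subsetI)
      fix x assume "x \<in> A"
      then obtain k i where ki: "k \<ge> m" "i \<in> I k" "x \<in> V k i"
        using cover[of m] by blast
      then have "x \<in> W (k - m) (to_nat i)"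
        by (auto simp: W_def)
      then have "x \<in> U (prod_encode (k - m, to_nat i))"
        by (simp add: U_def)
      then show "x \<in> (\<Union>n. U n)" by blast
    next
      fix n
      obtain k j where kj: "prod_decode n = (k, j)" by (cases "prod_decode n")
      have "bounded (W k j) \<and> diameter (W k j) \<le> \<delta>0"
      proof (cases "j \<in> to_nat ` I (k + m)")
        case True
        then obtain i where "i \<in> I (k + m)" "W k j = V (k + m) i"
          by (auto simp: W_def)
        then show ?thesis using V[of i "k + m"] m(2)[of "k + m"] by force
      qed (use that in \<open>auto simp: W_def\<close>)
      then show "bounded (U n)" "diameter (U n) \<le> \<delta>0" by (auto simp: U_def kj)
    qed
    then have "hausdorff_content s \<delta>0 A \<le> (\<Sum>n. diam_pow s (U n))"
      unfolding hausdorff_content_def by (intro INF_lower) simp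
    also have "\<dots> = (\<Sum>k. \<Sum>j. diam_pow s (W k j))"
    proof -
      have "(\<lambda>n. diam_pow s (U n)) = (\<lambda>(k, j). diam_pow s (W k j)) \<circ> prod_decode"
        by (auto simp: U_def split: prod.split)
      then show ?thesis
        using suminf_ennreal_2dimen[of "\<lambda>k. \<Sum>j. diam_pow s (W k j)" "\<lambda>(k, j). diam_pow s (W k j)"]
        by (simp add: o_def)
    qed
    also have "\<dots> \<le> (\<Sum>k. ennreal (c (k + m)))"
    proof (intro suminf_le allI)
      fix k
      have "(\<Sum>j. diam_pow s (W k j)) = (\<Sum>j\<in>to_nat ` I (k + m). diam_pow s (W k j))"
        by (rule suminf_finite) (auto simp: fin W_def diam_pow_def)
      also have "\<dots> = (\<Sum>i\<in>I (k + m). diam_pow s (W k (to_nat i)))"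
        by (rule sum.reindex_cong[of to_nat]) (auto intro: inj_onI)
      also have "\<dots> \<le> (\<Sum>i\<in>I (k + m). ennreal (d (k + m) i powr s))"
        by (intro sum_mono) (use V in \<open>auto simp: W_def intro!: diam_pow_le s\<close>)
      also have "\<dots> = ennreal (\<Sum>i\<in>I (k + m). d (k + m) i powr s)"
        by (rule sum_ennreal) simp
      also have "\<dots> \<le> ennreal (c (k + m))"
        by (intro ennreal_leI c(1))
      finally show "(\<Sum>j. diam_pow s (W k j)) \<le> ennreal (c (k + m))" .
    qed auto
    also have "\<dots> = ennreal (\<Sum>k. c (k + m))"
      using c0 c(2) by (intro suminf_ennreal2) (auto simp: summable_iff_shift)
    also have "\<dots> \<le> ennreal \<epsilon>"
      using m(1) by (intro ennreal_leI) auto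
    finally show ?thesis .
  qed
  then have "hausdorff_content s \<delta>0 A = 0" if "\<delta>0 > 0" for \<delta>0 :: real
    using that by (metis ennreal_zero_less_top ennreal_le_epsilon le_zero_eq add.left_neutral)
  then show ?thesis
    by (simp add: hausdorff_measure_def)
qed

lemma diameter_le_cart2:
  fixes U :: "(real^2) set"
  assumes "\<And>x y i. x \<in> U \<Longrightarrow> y \<in> U \<Longrightarrow> \<bar>x $ i - y $ i\<bar> \<le> r" "0 \<le> r"
  shows "bounded U \<and> diameter U \<le> 2 * r"
proof -
  have *: "dist x y \<le> 2 * r" if "x \<in> U" "y \<in> U" for x y
  proof -
    have "dist x y \<le> (\<Sum>i\<in>UNIV. \<bar>(x - y) $ i\<bar>)"
      unfolding dist_norm by (rule norm_le_l1_cart)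
    also have "\<dots> \<le> (\<Sum>i\<in>(UNIV::2 set). r)"
      using assms(1)[OF that] by (intro sum_mono) simp
    finally show ?thesis by simp
  qed
  then have "bounded U" by (meson bounded_def bounded_any_center bounded_two_points)
  moreover have "diameter U \<le> 2 * r"
    by (rule diameter_le) (use * assms(2) in \<open>auto simp: dist_norm\<close>)
  ultimately show ?thesis ..
qed

text \<open>Both coverings at once: the long side of each rectangle is cut into J k slices and every
  piece has diameter of order L k / q. There are about q^2 points with denominator q, so the cost is
  J L^s times the sum of q^(2-s) over q <= Q, at most J L^s Q^(3-s); s <= 2 makes q^(2-s)
  nondecreasing in q.\<close>

lemma hausdorff_measure_rational_limsup_zero:
  fixes A :: "(real^2) set" and Q D D' L :: "nat \<Rightarrow> real" and J :: "nat \<Rightarrow> nat"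
  assumes s: "0 < s" "s \<le> 2"
    and A01: "\<And>x i. x \<in> A \<Longrightarrow> 0 \<le> x $ i \<and> x $ i \<le> 1"
    and approx: "\<And>x m. x \<in> A \<Longrightarrow> \<exists>k\<ge>m. \<exists>(q::nat) (a1::int) (a2::int). 0 < q \<and> real q \<le> Q k \<and>
       \<bar>q * x $ 1 - a1\<bar> \<le> D k \<and> \<bar>q * x $ 2 - a2\<bar> \<le> D' k"
    and D: "\<And>k. D k \<le> 1" "\<And>k. D' k \<le> 1" 
    and J: "\<And>k. 0 < J k"
    and L: "\<And>k. 0 < L k" "\<And>k. 2 * D k \<le> J k * L k" "\<And>k. D' k \<le> L k" "L \<longlonglongrightarrow> 0"
    and summable: "summable (\<lambda>k. J k * L k powr s * Q k powr (3 - s))"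
  shows "hausdorff_measure s A = 0"
proof -
  \<comment> \<open>The coordinates lie in [0,1] and D k, D' k are at most 1, so numerators may
    overshoot [0,q] by one on each side.\<close>
  define I where "I k = (SIGMA q:{1..nat \<lfloor>Q k\<rfloor>}. {-1..int q + 1} \<times> {-1..int q + 1} \<times> {..<J k})" for k
  define V where "V k = (\<lambda>(q::nat, a1::int, a2::int, j::nat). {x::real^2. 
     - D k + j * L k \<le> q * x $ 1 - a1 \<and> q * x $ 1 - a1 \<le> - D k + (j + 1) * L k \<and> \<bar>q * x $ 2 - a2\<bar> \<le> L k})" for k
  define d where "d k = (\<lambda>(q::nat, a1::int, a2::int, j::nat). 2 * (2 * L k / q))" for k
  define \<delta> where "\<delta> k = 4 * L k" for k
  show ?thesis
  proof (rule hausdorff_measure_limsup_zero[where I = I and V = V and d = d and \<delta> = \<delta>])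
    show "finite (I k)" for k by (auto simp: I_def)
    show "\<delta> \<longlonglongrightarrow> 0" unfolding \<delta>_def using tendsto_mult_left[OF L(4), of 4] by simp
    show "A \<subseteq> (\<Union>k\<in>{m..}. \<Union>i\<in>I k. V k i)" for m
    proof
      fix x assume x: "x \<in> A"
      obtain k q a1 a2 where k: "k \<ge> m" "0 < q" "real q \<le> Q k" "\<bar>q * x $ 1 - of_int a1\<bar> \<le> D k" "\<bar>q * x $ 2 - of_int a2\<bar> \<le> D' k"
        using approx[OF x, of m] by blast
      have a: "a \<in> {-1..int q + 1}" if "\<bar>q * x $ i - of_int a\<bar> \<le> 1" for a i
      proof -
        have "0 \<le> q * x $ i" "q * x $ i \<le> q"
          using A01[OF x, of i] by (auto simp: mult_left_le)
        then have "-1 \<le> real_of_int a" "real_of_int a \<le> real q + 1" using that by linarith+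
        then show ?thesis by auto
      qed
      have a1: "a1 \<in> {-1..int q + 1}" using a[of 1 a1] k(4) D(1)[of k] by linarith
      have a2: "a2 \<in> {-1..int q + 1}" using a[of 2 a2] k(5) D(2)[of k] by linarith
      define t where "t = (q * x $ 1 - a1 + D k) / L k"
      have t: "0 \<le> t" "t \<le> J k"
        using k(4) L(1,2)[of k] by (auto simp: t_def field_simps)
      \<comment> \<open>t is the position along the long side in units of L k; the right end t = J k
        belongs to the last slice.\<close>
      obtain j where j: "j < J k" "real j \<le> t" "t \<le> real j + 1"
      proof (cases "t = J k")
        case True
        then show ?thesis using that[of "J k - 1"] J[of k] by (auto simp: of_nat_diff)
      next
        case False
        then have "nat \<lfloor>t\<rfloor> < J k" using t by linarith
        then show ?thesis using that[of "nat \<lfloor>t\<rfloor>"] t by auto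
      qed
      have "x \<in> V k (q, a1, a2, j)"
        using j L(1,3)[of k] k(5) by (auto simp: V_def t_def field_simps)
      moreover have "(q, a1, a2, j) \<in> I k"
        using k a1 a2 j by (auto simp: I_def le_nat_iff le_floor_iff)
      ultimately show "x \<in> (\<Union>k\<in>{m..}. \<Union>i\<in>I k. V k i)" using k(1) by blast
    qed
    show "bounded (V k i) \<and> diameter (V k i) \<le> d k i \<and> d k i \<le> \<delta> k" if "i \<in> I k" for k i
    proof -
      obtain q a1 a2 j where i: "i = (q, a1, a2, j)" by (cases i)
      have q: "q \<ge> 1" using that by (auto simp: I_def i)
      have "bounded (V k i) \<and> diameter (V k i) \<le> 2 * (2 * L k / q)"
      proof (rule diameter_le_cart2)
        fix x y l assume xy: "x \<in> V k i" "y \<in> V k i"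
        have "\<bar>q * x $ l - q * y $ l\<bar> \<le> 2 * L k"
        proof (cases "l = 1")
          case True
          with xy L(1)[of k] show ?thesis by (auto simp: V_def i algebra_simps)
        next
          case False
          then have "l = 2" using exhaust_2 by blast
          with xy show ?thesis by (auto simp: V_def i abs_le_iff)
        qed
        then have "real q * \<bar>x $ l - y $ l\<bar> \<le> 2 * L k"
          by (simp add: right_diff_distrib[symmetric] abs_mult)
        then show "\<bar>x $ l - y $ l\<bar> \<le> 2 * L k / q"
          using q by (simp add: field_simps)
      qed (use L(1)[of k] in auto)
      moreover have "d k i \<le> \<delta> k"
        using q L(1)[of k] by (simp add: d_def i \<delta>_def field_simps)
      ultimately show ?thesis by (simp add: d_def i)
    qed
    show "(\<Sum>i\<in>I k. d k i powr s) \<le> 256 * (J k * L k powr s * Q k powr (3 - s))" for k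
    proof -
      define R where "R = nat \<lfloor>Q k\<rfloor>"
      have RQ: "real R \<le> Q k" if "R > 0" using that unfolding R_def by linarith
      have "(\<Sum>i\<in>I k. d k i powr s) = (\<Sum>q\<in>{1..R}. \<Sum>i\<in>{-1..int q + 1} \<times> {-1..int q + 1} \<times> {..<J k}. d k (q, i) powr s)"
        unfolding I_def R_def by (subst sum.Sigma) auto
      also have "\<dots> = (\<Sum>q\<in>{1..R}. real ((q + 3) * ((q + 3) * J k)) * (4 * L k / q) powr s)"
        by (intro sum.cong refl) (simp add: d_def case_prod_beta card_cartesian_product nat_add_distrib add.commute)
      also have "\<dots> \<le> (\<Sum>q\<in>{1..R}. 256 * (J k * L k powr s * Q k powr (2 - s)))"
      proof (rule sum_mono)
        fix q assume q: "q \<in> {1..R}"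
        then have qQ: "real q \<le> Q k" "real q \<ge> 1" using RQ by auto
        \<comment> \<open>The constant 256 is 16 from (q+3)^2 <= (4q)^2 times 16 from 4^s <=
          4^2.\<close>
        have "real ((q + 3) * ((q + 3) * J k)) \<le> real (4 * q) * (real (4 * q) * J k)"
          using q by (simp only: of_nat_mult, intro mult_mono) auto
        moreover have "(4 * L k / q) powr s = 4 powr s * L k powr s / q powr s"
          using L(1)[of k] by (simp add: powr_mult powr_divide)
        moreover have "4 powr s \<le> (4::real) powr 2" using s by (intro powr_mono) auto
        ultimately have "real ((q + 3) * ((q + 3) * J k)) * (4 * L k / q) powr s
           \<le> (real (4 * q) * (real (4 * q) * J k)) * (16 * L k powr s / q powr s)"
          by (simp only:) (intro mult_mono divide_right_mono; simp)
        also have "\<dots> = 256 * (J k * L k powr s * (real q powr 2 / q powr s))"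
          using qQ by (simp add: power2_eq_square)
        also have "real q powr 2 / q powr s = q powr (2 - s)"
          by (simp add: powr_diff)
        also have "256 * (J k * L k powr s * real q powr (2 - s)) \<le> 256 * (J k * L k powr s * Q k powr (2 - s))"
          using qQ s by (intro mult_left_mono powr_mono2) auto
        finally show "real ((q + 3) * ((q + 3) * J k)) * (4 * L k / q) powr s \<le> 256 * (J k * L k powr s * Q k powr (2 - s))" .
      qed
      also have "\<dots> = 256 * (J k * L k powr s * (real R * Q k powr (2 - s)))" by simp
      also have "\<dots> \<le> 256 * (J k * L k powr s * Q k powr (3 - s))"
      proof (intro mult_left_mono)
        show "real R * Q k powr (2 - s) \<le> Q k powr (3 - s)"
        proof (cases "R = 0")
          case False
          then have Q: "real R \<le> Q k" "Q k > 0" using RQ by auto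
          then have "real R * Q k powr (2 - s) \<le> Q k powr 1 * Q k powr (2 - s)"
            by (intro mult_right_mono) auto
          also have "Q k powr 1 * Q k powr (2 - s) = Q k powr (3 - s)"
            by (simp only: powr_add[symmetric]) simp
          finally show ?thesis .
        qed auto
      qed auto
      finally show ?thesis .
    qed
    show "summable (\<lambda>k. 256 * (J k * L k powr s * Q k powr (3 - s)))"
      using summable by (rule summable_mult)
  qed (use s in auto)
qed

section \<open>Lower bounds for Hausdorff measure of limsup sets\<close>

text \<open>A list of triples \<open>(c, u, v)\<close> stands for the measure with density \<open>\<Sum> c \<cdot> 1\<^bsub>[u,v]\<^esub>\<close>.\<close>

type_synonym boxes = "(real \<times> (real^2) \<times> (real^2)) list"

definition box_mass :: "boxes \<Rightarrow> (real^2) set \<Rightarrow> real" where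
  "box_mass w S = (\<Sum>(c, u, v)\<leftarrow>w. c * measure lborel (cbox u v \<inter> S))"

text \<open>For nonnegative coefficients this bounds the density at every point, however the boxes
  overlap.\<close>

definition box_weight :: "boxes \<Rightarrow> real" where
  "box_weight w = (\<Sum>(c, u, v)\<leftarrow>w. c)"

definition box_support :: "boxes \<Rightarrow> (real^2) set" where
  "box_support w = (\<Union>(c, u, v)\<in>set w. cbox u v)"

text \<open>The pointwise product of two densities: the corner formulas describe the intersection of
  two boxes, and disjoint boxes produce an empty \<open>cbox\<close>.\<close>

definition box_mult :: "boxes \<Rightarrow> boxes \<Rightarrow> boxes" where
  "box_mult w w' = concat (map (\<lambda>(c, u, v). map (\<lambda>(c', u', v').
     (c * c', (\<chi> i. max (u $ i) (u' $ i)), (\<chi> i. min (v $ i) (v' $ i)))) w') w)"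

definition square :: "real^2 \<Rightarrow> real \<Rightarrow> (real^2) set" where
  "square z r = cbox z (z + (\<chi> i. r))"

abbreviation nonneg_weights :: "boxes \<Rightarrow> bool" where
  "nonneg_weights w \<equiv> (\<forall>(c, u, v)\<in>set w. 0 \<le> c)"

section \<open>Masses of piecewise constant densities and of their products\<close>

lemma cbox_Int_cart:
  fixes u v u' v' :: "real^2"
  shows "cbox u v \<inter> cbox u' v' = cbox (\<chi> i. max (u $ i) (u' $ i)) (\<chi> i. min (v $ i) (v' $ i))"
  by (auto simp: mem_box_cart)

lemma square_measurable [measurable]: "square z r \<in> sets borel"
  by (simp add: square_def)

lemma cbox_Int_fmeasurable: "S \<in> sets borel \<Longrightarrow> cbox u v \<inter> S \<in> fmeasurable lborel"
  by (rule fmeasurable_Int_fmeasurable) auto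

lemma measure_cbox_Int_mono:
  assumes "S \<in> sets borel" "T \<in> sets borel" "cbox u v \<inter> S \<subseteq> T"
  shows "measure lborel (cbox u v \<inter> S) \<le> measure lborel (cbox u v \<inter> T)"
  by (rule measure_mono_fmeasurable) (use assms cbox_Int_fmeasurable in auto)

lemma box_mass_mono:
  assumes "nonneg_weights w" "S \<in> sets borel" "T \<in> sets borel" "S \<subseteq> T"
  shows "box_mass w S \<le> box_mass w T"
  unfolding box_mass_def using assms
  by (intro sum_list_mono) (auto intro!: mult_left_mono measure_cbox_Int_mono)

lemma box_mass_empty [simp]: "box_mass w {} = 0"
  unfolding box_mass_def by (induction w) auto

lemma box_weight_nonneg: "nonneg_weights w \<Longrightarrow> 0 \<le> box_weight w"
  unfolding box_weight_def by (intro sum_list_nonneg) auto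

lemma box_mass_box_mult:
  "box_mass (box_mult w w') S = (\<Sum>(c, u, v)\<leftarrow>w. c * box_mass w' (cbox u v \<inter> S))"
proof (induction w)
  case (Cons a w)
  obtain c u v where a: "a = (c, u, v)" by (cases a)
  have "(\<Sum>(c, u, v)\<leftarrow>map (\<lambda>(c', u', v'). (c * c', (\<chi> i. max (u $ i) (u' $ i)), (\<chi> i. min (v $ i) (v' $ i)))) w'.
      c * measure lborel (cbox u v \<inter> S)) = c * box_mass w' (cbox u v \<inter> S)"
    unfolding box_mass_def
    by (induction w') (auto simp: cbox_Int_cart[symmetric] algebra_simps Int_ac)
  then show ?case using Cons by (simp add: box_mult_def box_mass_def a)
qed (simp add: box_mult_def box_mass_def)

lemma box_support_box_mult: "box_support (box_mult w w') \<subseteq> box_support w \<inter> box_support w'"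
  by (auto simp: box_support_def box_mult_def cbox_Int_cart[symmetric])

lemma nonneg_weights_box_mult: "nonneg_weights w \<Longrightarrow> nonneg_weights w' \<Longrightarrow> nonneg_weights (box_mult w w')"
  by (fastforce simp: box_mult_def)

lemma box_mass_box_mult_le:
  assumes "nonneg_weights w" "nonneg_weights w'" "S \<in> sets borel"
  shows "box_mass (box_mult w w') S \<le> box_weight w * box_mass w' S"
proof -
  have "box_mass (box_mult w w') S \<le> (\<Sum>(c, u, v)\<leftarrow>w. c * box_mass w' S)"
    unfolding box_mass_box_mult using assms
    by (intro sum_list_mono) (auto intro!: mult_left_mono box_mass_mono)
  also have "\<dots> = box_weight w * box_mass w' S"
    unfolding box_weight_def by (induction w) (auto simp: algebra_simps)
  finally show ?thesis .
qed

text \<open>If \<open>w'\<close> is nearly Lebesgue measure on every box of \<open>w\<close>,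
  multiplying by it hardly changes masses. This controls squares of fixed size, whereas the bound by
  \<open>box_weight\<close> controls the small ones.\<close>

lemma box_mass_box_mult_close:
  assumes "nonneg_weights w"
    and "\<And>c u v. (c, u, v) \<in> set w \<Longrightarrow>
      \<bar>box_mass w' (cbox u v \<inter> S) - measure lborel (cbox u v \<inter> S)\<bar> \<le> \<epsilon>"
  shows "\<bar>box_mass (box_mult w w') S - box_mass w S\<bar> \<le> box_weight w * \<epsilon>"
  unfolding box_mass_box_mult using assms
proof (induction w)
  case (Cons a w)
  obtain c u v where a: "a = (c, u, v)" by (cases a)
  have IH: "\<bar>(\<Sum>(c, u, v)\<leftarrow>w. c * box_mass w' (cbox u v \<inter> S)) - box_mass w S\<bar> \<le> box_weight w * \<epsilon>"
    by (rule Cons.IH) (use Cons.prems in auto)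
  have "\<bar>box_mass w' (cbox u v \<inter> S) - measure lborel (cbox u v \<inter> S)\<bar> \<le> \<epsilon>" "0 \<le> c"
    using Cons.prems by (auto simp: a)
  then have "c * \<bar>box_mass w' (cbox u v \<inter> S) - measure lborel (cbox u v \<inter> S)\<bar> \<le> c * \<epsilon>"
    by (intro mult_left_mono)
  then have "\<bar>c * box_mass w' (cbox u v \<inter> S) - c * measure lborel (cbox u v \<inter> S)\<bar> \<le> c * \<epsilon>"
    using \<open>0 \<le> c\<close> by (simp add: abs_mult right_diff_distrib[symmetric])
  then show ?case
    using IH by (simp add: a box_mass_def box_weight_def algebra_simps)
qed (simp add: box_mass_def box_weight_def)

lemma box_mass_subadditive:
  assumes "nonneg_weights w" "finite I" "\<And>i. i \<in> I \<Longrightarrow> V i \<in> sets borel" "box_support w \<subseteq> (\<Union>i\<in>I. V i)"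
  shows "box_mass w UNIV \<le> (\<Sum>i\<in>I. box_mass w (V i))"
  using assms(1,4) unfolding box_mass_def
proof (induction w)
  case (Cons a w)
  obtain c u v where a: "a = (c, u, v)" by (cases a)
  have "measure lborel (cbox u v) \<le> measure lborel (\<Union>i\<in>I. cbox u v \<inter> V i)"
    by (rule measure_mono_fmeasurable)
      (use Cons.prems a assms(2,3) in \<open>auto simp: box_support_def intro!: fmeasurable.finite_UN cbox_Int_fmeasurable\<close>)
  also have "\<dots> \<le> (\<Sum>i\<in>I. measure lborel (cbox u v \<inter> V i))"
    by (rule measure_UNION_le) (use assms(2,3) in auto)
  finally have "c * measure lborel (cbox u v) \<le> c * (\<Sum>i\<in>I. measure lborel (cbox u v \<inter> V i))"
    using Cons.prems by (intro mult_left_mono) (auto simp: a)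
  moreover have "(\<Sum>(c, u, v)\<leftarrow>w. c * measure lborel (cbox u v \<inter> UNIV)) \<le>
      (\<Sum>i\<in>I. \<Sum>(c, u, v)\<leftarrow>w. c * measure lborel (cbox u v \<inter> V i))"
    by (rule Cons.IH) (use Cons.prems in \<open>auto simp: box_support_def\<close>)
  ultimately show ?case by (simp add: a sum.distrib sum_distrib_left)
qed simp

lemma compact_box_support: "compact (box_support w)"
  unfolding box_support_def by (intro compact_UN) (auto split: prod.split)

lemma measure_cbox_real2:
  fixes u v :: "real^2"
  shows "measure lborel (cbox u v) = max 0 (v $ 1 - u $ 1) * max 0 (v $ 2 - u $ 2)"
proof (cases "cbox u v = {}")
  case True
  then obtain i where "v $ i < u $ i" by (auto simp: interval_eq_empty_cart)
  then show ?thesis using True exhaust_2[of i] by (auto simp: max_def)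
next
  case False
  then have "u $ i \<le> v $ i" for i
    by (auto simp: interval_ne_empty_cart)
  then show ?thesis
    using content_cbox_cart[OF False] by (simp add: UNIV_2 max_def)
qed

lemma measure_square: "r \<ge> 0 \<Longrightarrow> measure lborel (square z r) = r * r"
  by (simp add: square_def measure_cbox_real2)

text \<open>Working with the approximating masses and a finite subcover avoids passing to a limit measure.\<close>

lemma hausdorff_measure_pos_of_box_masses:
  fixes w :: "nat \<Rightarrow> boxes"
  assumes s: "0 < s" "s \<le> 2"
    and nonneg: "\<And>k. nonneg_weights (w k)"
    and decseq: "\<And>k. box_support (w (Suc k)) \<subseteq> box_support (w k)"
    and frostman: "\<And>k z r. 0 < r \<Longrightarrow> box_mass (w k) (square z r) \<le> 2 * r powr s"
    and total: "\<And>k. 1/2 \<le> box_mass (w k) UNIV"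
    and A: "(\<Inter>k. box_support (w k)) \<subseteq> A"
  shows "hausdorff_measure s A \<noteq> 0"
proof -
  \<comment> \<open>A total mass 1/2 less an enlargement cost 1/4 leaves 1/4, and 32 = 2 * 4^2 is
    the loss in the mass bound; 1/4 divided by 32 is 1/128.\<close>
  have "ennreal (1/128) \<le> (\<Sum>i. diam_pow s (U i))" if U: "delta_cover 1 A U" for U
  proof -
    have cov: "A \<subseteq> (\<Union>i. U i)" and bd: "\<And>i. bounded (U i)"
      using U by (auto simp: delta_cover_def)
    \<comment> \<open>A positive minimal radius, so that even a single point gets an open
      neighbourhood. Since (2 \<sigma> i)^s = 2^(-i)/16, the enlargement costs at most 2 * (2/16) =
      1/4 in total mass.\<close>
    define \<sigma> where "\<sigma> i = ((1/16) * (1/2)^i) powr (1/s) / 2" for i :: nat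
    define \<rho> where "\<rho> i = max (2 * diameter (U i)) (\<sigma> i)" for i
    define z where "z i = (SOME x. x \<in> U i)" for i
    define V where "V i = (if U i = {} then {} else box (z i - (\<chi> l. \<rho> i)) (z i + (\<chi> l. \<rho> i)))" for i
    have \<sigma>: "\<sigma> i > 0" for i by (simp add: \<sigma>_def)
    have \<rho>: "\<rho> i > 0" for i using \<sigma>[of i] by (simp add: \<rho>_def)
    have UV: "U i \<subseteq> V i" for i
    proof
      fix x assume x: "x \<in> U i"
      then have z: "z i \<in> U i" unfolding z_def by (rule someI)
      have "dist x (z i) \<le> diameter (U i)"
        using bd x z by (rule diameter_bounded_bound)
      also have "\<dots> < \<rho> i"
        using \<sigma>[of i] diameter_ge_0[OF bd[of i]] by (auto simp: \<rho>_def max_def)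
      finally have "norm (x - z i) < \<rho> i" by (simp add: dist_norm)
      then have "\<bar>x $ l - z i $ l\<bar> < \<rho> i" for l
        using component_le_norm_cart[of "x - z i" l] by simp
      then have "z i $ l - \<rho> i < x $ l \<and> x $ l < z i $ l + \<rho> i" for l
        by (simp add: abs_less_iff) (smt (verit))
      then show "x \<in> V i" using x by (auto simp: V_def mem_box_cart)
    qed
    have V_meas: "V i \<in> sets borel" and V_open: "open (V i)" for i
      by (auto simp: V_def open_box)
    have mass_V: "box_mass (w k) (V i) \<le> (if U i = {} then 0 else 32 * diameter (U i) powr s) + (1/8) * (1/2)^i" for k i
    proof (cases "U i = {}")
      case True
      then show ?thesis by (simp add: V_def)
    next
      case False
      have "V i \<subseteq> square (z i - (\<chi> l. \<rho> i)) (2 * \<rho> i)"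
      proof
        fix x assume "x \<in> V i"
        then have "z i $ l - \<rho> i < x $ l \<and> x $ l < z i $ l + \<rho> i" for l
          by (simp add: V_def False mem_box_cart)
        then have "z i $ l - \<rho> i \<le> x $ l \<and> x $ l \<le> z i $ l - \<rho> i + 2 * \<rho> i" for l
          by (smt (verit))
        then show "x \<in> square (z i - (\<chi> l. \<rho> i)) (2 * \<rho> i)"
          by (simp add: square_def mem_box_cart)
      qed
      then have "box_mass (w k) (V i) \<le> box_mass (w k) (square (z i - (\<chi> l. \<rho> i)) (2 * \<rho> i))"
        by (intro box_mass_mono nonneg V_meas square_measurable)
      also have "\<dots> \<le> 2 * (2 * \<rho> i) powr s"
        by (rule frostman) (use \<rho> in simp)
      also have "(2 * \<rho> i) powr s \<le> 16 * diameter (U i) powr s + (1/16) * (1/2)^i"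
      proof (cases "2 * diameter (U i) \<le> \<sigma> i")
        case True
        then have "2 * \<rho> i = ((1/16) * (1/2)^i) powr (1/s)" by (simp add: \<rho>_def \<sigma>_def)
        then have "(2 * \<rho> i) powr s = (1/16) * (1/2)^i" using s by (simp add: powr_powr)
        then show ?thesis using powr_ge_zero[of "diameter (U i)" s] by linarith
      next
        case False
        then have "2 * \<rho> i = 4 * diameter (U i)" by (simp add: \<rho>_def)
        then have "(2 * \<rho> i) powr s = 4 powr s * diameter (U i) powr s"
          using diameter_ge_0[OF bd[of i]] by (simp add: powr_mult)
        also have "\<dots> \<le> 4 powr 2 * diameter (U i) powr s"
          using s by (intro mult_right_mono powr_mono) auto
        finally show ?thesis by (simp add: add_increasing2)
      qed
      finally show ?thesis using False by simp
    qed
    define Ov where "Ov = (\<Union>i. V i)"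
    \<comment> \<open>Otherwise the decreasing nonempty compact sets
      \<open>box_support (w k) - Ov\<close> would have a common point, which lies in
      \<open>A\<close> but escapes the cover.\<close>
    have "\<exists>k. box_support (w k) \<subseteq> Ov"
    proof (rule ccontr)
      assume *: "\<nexists>k. box_support (w k) \<subseteq> Ov"
      have "(\<Inter>k. box_support (w k) - Ov) \<noteq> {}"
      proof (rule compact_nest)
        show "compact (box_support (w k) - Ov)" for k
          using V_open by (auto simp: Ov_def intro!: compact_diff compact_box_support)
        show "box_support (w k) - Ov \<noteq> {}" for k using * by blast
        show "box_support (w n) - Ov \<subseteq> box_support (w m) - Ov" if "m \<le> n" for m n
          using lift_Suc_antimono_le[of "\<lambda>k. box_support (w k)", OF decseq that] by blast
      qed
      then obtain x where x: "\<And>k. x \<in> box_support (w k)" "x \<notin> Ov" by blast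
      then have "x \<in> A" using A by blast
      then obtain i where "x \<in> U i" using cov by blast
      then show False using UV[of i] x(2) by (auto simp: Ov_def)
    qed
    then obtain k where k: "box_support (w k) \<subseteq> (\<Union>i. V i)" by (auto simp: Ov_def)
    obtain I where I: "finite I" "box_support (w k) \<subseteq> (\<Union>i\<in>I. V i)"
      by (rule compactE_image[OF compact_box_support, of UNIV V "w k"]) (use V_open k in auto)
    have "1/2 \<le> box_mass (w k) UNIV" by (rule total)
    also have "\<dots> \<le> (\<Sum>i\<in>I. box_mass (w k) (V i))"
      by (rule box_mass_subadditive) (use nonneg I V_meas in auto)
    also have "\<dots> \<le> (\<Sum>i\<in>I. (if U i = {} then 0 else 32 * diameter (U i) powr s) + (1/8) * (1/2)^i)"
      by (intro sum_mono mass_V)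
    also have "\<dots> = 32 * (\<Sum>i\<in>I. (if U i = {} then 0 else diameter (U i) powr s)) + (1/8) * (\<Sum>i\<in>I. (1/2)^i)"
      unfolding sum.distrib sum_distrib_left
      by (intro arg_cong2[where f = "(+)"] sum.cong refl) auto
    also have "(\<Sum>i\<in>I. (1/2::real)^i) \<le> (\<Sum>i. (1/2)^i)"
      by (intro sum_le_suminf summable_geometric I) auto
    also have "(\<Sum>i. (1/2::real)^i) = 2"
      by (subst suminf_geometric) auto
    finally have "1/128 \<le> (\<Sum>i\<in>I. (if U i = {} then 0 else diameter (U i) powr s))"
      by simp
    then have "ennreal (1/128) \<le> ennreal (\<Sum>i\<in>I. (if U i = {} then 0 else diameter (U i) powr s))"
      by (rule ennreal_leI)
    also have "\<dots> = (\<Sum>i\<in>I. ennreal (if U i = {} then 0 else diameter (U i) powr s))"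
      by (intro sum_ennreal[symmetric]) simp
    also have "\<dots> = (\<Sum>i\<in>I. diam_pow s (U i))"
      using s by (intro sum.cong refl) (simp add: diam_pow_def)
    also have "\<dots> \<le> (\<Sum>i. diam_pow s (U i))"
      by (intro sum_le_suminf I) auto
    finally show ?thesis .
  qed
  then have "ennreal (1/128) \<le> hausdorff_content s 1 A"
    unfolding hausdorff_content_def by (intro INF_greatest) simp
  also have "\<dots> \<le> hausdorff_measure s A"
    unfolding hausdorff_measure_def by (intro SUP_upper) simp
  finally show ?thesis by (auto simp: ennreal_eq_0_iff)
qed

abbreviation unit_square :: "(real^2) set" where
  "unit_square \<equiv> square 0 1"

text \<open>There are two regimes for a square of side r. Below a radius r0 depending on
  \<open>w\<close>, the better exponent t > s of the new density beats the factor
  \<open>box_weight w\<close>. Above r0 the new density is so well equidistributed that the product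
  differs from \<open>w\<close> by at most \<eta> r^s. The Frostman constant therefore grows by
  \<eta> only, instead of by a factor.\<close>

lemma frostman_iteration_step:
  fixes w :: boxes and K s t B :: real
  assumes st: "0 < s" "s < t" and K: "0 \<le> K"
    and stage: "\<And>\<epsilon> N0. 0 < \<epsilon> \<Longrightarrow> \<exists>N>N0. \<exists>v. nonneg_weights v \<and> box_support v \<subseteq> G N \<and>
      (\<forall>a b. cbox a b \<subseteq> unit_square \<longrightarrow> \<bar>box_mass v (cbox a b) - measure lborel (cbox a b)\<bar> \<le> \<epsilon>) \<and>
      (\<forall>z r. 0 < r \<longrightarrow> r \<le> 1 \<longrightarrow> box_mass v (square z r) \<le> K * r powr t)"
    and w: "nonneg_weights w" "box_support w \<subseteq> unit_square"
    and frostman: "\<And>z r. 0 < r \<Longrightarrow> box_mass w (square z r) \<le> B * r powr s" and "1 \<le> B"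
    and "0 < \<eta>"
  shows "\<exists>N>N0. \<exists>w'. nonneg_weights w' \<and> box_support w' \<subseteq> box_support w \<inter> G N \<and>
    (\<forall>z r. 0 < r \<longrightarrow> box_mass w' (square z r) \<le> (B + \<eta>) * r powr s) \<and>
    box_mass w UNIV - \<eta> \<le> box_mass w' UNIV"
proof -
  define W where "W = box_weight w"
  have W: "W \<ge> 0" using w by (simp add: W_def box_weight_nonneg)
  \<comment> \<open>Chosen so that r0^(t-s) (1 + W K) = 1, hence W K r^t <= r^s for r <= r0.\<close>
  define r0 where "r0 = (1 / (1 + W * K)) powr (1 / (t - s))"
  have WK: "W * K \<ge> 0" using W K by simp
  have r0: "0 < r0" "r0 \<le> 1"
    using WK st by (auto simp: r0_def intro!: powr_le1)
  have small: "W * (K * r powr t) \<le> r powr s" if "0 < r" "r \<le> r0" for r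
  proof -
    have "r powr (t - s) \<le> r0 powr (t - s)"
      using that st by (intro powr_mono2) auto
    also have "\<dots> = 1 / (1 + W * K)"
      using st WK by (simp add: r0_def powr_powr)
    finally have "r powr (t - s) * (1 + W * K) \<le> 1"
      using WK by (simp add: field_simps)
    moreover have "W * K * r powr (t - s) \<le> r powr (t - s) * (1 + W * K)"
      by (simp add: algebra_simps)
    ultimately have "W * K * r powr (t - s) \<le> 1" by linarith
    then have "W * K * r powr (t - s) * r powr s \<le> 1 * r powr s"
      by (intro mult_right_mono) auto
    then show ?thesis by (simp add: mult.assoc flip: powr_add)
  qed
  \<comment> \<open>Then the error W \<epsilon> is at most \<eta> r^s for every r >= r0.\<close>
  define \<epsilon> where "\<epsilon> = \<eta> * r0 powr s / (1 + W)"
  have \<epsilon>: "\<epsilon> > 0" using r0 W \<open>0 < \<eta>\<close> by (simp add: \<epsilon>_def)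
  have W\<epsilon>: "W * \<epsilon> \<le> \<eta> * r0 powr s"
  proof -
    have "W * \<epsilon> = (W / (1 + W)) * (\<eta> * r0 powr s)" by (simp add: \<epsilon>_def)
    also have "\<dots> \<le> 1 * (\<eta> * r0 powr s)"
      using W \<open>0 < \<eta>\<close> by (intro mult_right_mono) auto
    finally show ?thesis by simp
  qed
  obtain N v where N: "N > N0" and v: "nonneg_weights v" "box_support v \<subseteq> G N"
    and equi: "\<And>a b. cbox a b \<subseteq> unit_square \<Longrightarrow> \<bar>box_mass v (cbox a b) - measure lborel (cbox a b)\<bar> \<le> \<epsilon>"
    and frv: "\<And>z r. 0 < r \<Longrightarrow> r \<le> 1 \<Longrightarrow> box_mass v (square z r) \<le> K * r powr t"
    using stage[OF \<epsilon>, of N0] by metis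
  define p where "p = box_mult w v"
  have close: "\<bar>box_mass p (cbox a b) - box_mass w (cbox a b)\<bar> \<le> W * \<epsilon>" for a b
    unfolding p_def W_def
  proof (rule box_mass_box_mult_close[OF w(1)])
    fix c u u' assume "(c, u, u') \<in> set w"
    then have "cbox u u' \<subseteq> unit_square" using w(2) by (auto simp: box_support_def)
    then have "cbox u u' \<inter> cbox a b \<subseteq> unit_square" by blast
    then show "\<bar>box_mass v (cbox u u' \<inter> cbox a b) - measure lborel (cbox u u' \<inter> cbox a b)\<bar> \<le> \<epsilon>"
      unfolding cbox_Int_cart by (rule equi)
  qed
  have "box_mass p (square z r) \<le> (B + \<eta>) * r powr s" if r: "0 < r" for z r
  proof (cases "r \<le> r0")
    case True
    have "box_mass p (square z r) \<le> W * box_mass v (square z r)"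
      unfolding p_def W_def using w v by (intro box_mass_box_mult_le) auto
    also have "\<dots> \<le> W * (K * r powr t)"
      using True r r0 W by (intro mult_left_mono frv) auto
    also have "\<dots> \<le> 1 * r powr s" using small[OF r True] by simp
    also have "\<dots> \<le> (B + \<eta>) * r powr s"
      using \<open>1 \<le> B\<close> \<open>0 < \<eta>\<close> by (intro mult_right_mono) auto
    finally show ?thesis .
  next
    case False
    have "box_mass p (square z r) \<le> box_mass w (square z r) + W * \<epsilon>"
      using close[of z "z + (\<chi> i. r)"] by (simp add: square_def)
    also have "\<dots> \<le> B * r powr s + \<eta> * r powr s"
    proof (intro add_mono frostman r order_trans[OF W\<epsilon>] mult_left_mono powr_mono2)
    qed (use False r0 st \<open>0 < \<eta>\<close> in auto)
    finally show ?thesis by (simp add: algebra_simps)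
  qed
  moreover have "box_mass w UNIV - \<eta> \<le> box_mass p UNIV"
  proof -
    have sub: "box_support p \<subseteq> unit_square"
      using box_support_box_mult[of w v] w(2) by (auto simp: p_def)
    \<comment> \<open>The comparison \<open>close\<close> speaks of boxes only, so the total mass is
      first written as the mass of a box.\<close>
    have "box_mass w UNIV = box_mass w unit_square" if "box_support w \<subseteq> unit_square" for w
    proof -
      have "cbox u v \<inter> unit_square = cbox u v" if "(c, u, v) \<in> set w" for c u v
        using that \<open>box_support w \<subseteq> unit_square\<close> by (auto simp: box_support_def)
      then show ?thesis
        unfolding box_mass_def by (intro arg_cong[of _ _ sum_list] map_cong refl) auto
    qed
    from this[OF w(2)] this[OF sub] have "box_mass w UNIV - W * \<epsilon> \<le> box_mass p UNIV"
      using close[of 0 "0 + (\<chi> i. 1)"] by (simp add: square_def)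
    moreover have "W * \<epsilon> \<le> \<eta>"
      using r0 st \<open>0 < \<eta>\<close> by (intro order_trans[OF W\<epsilon>]) (auto intro!: mult_left_le powr_le1)
    ultimately show ?thesis by linarith
  qed
  moreover have "nonneg_weights p" unfolding p_def using w v by (intro nonneg_weights_box_mult)
  moreover have "box_support p \<subseteq> box_support w \<inter> G N"
    using box_support_box_mult[of w v] v by (auto simp: p_def)
  ultimately show ?thesis using N by blast
qed

lemma hausdorff_measure_limsup_pos:
  fixes G :: "nat \<Rightarrow> (real^2) set"
  assumes st: "0 < s" "s < t" "s \<le> 2" and K: "0 \<le> K"
    and stage: "\<And>\<epsilon> N0. 0 < \<epsilon> \<Longrightarrow> \<exists>N>N0. \<exists>v. nonneg_weights v \<and> box_support v \<subseteq> G N \<and>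
      (\<forall>a b. cbox a b \<subseteq> unit_square \<longrightarrow> \<bar>box_mass v (cbox a b) - measure lborel (cbox a b)\<bar> \<le> \<epsilon>) \<and>
      (\<forall>z r. 0 < r \<longrightarrow> r \<le> 1 \<longrightarrow> box_mass v (square z r) \<le> K * r powr t)"
    and A: "\<And>x. x \<in> unit_square \<Longrightarrow> (\<exists>\<^sub>\<infinity>N. x \<in> G N) \<Longrightarrow> x \<in> A"
  shows "hausdorff_measure s A \<noteq> 0"
proof -
  \<comment> \<open>Step k spends \<eta> = 2^(-k-2). The mass bound decreases by exactly this
    amount, from 1/2 + 2^(-k-1), and stays above 1/2; the Frostman constant 2 - 2^(-k) may grow by
    twice as much and stays below 2.\<close>
  define P where "P k wN \<longleftrightarrow> nonneg_weights (fst wN) \<and> box_support (fst wN) \<subseteq> unit_square \<and>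
      (\<forall>z r. 0 < r \<longrightarrow> box_mass (fst wN) (square z r) \<le> (2 - (1/2)^k) * r powr s) \<and>
      1/2 + (1/2)^(k+1) \<le> box_mass (fst wN) UNIV" for k and wN :: "boxes \<times> nat"
  define Q where "Q wN wN' \<longleftrightarrow> snd wN < snd wN' \<and> box_support (fst wN') \<subseteq> box_support (fst wN) \<inter> G (snd wN')"
    for wN wN' :: "boxes \<times> nat"
  have "\<exists>f. \<forall>k. P k (f k) \<and> Q (f k) (f (Suc k))"
  proof (rule dependent_nat_choice)
    \<comment> \<open>Lebesgue measure on the unit square: its Frostman constant for any s <= 2 is 1
      and its mass is 1, as required at k = 0.\<close>
    define w0 :: boxes where "w0 = [(1, 0, (\<chi> i. 1))]"
    have w0: "box_mass w0 S = measure lborel (unit_square \<inter> S)" for S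
      by (simp add: w0_def box_mass_def square_def)
    have "box_mass w0 (square z r) \<le> (2 - (1/2)^0) * r powr s" if r: "0 < r" for z r
    proof (cases "r \<le> 1")
      case True
      have "measure lborel (unit_square \<inter> square z r) \<le> measure lborel (square z r)"
        by (rule measure_mono_fmeasurable) (auto simp: square_def)
      also have "\<dots> = r powr 2" using r by (simp add: measure_square power2_eq_square)
      also have "\<dots> \<le> r powr s" using r True st by (intro powr_mono') auto
      finally show ?thesis by (simp add: w0)
    next
      case False
      have "measure lborel (unit_square \<inter> square z r) \<le> measure lborel unit_square"
        by (rule measure_mono_fmeasurable) (auto simp: square_def)
      also have "\<dots> = 1" by (simp add: measure_square)
      also have "\<dots> \<le> r powr s" using False st by (intro ge_one_powr_ge_zero) auto
      finally show ?thesis by (simp add: w0)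
    qed
    moreover have "box_mass w0 UNIV = 1" by (simp add: w0 measure_square)
    moreover have "box_support w0 \<subseteq> unit_square" "nonneg_weights w0"
      by (auto simp: w0_def box_support_def square_def)
    ultimately have "P 0 (w0, 0)" by (simp add: P_def)
    then show "\<exists>x. P 0 x" ..
  next
    fix wN k assume P: "P k wN"
    have *: "\<exists>N>snd wN. \<exists>w'. nonneg_weights w' \<and> box_support w' \<subseteq> box_support (fst wN) \<inter> G N \<and>
      (\<forall>z r. 0 < r \<longrightarrow> box_mass w' (square z r) \<le> ((2 - (1/2)^k) + (1/2)^(k+2)) * r powr s) \<and>
      box_mass (fst wN) UNIV - (1/2)^(k+2) \<le> box_mass w' UNIV"
    proof (rule frostman_iteration_step[where G = G and t = t and K = K])
      show "1 \<le> 2 - (1/2::real)^k" by (simp add: power_le_one)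
    qed (use P st K stage in \<open>auto simp: P_def\<close>)
    obtain N w' where N: "N > snd wN" and w': "nonneg_weights w'" "box_support w' \<subseteq> box_support (fst wN) \<inter> G N"
      "\<And>z r. 0 < r \<Longrightarrow> box_mass w' (square z r) \<le> ((2 - (1/2)^k) + (1/2)^(k+2)) * r powr s"
      "box_mass (fst wN) UNIV - (1/2)^(k+2) \<le> box_mass w' UNIV"
      using * by blast
    have "box_mass w' (square z r) \<le> (2 - (1/2)^(Suc k)) * r powr s" if "0 < r" for z r
      by (rule order_trans[OF w'(3)[OF that] mult_right_mono]) auto
    moreover have "1/2 + (1/2)^(Suc k + 1) \<le> box_mass w' UNIV"
      using w'(4) P by (simp add: P_def)
    ultimately have "P (Suc k) (w', N)" using w'(1,2) P by (auto simp: P_def)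
    moreover have "Q wN (w', N)" using N w'(2) by (simp add: Q_def)
    ultimately show "\<exists>y. P (Suc k) y \<and> Q wN y" by blast
  qed
  then obtain f where f: "\<And>k. P k (f k)" "\<And>k. Q (f k) (f (Suc k))" by blast
  define w where "w k = fst (f k)" for k
  define N where "N k = snd (f k)" for k
  show ?thesis
  proof (rule hausdorff_measure_pos_of_box_masses[where w = w])
    show "nonneg_weights (w k)" for k using f(1)[of k] by (simp add: P_def w_def)
    show "box_support (w (Suc k)) \<subseteq> box_support (w k)" for k
      using f(2)[of k] by (auto simp: Q_def w_def)
    show "1/2 \<le> box_mass (w k) UNIV" for k
    proof -
      have "0 \<le> (1/2::real)^(k+1)" by simp
      then show ?thesis using f(1)[of k] unfolding P_def w_def by linarith
    qed
    show "box_mass (w k) (square z r) \<le> 2 * r powr s" if "0 < r" for k z r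
    proof -
      have "box_mass (w k) (square z r) \<le> (2 - (1/2)^k) * r powr s"
        using f(1)[of k] that by (auto simp: P_def w_def)
      also have "\<dots> \<le> 2 * r powr s" by (intro mult_right_mono) auto
      finally show ?thesis .
    qed
    show "(\<Inter>k. box_support (w k)) \<subseteq> A"
    proof
      fix x assume x: "x \<in> (\<Inter>k. box_support (w k))"
      then have "x \<in> unit_square" using f(1)[of 0] by (auto simp: P_def w_def)
      moreover have "\<exists>\<^sub>\<infinity>N. x \<in> G N"
        unfolding INFM_nat
      proof
        fix m
        have sm: "strict_mono N"
          by (rule strict_monoI_Suc) (use f(2) in \<open>auto simp: Q_def N_def\<close>)
        have "m < N (Suc m)"
          using strict_mono_imp_increasing[OF sm, of "Suc m"] by simp
        moreover have "x \<in> G (N (Suc m))"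
          using f(2)[of m] x by (auto simp: Q_def N_def w_def)
        ultimately show "\<exists>n>m. x \<in> G n" by blast
      qed
      ultimately show "x \<in> A" by (rule A)
    qed
  qed (use st in auto)
qed

section \<open>Counting primes\<close>

text \<open>The recurrence \<open>1/((m+1) C(n,m+1)) = 1/(m C(n-1,m)) - 1/(m C(n,m))\<close> of Leibniz's harmonic triangle.\<close>

lemma Lcm_div_binomial_Ints:
  "1 \<le> m \<Longrightarrow> m \<le> n \<Longrightarrow> real (Lcm {1..n}) / (real m * real (n choose m)) \<in> \<int>"
proof (induction m arbitrary: n rule: nat_induct_at_least)
  case base
  then have "n dvd Lcm {1..n}" by (intro dvd_Lcm) auto
  then obtain k where "Lcm {1..n} = n * k" by (elim dvdE)
  then show ?case using base by simp
next
  case (Suc m)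
  then obtain l where n: "n = Suc l" "m \<le> l" by (cases n) auto
  have "Lcm {1..l} dvd Lcm {1..n}"
    by (rule Lcm_subset) (use n in auto)
  then obtain k where k: "Lcm {1..n} = Lcm {1..l} * k" by (elim dvdE)
  have 1: "real (Lcm {1..n}) / (real m * real (l choose m)) \<in> \<int>"
    using Ints_mult[OF Suc.IH[of l] Ints_of_nat[of k]] n unfolding k of_nat_mult by simp
  have 2: "real (Lcm {1..n}) / (real m * real (n choose m)) \<in> \<int>"
    using n by (intro Suc.IH) auto
  have c0: "real (l choose m) > 0" using n by simp
  have m0: "real m > 0" using Suc by simp
  have b1: "real (Suc m) * real (n choose Suc m) = real n * real (l choose m)"
    using Suc_times_binomial_eq[of l m] n(1) by (metis mult.commute of_nat_mult)
  have "(n - m) * (n choose m) = n * (l choose m)"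
    using binomial_absorb_comp[of n m] n by simp
  then have b2: "(real n - real m) * real (n choose m) = real n * real (l choose m)"
    using n by (metis of_nat_diff of_nat_mult le_SucI)
  have nm: "real n - real m > 0" using n by simp
  have b3: "real (n choose m) = real n * real (l choose m) / (real n - real m)"
    using b2 nm by (simp add: field_simps)
  have "1 / (real (Suc m) * real (n choose Suc m)) =
      1 / (real m * real (l choose m)) - 1 / (real m * real (n choose m))"
  proof -
    have aux: "1 / (x * b) = 1 / (y * b) - 1 / (y * (x * b / (x - y)))"
      if "0 < y" "y < x" "0 < b" for x y b :: real
    proof -
      have "1 / (y * b) = x / (y * x * b)" using that by simp
      moreover have "1 / (y * (x * b / (x - y))) = (x - y) / (y * x * b)" using that by simp
      ultimately have "1 / (y * b) - 1 / (y * (x * b / (x - y))) = y / (y * x * b)"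
        by (simp add: diff_divide_distrib)
      then show ?thesis using that by simp
    qed
    show ?thesis unfolding b1 b3 by (rule aux) (use nm m0 c0 in auto)
  qed
  then have "real (Lcm {1..n}) / (real (Suc m) * real (n choose Suc m)) =
      real (Lcm {1..n}) / (real m * real (l choose m)) - real (Lcm {1..n}) / (real m * real (n choose m))"
    by (metis (no_types, lifting) mult.right_neutral right_diff_distrib times_divide_eq_right)
  then show ?case using Ints_diff[OF 1 2] by simp
qed

text \<open>The multiplicity of p in a least common multiple is the maximum of the multiplicities in
  the elements.\<close>

lemma prime_power_dvd_Lcm:
  fixes p :: nat
  assumes "prime p" "finite A" "0 \<notin> A" "A \<noteq> {}" "p ^ k dvd Lcm A"
  shows "\<exists>a\<in>A. p ^ k dvd a"
  using assms(2,4,3,5)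
proof (induction A rule: finite_ne_induct)
  case (insert a A)
  have nz: "Lcm A \<noteq> 0" "a \<noteq> 0" using insert by (auto simp: Lcm_0_iff)
  have np: "\<not> is_unit p" using assms(1) by (simp add: prime_nat_iff)
  have "k \<le> multiplicity p (lcm a (Lcm A))"
    using insert.prems nz np by (subst (asm) power_dvd_iff_le_multiplicity) (auto simp: lcm_eq_0_iff)
  then have "k \<le> multiplicity p a \<or> k \<le> multiplicity p (Lcm A)"
    using nz assms(1) by (subst (asm) multiplicity_lcm) auto
  then have "p ^ k dvd a \<or> p ^ k dvd Lcm A"
    by (auto intro: multiplicity_dvd')
  then show ?case using insert by auto
qed simp

text \<open>Each full prime power in the factorisation of the lcm divides some number up to n, so it
  is at most n; there is one such factor for each prime up to n.\<close>

lemma Lcm_le_power_prime_count: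
  fixes n :: nat
  assumes "n \<ge> 1"
  shows "Lcm {1..n} \<le> n ^ card {p. prime p \<and> p \<le> n}"
proof -
  define l where "l = Lcm {1..n}"
  have l0: "l \<noteq> 0" unfolding l_def by (subst Lcm_0_iff) auto
  have pow: "p ^ k \<le> n" if "prime p" "p ^ k dvd l" for p k
  proof -
    have "\<exists>a\<in>{1..n}. p ^ k dvd a"
      by (rule prime_power_dvd_Lcm) (use that assms in \<open>simp_all add: l_def\<close>)
    then obtain a where "a \<in> {1..n}" "p ^ k dvd a" by blast
    then show ?thesis using dvd_imp_le[of "p ^ k" a] by auto
  qed
  have "l = (\<Prod>p\<in>prime_factors l. p ^ multiplicity p l)"
    using l0 by (simp add: prime_factorization_nat)
  also have "\<dots> \<le> (\<Prod>p\<in>prime_factors l. n)"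
    by (intro prod_mono) (auto intro!: pow multiplicity_dvd)
  also have "\<dots> = n ^ card (prime_factors l)" by simp
  also have "\<dots> \<le> n ^ card {p. prime p \<and> p \<le> n}"
  proof (intro power_increasing card_mono assms)
    show "prime_factors l \<subseteq> {p. prime p \<and> p \<le> n}"
      using pow[of _ 1] by auto
  qed auto
  finally show ?thesis by (simp add: l_def)
qed

text \<open>A Chebyshev bound: n C(2n,n) >= 4^n/2 divides lcm(1..2n), which is at most 2n to the
  power of the number of primes up to 2n.\<close>

lemma prime_count_lower_bound:
  assumes "n \<ge> 1"
  shows "real n * ln 4 - ln 2 \<le> card {p. prime p \<and> p \<le> 2 * n} * ln (2 * real n)"
proof -
  let ?l = "Lcm {1..2 * n}" and ?c = "card {p. prime p \<and> p \<le> 2 * n}"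
  have c0: "real n * real (2 * n choose n) > 0" using assms by simp
  have "?l \<noteq> 0" by (subst Lcm_0_iff) auto
  then have l0: "real ?l > 0" by linarith
  obtain k :: int where k: "real ?l / (real n * real (2 * n choose n)) = of_int k"
    using Lcm_div_binomial_Ints[of n "2 * n"] assms by (auto elim: Ints_cases)
  have "of_int k > (0::real)" unfolding k[symmetric] using c0 l0 by simp
  then have "1 \<le> real ?l / (real n * real (2 * n choose n))" unfolding k by simp
  then have "real n * real (2 * n choose n) \<le> real ?l" using c0 by (simp add: field_simps)
  moreover have "4 ^ n / 2 \<le> real n * real (2 * n choose n)"
    using central_binomial_lower_bound[of n] assms by (simp add: field_simps)
  ultimately have "4 ^ n / 2 \<le> real ?l" by linarith
  also have "\<dots> \<le> real ((2 * n) ^ ?c)"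
    using Lcm_le_power_prime_count[of "2 * n"] assms by (simp only: of_nat_le_iff)
  finally have "ln (4 ^ n / 2) \<le> ln (real ((2 * n) ^ ?c))"
    by (subst ln_le_cancel_iff) (use assms in auto)
  also have "ln (real ((2 * n) ^ ?c)) = ?c * ln (2 * real n)"
    unfolding of_nat_power by (subst ln_realpow) (use assms in auto)
  finally show ?thesis by (simp add: ln_div ln_realpow)
qed

text \<open>Up to N^\<kappa>/36 there are at least of order N^\<kappa>/log N primes, and discarding
  those below N^(\<kappa>-\<eta>) loses at most N^(\<kappa>-\<eta>) + 1 of them. Enough remain, all
  comparable to N^\<kappa> up to N^\<eta>.\<close>

lemma many_primes:
  fixes \<kappa> \<eta> :: real
  assumes "0 < \<eta>" "\<eta> < \<kappa>" "\<kappa> < 1"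
  shows "eventually (\<lambda>N. \<exists>P. finite P \<and> N powr (\<kappa> - \<eta>) \<le> real (card P) \<and>
    (\<forall>q\<in>P. prime q \<and> odd q \<and> real N powr (\<kappa> - \<eta>) \<le> real q \<and> real q \<le> real N powr \<kappa> / 36)) sequentially"
proof -
  have "eventually (\<lambda>N. (2 * real N powr (\<kappa> - \<eta>) + 3) * ln (real N) \<le> (real N powr \<kappa> / 72 - 1) * ln 4 - ln 2) sequentially"
    using assms by real_asymp
  moreover have "eventually (\<lambda>N. 2 < real N powr (\<kappa> - \<eta>)) sequentially"
    using assms by real_asymp
  moreover have "eventually (\<lambda>N. 72 \<le> real N powr \<kappa>) sequentially"
    using assms by real_asymp
  moreover have "eventually (\<lambda>N. N \<ge> 2) sequentially" by (rule eventually_ge_at_top)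
  ultimately show ?thesis
  proof eventually_elim
    case (elim N)
    \<comment> \<open>The prime count is available up to 2n, and 2n <= N^\<kappa>/36.\<close>
    define n where "n = nat \<lfloor>real N powr \<kappa> / 72\<rfloor>"
    have "real_of_int \<lfloor>real N powr \<kappa> / 72\<rfloor> \<le> real N powr \<kappa> / 72"
      by (rule of_int_floor_le)
    moreover have "1 \<le> \<lfloor>real N powr \<kappa> / 72\<rfloor>"
      using elim(3) by (simp add: le_floor_iff)
    ultimately have n: "n \<ge> 1" "real n \<le> real N powr \<kappa> / 72" "real N powr \<kappa> / 72 - 1 \<le> real n"
      unfolding n_def by linarith+
    have "real N powr \<kappa> \<le> real N powr 1" using elim(4) assms by (intro powr_mono) auto
    then have nN: "2 * real n \<le> real N" using n(2) by simp
    define c where "c = real (card {p. prime p \<and> p \<le> 2 * n})"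
    have "(2 * real N powr (\<kappa> - \<eta>) + 3) * ln (real N) \<le> real n * ln 4 - ln 2"
      using elim(1) n(3) by (smt (verit) ln_gt_zero mult_right_mono)
    also have "\<dots> \<le> c * ln (2 * real n)"
      unfolding c_def by (rule prime_count_lower_bound[OF n(1)])
    also have "\<dots> \<le> c * ln (real N)"
      using nN n(1) by (intro mult_left_mono) (auto simp: c_def)
    finally have c: "2 * real N powr (\<kappa> - \<eta>) + 3 \<le> c"
      using elim(4) by simp
    define P where "P = {p. prime p \<and> p \<le> 2 * n} - {..<nat \<lceil>real N powr (\<kappa> - \<eta>)\<rceil>}"
    have "card {p. prime p \<and> p \<le> 2 * n} \<le> card P + card {..<nat \<lceil>real N powr (\<kappa> - \<eta>)\<rceil>}"
      unfolding P_def by (metis card_Diff1_le diff_card_le_card_Diff finite_lessThan le_diff_conv)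
    then have "c \<le> real (card P) + real (nat \<lceil>real N powr (\<kappa> - \<eta>)\<rceil>)"
      unfolding c_def card_lessThan of_nat_add[symmetric] of_nat_le_iff .
    also have "real (nat \<lceil>real N powr (\<kappa> - \<eta>)\<rceil>) \<le> real N powr (\<kappa> - \<eta>) + 1"
      by (simp add: of_nat_nat) 
    finally have "real N powr (\<kappa> - \<eta>) \<le> real (card P)" using c powr_ge_zero[of N "\<kappa> - \<eta>"] by linarith
    moreover have "prime q \<and> odd q \<and> real N powr (\<kappa> - \<eta>) \<le> real q \<and> real q \<le> real N powr \<kappa> / 36"
      if "q \<in> P" for q
    proof -
      have q: "prime q" "q \<le> 2 * n" "\<lceil>real N powr (\<kappa> - \<eta>)\<rceil> \<le> int q"
        using that by (auto simp: P_def)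
      then have "real N powr (\<kappa> - \<eta>) \<le> real q" by linarith
      moreover have "real q \<le> real N powr \<kappa> / 36"
        using q(2) n(2) by linarith
      moreover have "odd q" using q(1) calculation(1) elim(2) prime_odd_nat[of q] by auto
      ultimately show ?thesis using q(1) by simp
    qed
    moreover have "finite P" by (simp add: P_def)
    ultimately show ?case by blast
  qed
qed

section \<open>Boxes around rational points\<close>

text \<open>Pigeonhole: points at distance at least d fall into different half-open cells of length
  d.\<close>

lemma card_separated_le:
  fixes S :: "real set"
  assumes d: "0 < d" and "x \<le> y" and S: "S \<subseteq> {x..y}"
    and sep: "\<And>s s'. s \<in> S \<Longrightarrow> s' \<in> S \<Longrightarrow> s \<noteq> s' \<Longrightarrow> d \<le> \<bar>s - s'\<bar>"
  shows "finite S \<and> real (card S) \<le> (y - x) / d + 1"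
proof -
  define f where "f s = nat \<lfloor>(s - x) / d\<rfloor>" for s
  define M where "M = nat \<lfloor>(y - x) / d\<rfloor>"
  have "inj_on f S"
  proof (rule inj_onI, rule ccontr)
    fix s s' assume ss: "s \<in> S" "s' \<in> S" "f s = f s'" "s \<noteq> s'"
    have "(s - x) / d \<ge> 0" "(s' - x) / d \<ge> 0" using ss S d by auto
    then have "0 \<le> \<lfloor>(s - x) / d\<rfloor>" "0 \<le> \<lfloor>(s' - x) / d\<rfloor>"
      by (simp_all only: zero_le_floor)
    then have "\<lfloor>(s - x) / d\<rfloor> = \<lfloor>(s' - x) / d\<rfloor>"
      using ss(3) unfolding f_def by (metis eq_nat_nat_iff)
    then have "\<bar>(s - x) / d - (s' - x) / d\<bar> < 1" by linarith
    also have "(s - x) / d - (s' - x) / d = (s - s') / d"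
      by (simp add: diff_divide_distrib)
    finally have "\<bar>s - s'\<bar> < d" using d by (simp add: abs_divide)
    then show False using sep[OF ss(1,2,4)] by simp
  qed
  moreover have sub: "f ` S \<subseteq> {..M}"
    unfolding f_def M_def using S d
    by (auto intro!: nat_mono floor_mono divide_right_mono)
  ultimately have fin: "finite S" using inj_on_finite by blast
  have "card S = card (f ` S)" using \<open>inj_on f S\<close> by (simp add: card_image)
  also have "\<dots> \<le> card {..M}" by (rule card_mono) (use sub in auto)
  finally have "real (card S) \<le> real M + 1" by simp
  also have "real M \<le> (y - x) / d"
    using assms(1,2) by (simp add: M_def)
  finally show ?thesis using fin by simp
qed

lemma card_nat_interval_le:
  fixes x y :: real
  assumes "x \<le> y + 1" "J \<subseteq> {j::nat. x \<le> real j \<and> real j \<le> y}"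
  shows "finite J \<and> real (card J) \<le> y - x + 1"
proof (cases "x \<le> y")
  case True
  have "finite (real ` J) \<and> real (card (real ` J)) \<le> (y - x) / 1 + 1"
    using assms(2) True by (intro card_separated_le) auto
  then show ?thesis by (simp add: card_image finite_image_iff)
next
  case False
  then have "J = {}" using assms(2) by force
  then show ?thesis using assms by simp
qed

lemma card_nat_interval_ge:
  fixes x y :: real
  assumes "0 \<le> x"
  shows "y - x - 1 \<le> real (card {j::nat. x \<le> real j \<and> real j \<le> y})"
proof -
  have fin: "finite {j::nat. x \<le> real j \<and> real j \<le> y}"
    by (rule finite_subset[of _ "{..nat \<lfloor>y\<rfloor>}"]) (auto simp: le_nat_floor)
  have "{nat \<lceil>x\<rceil>..<nat (\<lfloor>y\<rfloor> + 1)} \<subseteq> {j::nat. x \<le> real j \<and> real j \<le> y}"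
  proof
    fix j assume "j \<in> {nat \<lceil>x\<rceil>..<nat (\<lfloor>y\<rfloor> + 1)}"
    then have "nat \<lceil>x\<rceil> \<le> j" "j < nat (\<lfloor>y\<rfloor> + 1)" by auto
    then have "\<lceil>x\<rceil> \<le> int j" "int j \<le> \<lfloor>y\<rfloor>" by linarith+
    then have "x \<le> real j" "real j \<le> y" by linarith+
    then show "j \<in> {j::nat. x \<le> real j \<and> real j \<le> y}" by simp
  qed
  from card_mono[OF fin this] have "real (nat (\<lfloor>y\<rfloor> + 1) - nat \<lceil>x\<rceil>) \<le> real (card {j::nat. x \<le> real j \<and> real j \<le> y})"
    by simp
  moreover have "y - x - 1 \<le> real (nat (\<lfloor>y\<rfloor> + 1) - nat \<lceil>x\<rceil>)"
    using assms by linarith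
  ultimately show ?thesis by linarith
qed

text \<open>The length of the intersection of [x-h, x+h] and [a,b]. The measure of an intersection
  of two plane boxes is a product of two such lengths.\<close>

definition overlap :: "real \<Rightarrow> real \<Rightarrow> real \<Rightarrow> real \<Rightarrow> real" where
  "overlap x h a b = max 0 (min (x + h) b - max (x - h) a)"

lemma overlap_nonneg [simp]: "0 \<le> overlap x h a b"
  by (simp add: overlap_def)

lemma overlap_le: "0 \<le> h \<Longrightarrow> overlap x h a b \<le> 2 * h" "a \<le> b \<Longrightarrow> overlap x h a b \<le> b - a"
  by (auto simp: overlap_def)

lemma overlap_eq_0: "0 \<le> h \<Longrightarrow> a \<le> b \<Longrightarrow> \<not> (a - h \<le> x \<and> x \<le> b + h) \<Longrightarrow> overlap x h a b = 0"
  by (auto simp: overlap_def)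

lemma overlap_full: "0 \<le> h \<Longrightarrow> a + h \<le> x \<Longrightarrow> x \<le> b - h \<Longrightarrow> overlap x h a b = 2 * h"
  by (auto simp: overlap_def)

text \<open>The left side is the mass that [a,b] receives when each j/q carries mass 1/q spread over
  half-width h. Only j/q in [a-h, b+h] contribute, at most 2h each; the term 1/q is the counting
  error.\<close>

lemma sum_overlap_le:
  fixes q :: nat and h a b :: real
  assumes "0 < h" "a \<le> b" "0 < q"
  shows "(\<Sum>j\<in>{1..<q}. overlap (j / q) h a b) / (2 * h * q) \<le> (b - a) + 2 * h + 1 / q"
proof -
  let ?J = "{j\<in>{1..<q}. a - h \<le> j / q \<and> j / q \<le> b + h}"
  have "(\<Sum>j\<in>{1..<q}. overlap (j / q) h a b) = (\<Sum>j\<in>?J. overlap (j / q) h a b)"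
    using overlap_eq_0[of h a b] assms by (intro sum.mono_neutral_right) auto
  also have "\<dots> \<le> (\<Sum>j\<in>?J. 2 * h)"
    by (intro sum_mono overlap_le) (use assms in auto)
  also have "\<dots> = 2 * h * real (card ?J)" by simp
  also have "real (card ?J) \<le> q * (b + h) - q * (a - h) + 1"
  proof (rule card_nat_interval_le[THEN conjunct2])
    have "q * (a - h) \<le> q * (b + h)" using assms by (intro mult_left_mono) auto
    then show "q * (a - h) \<le> q * (b + h) + 1" by simp
    show "?J \<subseteq> {j. q * (a - h) \<le> real j \<and> real j \<le> q * (b + h)}"
      using assms by (auto simp: field_simps)
  qed
  finally have "(\<Sum>j\<in>{1..<q}. overlap (j / q) h a b) \<le> 2 * h * (q * (b + h) - q * (a - h) + 1)"
    using assms by simp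
  then have "(\<Sum>j\<in>{1..<q}. overlap (j / q) h a b) / (2 * h * q) \<le> 2 * h * (q * (b + h) - q * (a - h) + 1) / (2 * h * q)"
    using assms by (intro divide_right_mono) auto
  also have "\<dots> = (b - a) + 2 * h + 1 / q"
    using assms by (simp add: field_simps)
  finally show ?thesis .
qed

lemma sum_overlap_ge:
  fixes q :: nat and h a b :: real
  assumes "0 < h" "0 \<le> a" "b \<le> 1" "0 < q"
  shows "(b - a) - 2 * h - 1 / q \<le> (\<Sum>j\<in>{1..<q}. overlap (j / q) h a b) / (2 * h * q)"
proof -
  let ?J = "{j::nat. q * (a + h) \<le> real j \<and> real j \<le> q * (b - h)}"
  \<comment> \<open>The missing numerators 0 and q do no harm: an interval of positive half-width
    that lies inside [0,1] is never centred at an endpoint.\<close>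
  have J: "0 < j \<and> j < q \<and> a + h \<le> j / q \<and> j / q \<le> b - h" if "j \<in> ?J" for j
  proof -
    have 1: "a + h \<le> j / q" "j / q \<le> b - h" using that assms by (auto simp: field_simps)
    then have "0 < real j / q" "real j / q < 1" using assms by linarith+
    then show ?thesis using 1 assms by (auto simp: field_simps zero_less_divide_iff)
  qed
  have "2 * h * (q * (b - h) - q * (a + h) - 1) \<le> 2 * h * real (card ?J)"
    using assms by (intro mult_left_mono card_nat_interval_ge) auto
  also have "\<dots> = (\<Sum>j\<in>?J. overlap (j / q) h a b)"
  proof -
    have "(\<Sum>j\<in>?J. overlap (j / q) h a b) = (\<Sum>j\<in>?J. 2 * h)"
    proof (rule sum.cong[OF refl])
      fix j assume "j \<in> ?J"
      from J[OF this] show "overlap (j / q) h a b = 2 * h"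
        using assms(1) by (intro overlap_full) auto
    qed
    then show ?thesis by simp
  qed
  also have "\<dots> \<le> (\<Sum>j\<in>{1..<q}. overlap (j / q) h a b)"
  proof (rule sum_mono2)
    show "?J \<subseteq> {1..<q}"
    proof
      fix j assume "j \<in> ?J"
      from J[OF this] show "j \<in> {1..<q}" by auto
    qed
  qed auto
  finally have "2 * h * (q * (b - h) - q * (a + h) - 1) / (2 * h * q) \<le> (\<Sum>j\<in>{1..<q}. overlap (j / q) h a b) / (2 * h * q)"
    using assms by (intro divide_right_mono) auto
  moreover have "2 * h * (q * (b - h) - q * (a + h) - 1) / (2 * h * q) = (b - a) - 2 * h - 1 / q"
    using assms by (simp add: field_simps)
  ultimately show ?thesis by simp
qed

text \<open>The coefficient gives each box mass 1/(|P| q^2): all denominators carry nearly equal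
  mass and the total is close to 1.\<close>

definition rat_box :: "nat set \<Rightarrow> real \<Rightarrow> real \<Rightarrow> nat \<times> nat \<times> nat \<Rightarrow> real \<times> (real^2) \<times> (real^2)" where
  "rat_box P h1 h2 = (\<lambda>(q, a1, a2). (1 / (real (card P) * (2 * h1 * real q) * (2 * h2 * real q)),
     vector [real a1 / real q - h1, real a2 / real q - h2],
     vector [real a1 / real q + h1, real a2 / real q + h2]))"

definition rat_index :: "nat set \<Rightarrow> (nat \<times> nat \<times> nat) set" where
  "rat_index P = (SIGMA q:P. {1..<q} \<times> {1..<q})"

lemma measure_rat_box_Int:
  fixes x y h1 h2 :: real and a b :: "real^2"
  shows "measure lborel (cbox (vector [x - h1, y - h2]) (vector [x + h1, y + h2]) \<inter> cbox a b)
    = overlap x h1 (a $ 1) (b $ 1) * overlap y h2 (a $ 2) (b $ 2)"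
  by (simp add: cbox_Int_cart measure_cbox_real2 overlap_def)

lemma box_mass_rat_boxes:
  fixes h1 h2 :: real
  assumes "set xs = rat_index P" "distinct xs"
  shows "box_mass (map (rat_box P h1 h2) xs) (cbox a b) =
    (\<Sum>(q, a1, a2)\<in>rat_index P. 1 / (card P * (2 * h1 * q) * (2 * h2 * q)) *
       (overlap (a1 / q) h1 (a $ 1) (b $ 1) * overlap (a2 / q) h2 (a $ 2) (b $ 2)))"
proof -
  have "box_mass (map (rat_box P h1 h2) xs) (cbox a b) =
    (\<Sum>(q, a1, a2)\<leftarrow>xs. 1 / (card P * (2 * h1 * q) * (2 * h2 * q)) *
       (overlap (a1 / q) h1 (a $ 1) (b $ 1) * overlap (a2 / q) h2 (a $ 2) (b $ 2)))"
    unfolding box_mass_def map_map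
    by (intro arg_cong[of _ _ sum_list] map_cong refl)
      (auto simp: rat_box_def measure_rat_box_Int)
  then show ?thesis
    using assms by (simp add: sum_list_distinct_conv_sum_set)
qed

text \<open>For a fixed denominator the centres form a product grid, so its contribution is a
  product of one-dimensional masses; these are then averaged over the denominators.\<close>

lemma box_mass_rat_boxes_product:
  fixes h1 h2 :: real
  assumes "set xs = rat_index P" "distinct xs" "finite P"
  shows "box_mass (map (rat_box P h1 h2) xs) (cbox a b) =
    (\<Sum>q\<in>P. ((\<Sum>j\<in>{1..<q}. overlap (j / q) h1 (a $ 1) (b $ 1)) / (2 * h1 * q)) *
            ((\<Sum>j\<in>{1..<q}. overlap (j / q) h2 (a $ 2) (b $ 2)) / (2 * h2 * q))) / card P"
proof -
  have aux: "1 / (c * A * B) * (S * T) = (S / A) * (T / B) / c" for c A B S T :: real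
    by simp
  have "box_mass (map (rat_box P h1 h2) xs) (cbox a b) = (\<Sum>q\<in>P. \<Sum>(a1, a2)\<in>{1..<q}\<times>{1..<q}. 
      1 / (card P * (2 * h1 * q) * (2 * h2 * q)) *
       (overlap (a1 / q) h1 (a $ 1) (b $ 1) * overlap (a2 / q) h2 (a $ 2) (b $ 2)))"
    unfolding box_mass_rat_boxes[OF assms(1,2)] rat_index_def
    by (subst sum.Sigma) (use assms(3) in auto)
  also have "\<dots> = (\<Sum>q\<in>P. 1 / (card P * (2 * h1 * q) * (2 * h2 * q)) *
      ((\<Sum>j\<in>{1..<q}. overlap (j / q) h1 (a $ 1) (b $ 1)) * (\<Sum>j\<in>{1..<q}. overlap (j / q) h2 (a $ 2) (b $ 2))))"
    by (intro sum.cong refl, simp only: sum_product sum.cartesian_product)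
      (simp only: sum_distrib_left case_prod_unfold)
  finally show ?thesis
    unfolding sum_divide_distrib[of _ P] by (simp only: aux)
qed

text \<open>Every one-dimensional factor is within 2h + 1/q <= 2\<delta> of the side length.
  Replacing one factor at a time costs 2\<delta> * 3 + 2\<delta>, since the factors are at most 1 +
  2\<delta> <= 3.\<close>

lemma rat_boxes_equidistributed:
  fixes h1 h2 \<delta> :: real
  assumes xs: "set xs = rat_index P" "distinct xs" and P: "finite P" "P \<noteq> {}"
    and h: "0 < h1" "0 < h2" and \<delta>: "2 * h1 \<le> \<delta>" "2 * h2 \<le> \<delta>" "\<And>q. q \<in> P \<Longrightarrow> 0 < q \<and> 1 / q \<le> \<delta>" "\<delta> \<le> 1"
    and ab: "cbox a b \<subseteq> unit_square"
  shows "\<bar>box_mass (map (rat_box P h1 h2) xs) (cbox a b) - measure lborel (cbox a b)\<bar> \<le> 8 * \<delta>"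
proof (cases "cbox a b = {}")
  case True
  have "0 < \<delta>" using h \<delta>(1) by linarith
  then show ?thesis using True by simp
next
  case False
  have ab_le: "a $ i \<le> b $ i" for i using False by (auto simp: interval_ne_empty_cart)
  have "a \<in> unit_square" "b \<in> unit_square" using ab ab_le by (auto simp: mem_box_cart)
  then have ab01: "0 \<le> a $ i" "b $ i \<le> 1" for i by (auto simp: square_def mem_box_cart)
  define A where "A q = (\<Sum>j\<in>{1..<q}. overlap (j / q) h1 (a $ 1) (b $ 1)) / (2 * h1 * q)" for q :: nat
  define B where "B q = (\<Sum>j\<in>{1..<q}. overlap (j / q) h2 (a $ 2) (b $ 2)) / (2 * h2 * q)" for q :: nat
  define k l where "k = b $ 1 - a $ 1" and "l = b $ 2 - a $ 2"
  have kl: "0 \<le> k" "k \<le> 1" "0 \<le> l" "l \<le> 1"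
    using ab_le ab01[of 1] ab01[of 2] by (auto simp: k_def l_def)
  have meas: "measure lborel (cbox a b) = k * l"
    using kl by (simp add: measure_cbox_real2 k_def l_def)
  have close: "\<bar>A q * B q - k * l\<bar> \<le> 8 * \<delta>" if "q \<in> P" for q
  proof -
    have q: "0 < q" "1 / q \<le> \<delta>" using \<delta>(3)[OF that] by auto
    have A: "\<bar>A q - k\<bar> \<le> 2 * \<delta>"
      using sum_overlap_le[OF h(1) ab_le q(1), of 1] sum_overlap_ge[OF h(1) ab01(1) ab01(2) q(1), of 1 1] q(2) \<delta>(1)
      unfolding A_def k_def by linarith
    have B: "\<bar>B q - l\<bar> \<le> 2 * \<delta>"
      using sum_overlap_le[OF h(2) ab_le q(1), of 2] sum_overlap_ge[OF h(2) ab01(1) ab01(2) q(1), of 2 2] q(2) \<delta>(2)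
      unfolding B_def l_def by linarith
    have "A q * B q - k * l = (A q - k) * B q + k * (B q - l)" by (simp add: algebra_simps)
    also have "\<bar>\<dots>\<bar> \<le> \<bar>A q - k\<bar> * \<bar>B q\<bar> + \<bar>k\<bar> * \<bar>B q - l\<bar>"
      by (metis abs_mult abs_triangle_ineq)
    also have "\<dots> \<le> 2 * \<delta> * 3 + 1 * (2 * \<delta>)"
      using A B kl \<delta>(4) by (intro add_mono mult_mono) auto
    finally show ?thesis by simp
  qed
  have c0: "real (card P) > 0" using P by (simp add: card_gt_0_iff)
  have "box_mass (map (rat_box P h1 h2) xs) (cbox a b) - measure lborel (cbox a b)
      = (\<Sum>q\<in>P. A q * B q - k * l) / card P"
    unfolding box_mass_rat_boxes_product[OF xs P(1)] meas A_def[symmetric] B_def[symmetric]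
    using c0 by (simp add: sum_subtractf field_simps)
  also have "\<bar>\<dots>\<bar> = \<bar>\<Sum>q\<in>P. A q * B q - k * l\<bar> / card P"
    by simp
  also have "\<dots> \<le> (\<Sum>q\<in>P. 8 * \<delta>) / card P"
    by (intro divide_right_mono order_trans[OF sum_abs] sum_mono close) auto
  also have "\<dots> = 8 * \<delta>" using c0 by simp
  finally show ?thesis .
qed

lemma rat_boxes_mass_large_square:
  fixes h1 h2 \<delta> r :: real
  assumes xs: "set xs = rat_index P" "distinct xs" and P: "finite P" "P \<noteq> {}"
    and h: "0 < h1" "0 < h2" and \<delta>: "2 * h1 \<le> \<delta>" "2 * h2 \<le> \<delta>" "\<And>q. q \<in> P \<Longrightarrow> 0 < q \<and> 1 / q \<le> \<delta>"
    and r: "0 < r"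
  shows "box_mass (map (rat_box P h1 h2) xs) (square z r) \<le> (r + 2 * \<delta>)^2"
proof -
  define A where "A q = (\<Sum>j\<in>{1..<q}. overlap (j / q) h1 (z $ 1) (z $ 1 + r)) / (2 * h1 * q)" for q :: nat
  define B where "B q = (\<Sum>j\<in>{1..<q}. overlap (j / q) h2 (z $ 2) (z $ 2 + r)) / (2 * h2 * q)" for q :: nat
  have close: "A q * B q \<le> (r + 2 * \<delta>)^2" if "q \<in> P" for q
  proof -
    have q: "0 < q" "1 / q \<le> \<delta>" using \<delta>(3)[OF that] by auto
    have z: "z $ i \<le> z $ i + r" for i using r by simp
    have A: "A q \<le> r + 2 * \<delta>"
      using sum_overlap_le[OF h(1) z q(1), of 1] q(2) \<delta>(1)
      unfolding A_def by linarith
    have B: "B q \<le> r + 2 * \<delta>"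
      using sum_overlap_le[OF h(2) z q(1), of 2] q(2) \<delta>(2)
      unfolding B_def by linarith
    have "0 \<le> A q" "0 \<le> B q"
      using h by (auto simp: A_def B_def intro!: divide_nonneg_nonneg sum_nonneg)
    then show ?thesis unfolding power2_eq_square using A B by (intro mult_mono) auto
  qed
  have c0: "real (card P) > 0" using P by (simp add: card_gt_0_iff)
  have "box_mass (map (rat_box P h1 h2) xs) (square z r) = (\<Sum>q\<in>P. A q * B q) / card P"
    unfolding square_def box_mass_rat_boxes_product[OF xs P(1)] A_def B_def by simp
  also have "\<dots> \<le> (\<Sum>q\<in>P. (r + 2 * \<delta>)^2) / card P"
    by (intro divide_right_mono sum_mono close) auto
  also have "\<dots> = (r + 2 * \<delta>)^2" using c0 by simp
  finally show ?thesis .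
qed

section \<open>Separation of fractions and the mass of small squares\<close>

lemma prime_fraction_diff_ge:
  fixes p q a b :: nat
  assumes "prime p" "prime q" "a \<in> {1..<p}" "b \<in> {1..<q}" "(p, a) \<noteq> (q, b)"
  shows "1 / (real p * real q) \<le> \<bar>a / p - b / q\<bar>"
proof -
  \<comment> \<open>Equality would make p divide q, as p does not divide a; then p = q and a = b.
    The numerator of the difference is thus a nonzero integer.\<close>
  have "a * q \<noteq> b * p"
  proof
    assume eq: "a * q = b * p"
    then have "p dvd a * q" by simp
    then have "p dvd q" using assms(1,3) by (auto simp: prime_dvd_mult_iff dest: dvd_imp_le)
    then have "p = q" using assms(1,2) by (simp add: primes_dvd_imp_eq)
    then show False using eq assms by (simp add: prime_gt_0_nat)
  qed
  then have "int a * int q - int b * int p \<noteq> 0"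
    by (metis eq_iff_diff_eq_0 of_nat_eq_iff of_nat_mult)
  then have "1 \<le> \<bar>int a * int q - int b * int p\<bar>" by linarith
  then have "1 \<le> real_of_int \<bar>int a * int q - int b * int p\<bar>" by (simp only: of_int_1_le_iff)
  then have 1: "1 \<le> \<bar>real a * real q - real b * real p\<bar>" by simp
  have pq: "real p > 0" "real q > 0" using assms by (simp_all add: prime_gt_0_nat)
  have "a / p - b / q = (real a * real q - real b * real p) / (real p * real q)"
    using pq by (simp add: field_simps)
  then have "\<bar>a / p - b / q\<bar> = \<bar>real a * real q - real b * real p\<bar> / (real p * real q)"
    using pq by (simp add: abs_mult)
  then show ?thesis using 1 pq by (simp add: divide_right_mono)
qed

text \<open>On a square smaller than the spacing \<open>1/q\<close> each fraction \<open>a2/q\<close> determines the whole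
  triple, so the boxes that meet the square are counted by the separation of the fractions.\<close>

lemma card_rat_index_near_le:
  fixes h1 h2 x y r R :: real
  assumes P: "\<And>q. q \<in> P \<Longrightarrow> prime q \<and> real q \<le> R"
    and h: "0 < h1" "0 < h2" and r: "0 < r" "(r + 2 * h1) * R < 1"
  defines "T \<equiv> {(q::nat, a1::nat, a2::nat)\<in>rat_index P. x - h1 \<le> real a1 / real q \<and> real a1 / real q \<le> x + r + h1 \<and>
     y - h2 \<le> real a2 / real q \<and> real a2 / real q \<le> y + r + h2}"
  shows "real (card T) \<le> (r + 2 * h2) * R^2 + 1"
proof (cases "T = {}")
  case True
  then show ?thesis using h r by simp
next
  case False
  define f :: "nat \<times> nat \<times> nat \<Rightarrow> real" where "f = (\<lambda>(q, a1, a2). a2 / q)"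
  have sep: "1 / R^2 \<le> \<bar>f t - f t'\<bar>" if t: "t \<in> T" "t' \<in> T" "t \<noteq> t'" for t t'
  proof -
    obtain q a1 a2 q' b1 b2 where eq: "t = (q, a1, a2)" "t' = (q', b1, b2)"
      by (cases t, cases t') auto
    have q: "prime q" "real q \<le> R" "prime q'" "real q' \<le> R"
      using t P by (auto simp: T_def eq rat_index_def)
    have q0: "real q > 0" "real q' > 0" using q by (simp_all add: prime_gt_0_nat)
    have "(q, a2) \<noteq> (q', b2)"
    proof
      assume *: "(q, a2) = (q', b2)"
      then have ne: "a1 \<noteq> b1" using t(3) eq by auto
      have "x - h1 \<le> a1 / q" "a1 / q \<le> x + r + h1" "x - h1 \<le> b1 / q" "b1 / q \<le> x + r + h1"
        using t * by (auto simp: T_def eq)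
      then have "\<bar>a1 / q - b1 / q\<bar> \<le> r + 2 * h1" by linarith
      then have "\<bar>real a1 - real b1\<bar> \<le> (r + 2 * h1) * q"
        using q0 by (simp add: diff_divide_distrib[symmetric] field_simps)
      also have "\<dots> \<le> (r + 2 * h1) * R" using q h r by (intro mult_left_mono) auto
      finally show False using ne r(2) by linarith
    qed
    then have "1 / (real q * real q') \<le> \<bar>f t - f t'\<bar>"
      unfolding f_def eq using t q by (auto simp: T_def eq rat_index_def intro!: prime_fraction_diff_ge)
    moreover have "1 / R^2 \<le> 1 / (real q * real q')"
      unfolding power2_eq_square using q q0 by (intro divide_left_mono mult_mono) auto
    ultimately show ?thesis by linarith
  qed
  obtain t where "t \<in> T" using False by blast
  then obtain q where "q \<in> P" by (auto simp: T_def rat_index_def)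
  then have "R > 0" using P[of q] prime_gt_0_nat[of q] by linarith
  then have R: "1 / R^2 > 0" by simp
  have inj: "inj_on f T"
  proof (rule inj_onI, rule ccontr)
    fix t t' assume "t \<in> T" "t' \<in> T" "f t = f t'" "t \<noteq> t'"
    with sep[of t t'] R show False by simp
  qed
  have "finite (f ` T) \<and> real (card (f ` T)) \<le> ((y + r + h2) - (y - h2)) / (1 / R^2) + 1"
  proof (rule card_separated_le[OF R])
    show "f ` T \<subseteq> {y - h2..y + r + h2}" by (auto simp: T_def f_def)
    show "1 / R^2 \<le> \<bar>u - u'\<bar>" if u: "u \<in> f ` T" "u' \<in> f ` T" "u \<noteq> u'" for u u'
    proof -
      obtain t t' where "t \<in> T" "t' \<in> T" "u = f t" "u' = f t'" using u by blast
      then show ?thesis using sep[of t t'] u(3) by auto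
    qed
  qed (use h r in auto)
  then show ?thesis using inj by (simp add: card_image algebra_simps)
qed

text \<open>The number of boxes near the square times the mass it can take from one of them: a box
  has mass at most 1/D^3, and the square meets at most the proportion min 1 (r/(2 h)) of it in each
  direction.\<close>

lemma rat_boxes_mass_small_square:
  fixes h1 h2 D r R :: real
  assumes xs: "set xs = rat_index P" "distinct xs" and P: "finite P"
    and P': "\<And>q. q \<in> P \<Longrightarrow> prime q \<and> D \<le> real q \<and> real q \<le> R" "D \<le> real (card P)" and D: "0 < D"
    and h: "0 < h1" "0 < h2" and r: "0 < r" "(r + 2 * h1) * R < 1"
  shows "box_mass (map (rat_box P h1 h2) xs) (square z r) \<le>
    ((r + 2 * h2) * R^2 + 1) / D^3 * (min 1 (r / (2 * h1)) * min 1 (r / (2 * h2)))"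
proof -
  define T where "T = {(q, a1, a2)\<in>rat_index P. z $ 1 - h1 \<le> real a1 / real q \<and> real a1 / real q \<le> z $ 1 + r + h1 \<and>
     z $ 2 - h2 \<le> real a2 / real q \<and> real a2 / real q \<le> z $ 2 + r + h2}"
  define m where "m = min 1 (r / (2 * h1)) * min 1 (r / (2 * h2))"
  have m0: "0 \<le> m" using h r by (auto simp: m_def)
  have fin: "finite (rat_index P)" unfolding rat_index_def using P by auto
  define F where "F = (\<lambda>(q::nat, a1::nat, a2::nat). 1 / (card P * (2 * h1 * q) * (2 * h2 * q)) *
       (overlap (a1 / q) h1 (z $ 1) (z $ 1 + r) * overlap (a2 / q) h2 (z $ 2) (z $ 2 + r)))"
  have "box_mass (map (rat_box P h1 h2) xs) (square z r) = (\<Sum>t\<in>rat_index P. F t)"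
    unfolding square_def box_mass_rat_boxes[OF xs] F_def by simp
  also have "\<dots> = (\<Sum>t\<in>T. F t)"
  proof (rule sum.mono_neutral_right[OF fin])
    show "T \<subseteq> rat_index P" by (auto simp: T_def)
    show "\<forall>t\<in>rat_index P - T. F t = 0"
    proof
      fix t assume t: "t \<in> rat_index P - T"
      obtain q a1 a2 where eq: "t = (q, a1, a2)" by (cases t)
      have "\<not> (z $ 1 - h1 \<le> real a1 / real q \<and> real a1 / real q \<le> z $ 1 + r + h1) \<or>
          \<not> (z $ 2 - h2 \<le> real a2 / real q \<and> real a2 / real q \<le> z $ 2 + r + h2)"
        using t by (auto simp: T_def eq)
      then have "overlap (a1 / q) h1 (z $ 1) (z $ 1 + r) = 0 \<or> overlap (a2 / q) h2 (z $ 2) (z $ 2 + r) = 0"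
        using overlap_eq_0[of h1 "z $ 1" "z $ 1 + r" "a1 / q"] overlap_eq_0[of h2 "z $ 2" "z $ 2 + r" "a2 / q"] h r
        by auto
      then show "F t = 0" by (auto simp: F_def eq)
    qed
  qed
  also have "\<dots> \<le> (\<Sum>t\<in>T. m / D^3)"
  proof (rule sum_mono)
    fix t assume t: "t \<in> T"
    obtain q a1 a2 where eq: "t = (q, a1, a2)" by (cases t)
    have q: "D \<le> real q" using t P' by (auto simp: T_def eq rat_index_def)
    have o1: "overlap (a1 / q) h1 (z $ 1) (z $ 1 + r) / (2 * h1) \<le> min 1 (r / (2 * h1))"
      using overlap_le(1)[of h1 "a1 / q" "z $ 1" "z $ 1 + r"] overlap_le(2)[of "z $ 1" "z $ 1 + r" "a1 / q" h1] h r
      by (auto intro!: divide_right_mono)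
    have o2: "overlap (a2 / q) h2 (z $ 2) (z $ 2 + r) / (2 * h2) \<le> min 1 (r / (2 * h2))"
      using overlap_le(1)[of h2 "a2 / q" "z $ 2" "z $ 2 + r"] overlap_le(2)[of "z $ 2" "z $ 2 + r" "a2 / q" h2] h r
      by (auto intro!: divide_right_mono)
    have "F t = (overlap (a1 / q) h1 (z $ 1) (z $ 1 + r) / (2 * h1)) * (overlap (a2 / q) h2 (z $ 2) (z $ 2 + r) / (2 * h2))
         / (card P * real q * real q)"
      by (simp add: F_def eq)
    also have "\<dots> \<le> m / (D * D * D)"
      unfolding m_def using q D P'(2) h r
      by (intro frac_le mult_mono o1 o2) auto
    finally show "F t \<le> m / D^3" by (simp add: power3_eq_cube)
  qed
  also have "\<dots> = real (card T) * (m / D^3)" by simp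
  also have "\<dots> \<le> ((r + 2 * h2) * R^2 + 1) * (m / D^3)"
    unfolding T_def using m0 D P' h r
    by (intro mult_right_mono card_rat_index_near_le) auto
  finally show ?thesis by (simp add: m_def)
qed

section \<open>The dimension of the exceptional set\<close>

text \<open>Interpolation between the two bounds 1 and x; the exponent u is later chosen to produce
  the required power of r.\<close>

lemma min_one_le_powr:
  fixes x u :: real
  assumes "0 < x" "0 \<le> u" "u \<le> 1"
  shows "min 1 x \<le> x powr u"
proof (cases "x \<le> 1")
  case True
  then have "x powr 1 \<le> x powr u" using assms by (intro powr_mono') auto
  then show ?thesis using assms True by simp
next
  case False
  then show ?thesis using assms by (simp add: ge_one_powr_ge_zero)
qed

text \<open>The two summands are the counted boxes and the bounded number that a square may always
  meet. The second decides the dimension: for t <= 1 interpolation takes (rX)^t and needs t <=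
  3\<kappa>, for t > 1 it takes (rX)(rX^2)^(t-1) and needs 2t <= 1 + 3\<kappa>, up to \<eta>. For
  \<kappa> = 2 - 2\<alpha> these are 6(1-\<alpha>) and 7/2 - 3\<alpha>. The first summand asks for t
  <= 1 + \<kappa>, again up to \<eta>.\<close>

lemma small_square_exponents:
  fixes X \<kappa> \<eta> r t :: real
  assumes X: "1 \<le> X" and r: "0 < r" "r \<le> 1" and t: "0 < t" "t \<le> 2"
    and \<eta>: "3 * \<eta> \<le> \<kappa>" "t \<le> 3 * \<kappa> - 3 * \<eta>" "2 * t \<le> 1 + 3 * \<kappa> - 3 * \<eta>" "t \<le> 1 + \<kappa> - 3 * \<eta>"
  shows "(r * X powr (2 * \<kappa>) + 2) / X powr (3 * \<kappa> - 3 * \<eta>) * (min 1 (r * X) * min 1 (r * X^2)) \<le> 3 * r powr t"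
proof -
  define m where "m = min 1 (r * X) * min 1 (r * X^2)"
  have rX: "0 < r * X" "0 < r * X^2" using X r by auto
  have m: "0 \<le> m" "m \<le> 1" using rX by (auto simp: m_def intro!: mult_le_one)
  have le1: "X powr y \<le> 1" if "y \<le> 0" for y
    using powr_mono[OF that X] X by simp
  have X2: "X^2 = X powr 2" using X by simp
  have 1: "m / X powr (3 * \<kappa> - 3 * \<eta>) \<le> r powr t"
  proof (cases "t \<le> 1")
    case True
    have "m \<le> (r * X) powr t * 1"
      unfolding m_def using rX t True by (intro mult_mono min_one_le_powr) auto
    then have "m / X powr (3 * \<kappa> - 3 * \<eta>) \<le> (r * X) powr t / X powr (3 * \<kappa> - 3 * \<eta>)"
      by (intro divide_right_mono) auto
    also have "\<dots> = r powr t * X powr (t - (3 * \<kappa> - 3 * \<eta>))"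
      using r X by (simp add: powr_mult powr_diff)
    also have "\<dots> \<le> r powr t * 1" by (intro mult_left_mono le1) (use \<eta> in auto)
    finally show ?thesis by simp
  next
    case False
    have "m \<le> (r * X) powr 1 * (r * X^2) powr (t - 1)"
      unfolding m_def using rX t False by (intro mult_mono min_one_le_powr) auto
    also have "\<dots> = (r powr 1 * r powr (t - 1)) * (X powr 1 * X powr (2 * (t - 1)))"
      using r X unfolding X2 by (simp only: powr_mult powr_powr) (simp add: mult_ac)
    also have "\<dots> = r powr t * X powr (2 * t - 1)"
      by (simp only: powr_add[symmetric]) (simp add: algebra_simps)
    finally have "m / X powr (3 * \<kappa> - 3 * \<eta>) \<le> r powr t * X powr (2 * t - 1) / X powr (3 * \<kappa> - 3 * \<eta>)"
      by (intro divide_right_mono) auto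
    also have "\<dots> = r powr t * X powr (2 * t - 1 - (3 * \<kappa> - 3 * \<eta>))"
      by (simp add: powr_diff)
    also have "\<dots> \<le> r powr t * 1" by (intro mult_left_mono le1) (use \<eta> in auto)
    finally show ?thesis by simp
  qed
  have 2: "r * X powr (2 * \<kappa>) * m / X powr (3 * \<kappa> - 3 * \<eta>) \<le> r powr t"
  proof -
    have eq: "r * X powr (2 * \<kappa>) * m / X powr (3 * \<kappa> - 3 * \<eta>) = r * m * X powr (3 * \<eta> - \<kappa>)"
    proof -
      have "X powr (2 * \<kappa>) / X powr (3 * \<kappa> - 3 * \<eta>) = X powr (3 * \<eta> - \<kappa>)"
        by (simp add: powr_diff[symmetric])
      then show ?thesis by (metis (no_types, lifting) mult.assoc mult.commute times_divide_eq_right)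
    qed
    show ?thesis
    proof (cases "t \<le> 1")
      case True
      have "r * m * X powr (3 * \<eta> - \<kappa>) \<le> r * 1 * 1"
        using m r by (intro mult_mono le1) (use \<eta> in auto)
      also have "\<dots> \<le> r powr t" using powr_mono'[OF True, of r] r by simp
      finally show ?thesis by (simp only: eq)
    next
      case False
      have "m \<le> (r * X) powr (t - 1) * 1"
        unfolding m_def using rX t False by (intro mult_mono min_one_le_powr) auto
      then have "r * m * X powr (3 * \<eta> - \<kappa>) \<le> r * (r * X) powr (t - 1) * X powr (3 * \<eta> - \<kappa>)"
        using r by (intro mult_right_mono mult_left_mono) auto
      also have "\<dots> = (r powr 1 * r powr (t - 1)) * (X powr (t - 1) * X powr (3 * \<eta> - \<kappa>))"
        using r X by (simp add: powr_mult)
      also have "\<dots> = r powr t * X powr (t - 1 + (3 * \<eta> - \<kappa>))"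
        by (simp only: powr_add[symmetric]) simp
      also have "\<dots> \<le> r powr t * 1" by (intro mult_left_mono le1) (use \<eta> in auto)
      finally show ?thesis by (simp add: eq)
    qed
  qed
  have "(r * X powr (2 * \<kappa>) + 2) / X powr (3 * \<kappa> - 3 * \<eta>) * m =
      r * X powr (2 * \<kappa>) * m / X powr (3 * \<kappa> - 3 * \<eta>) + 2 * (m / X powr (3 * \<kappa> - 3 * \<eta>))"
    by (simp add: add_divide_distrib distrib_right)
  also have "\<dots> \<le> r powr t + 2 * r powr t" using 1 2 by linarith
  finally show ?thesis by (simp add: m_def)
qed

text \<open>Squares of side at least X^(-\<kappa>) are treated by equidistribution for each q;
  smaller ones are below the spacing of the fractions with one denominator, so the separation count
  applies. The constant is 972 = 18^2 * 3, where 18 = 36/2 comes from the side lengths 2/(36 X) and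
  2/(36 X^2).\<close>

lemma rat_boxes_frostman:
  fixes X \<kappa> \<eta> r t :: real
  assumes xs: "set xs = rat_index P" "distinct xs" and P: "finite P"
    and P': "\<And>q. q \<in> P \<Longrightarrow> prime q \<and> X powr (\<kappa> - \<eta>) \<le> real q \<and> real q \<le> X powr \<kappa> / 36" 
      "X powr (\<kappa> - \<eta>) \<le> real (card P)"
    and X: "1 \<le> X" and r: "0 < r" "r \<le> 1" and t: "0 < t" "t < 2" and \<kappa>: "\<kappa> < 1" "0 < \<eta>" "\<eta> < \<kappa>"
    and \<eta>: "3 * \<eta> \<le> \<kappa>" "2 * \<eta> \<le> \<kappa> * (2 - t)" "t \<le> 3 * \<kappa> - 3 * \<eta>" "2 * t \<le> 1 + 3 * \<kappa> - 3 * \<eta>" "t \<le> 1 + \<kappa> - 3 * \<eta>"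
  shows "box_mass (map (rat_box P (1 / (36 * X)) (1 / (36 * X^2))) xs) (square z r) \<le> 972 * r powr t"
proof -
  define D where "D = X powr (\<kappa> - \<eta>)"
  have D: "0 < D" using X by (simp add: D_def)
  have P0: "P \<noteq> {}" using P'(2) D by (auto simp: D_def)
  have "D \<le> X" using powr_mono[of "\<kappa> - \<eta>" 1 X] X \<kappa> by (simp add: D_def)
  then have XD: "1 / X \<le> 1 / D" using D by (intro divide_left_mono) auto
  have X2: "1 / X^2 \<le> 1 / X" using X by (intro divide_left_mono) (auto simp: power2_eq_square)
  show ?thesis
  proof (cases "X powr (- \<kappa>) \<le> r")
    case True
    have "box_mass (map (rat_box P (1 / (36 * X)) (1 / (36 * X^2))) xs) (square z r) \<le> (r + 2 * (1 / D))^2"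
    proof (rule rat_boxes_mass_large_square[OF xs P P0])
      show "2 * (1 / (36 * X)) \<le> 1 / D"
        by (rule order_trans[OF _ XD]) (use X in \<open>simp add: field_simps\<close>)
      have "2 * (1 / (36 * X^2)) \<le> 1 / X^2" using X by (simp add: field_simps)
      then show "2 * (1 / (36 * X^2)) \<le> 1 / D" using X2 XD by linarith
      show "0 < q \<and> 1 / q \<le> 1 / D" if "q \<in> P" for q
        using P'(1)[OF that] D by (auto simp: D_def[symmetric] prime_gt_0_nat intro!: divide_left_mono mult_pos_pos)
    qed (use X r in auto)
    also have "\<dots> \<le> (3 * max r (1 / D))^2"
      using r D by (intro power_mono) auto
    also have "\<dots> = 9 * (max r (1 / D))^2" by (simp add: power_mult_distrib)
    also have "(max r (1 / D))^2 \<le> r powr t"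
    proof (cases "1 / D \<le> r")
      case True
      have "r powr 2 \<le> r powr t" using r t by (intro powr_mono') auto
      then show ?thesis using True r by simp
    next
      case False
      \<comment> \<open>In the narrow range X^(-\<kappa>) <= r < 1/D the bound 1/D^2 does not shrink
        with r; t < 2 leaves room for it as soon as 2\<eta> <= \<kappa>(2 - t).\<close>
      have "D^2 = X powr (2 * (\<kappa> - \<eta>))"
        by (simp add: D_def power2_eq_square flip: powr_add)
      then have "(1 / D)^2 = X powr (- (2 * (\<kappa> - \<eta>)))"
        by (simp only: power_one_over powr_minus inverse_eq_divide)
      also have "\<dots> \<le> X powr (- \<kappa> * t)"
        using X \<eta>(2) by (intro powr_mono) (auto simp: algebra_simps)
      also have "\<dots> = (X powr (- \<kappa>)) powr t" by (simp add: powr_powr)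
      also have "\<dots> \<le> r powr t" using True t by (intro powr_mono2) auto
      finally show ?thesis using False by simp
    qed
    finally show ?thesis using powr_ge_zero[of r t] by linarith
  next
    case False
    define R where "R = X powr \<kappa> / 36"
    have Xk: "X powr \<kappa> \<le> X" using powr_mono[of \<kappa> 1 X] \<kappa> X by simp
    have Xk0: "X powr \<kappa> > 0" using X by simp
    have rR: "r * R < 1 / 36"
    proof -
      have "r * X powr \<kappa> < X powr (- \<kappa>) * X powr \<kappa>"
        using False Xk0 by (intro mult_strict_right_mono) auto
      also have "\<dots> = 1" using X by (simp flip: powr_add)
      finally show ?thesis by (simp add: R_def)
    qed
    have "1 / X * R \<le> 1 / 36" using Xk X by (simp add: R_def field_simps)
    then have hR: "(r + 2 * (1 / (36 * X))) * R < 1"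
      using rR by (simp add: distrib_right) (use rR in argo)
    have "box_mass (map (rat_box P (1 / (36 * X)) (1 / (36 * X^2))) xs) (square z r)
       \<le> ((r + 2 * (1 / (36 * X^2))) * R^2 + 1) / D^3 * (min 1 (r / (2 * (1 / (36 * X)))) * min 1 (r / (2 * (1 / (36 * X^2)))))"
      by (rule rat_boxes_mass_small_square[OF xs P _ _ D])
        (use P' X r hR in \<open>auto simp: D_def R_def\<close>)
    also have "\<dots> \<le> (r * X powr (2 * \<kappa>) + 2) / D^3 * ((18 * min 1 (r * X)) * (18 * min 1 (r * X^2)))"
    proof -
      have R2: "R^2 = X powr (2 * \<kappa>) / 1296"
        by (simp add: R_def power_divide power2_eq_square flip: powr_add)
      have "r * R^2 \<le> r * X powr (2 * \<kappa>)" unfolding R2 using r by (intro mult_left_mono) auto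
      moreover have "2 * (1 / (36 * X^2)) * R^2 \<le> 1"
      proof -
        have "(X powr \<kappa>)^2 \<le> X^2" using Xk by (intro power_mono) auto
        also have "X^2 \<le> X^2 * 23328" by simp
        finally show ?thesis using X by (simp add: R_def power_divide field_simps)
      qed
      ultimately have 1: "(r + 2 * (1 / (36 * X^2))) * R^2 + 1 \<le> r * X powr (2 * \<kappa>) + 2"
        unfolding distrib_right by linarith
      have min18: "0 \<le> min 1 (18 * y) \<and> min 1 (18 * y) \<le> 18 * min 1 y" if "0 \<le> y" for y :: real
        using that unfolding min_def by (simp split: if_split)
      have eqs: "r / (2 * (1 / (36 * X))) = 18 * (r * X)" "r / (2 * (1 / (36 * X^2))) = 18 * (r * X^2)"
        by simp_all
      have 2: "0 \<le> min 1 (18 * (r * X)) \<and> min 1 (18 * (r * X)) \<le> 18 * min 1 (r * X)"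
        using X r by (intro min18) simp
      have 3: "0 \<le> min 1 (18 * (r * X^2)) \<and> min 1 (18 * (r * X^2)) \<le> 18 * min 1 (r * X^2)"
        using X r by (intro min18) simp
      have 4: "0 \<le> (r * X powr (2 * \<kappa>) + 2) / D^3"
        using r D by simp
      show ?thesis
        unfolding eqs
      proof (rule mult_mono[OF divide_right_mono[OF 1] _ 4])
        show "min 1 (18 * (r * X)) * min 1 (18 * (r * X^2)) \<le> 18 * min 1 (r * X) * (18 * min 1 (r * X^2))"
          using 2 3 by (intro mult_mono) linarith+
        show "0 \<le> min 1 (18 * (r * X)) * min 1 (18 * (r * X^2))"
          using 2 3 by simp
      qed (use D in simp)
    qed
    also have "\<dots> = 324 * ((r * X powr (2 * \<kappa>) + 2) / X powr (3 * \<kappa> - 3 * \<eta>) * (min 1 (r * X) * min 1 (r * X^2)))"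
    proof -
      have "D^3 = X powr (3 * \<kappa> - 3 * \<eta>)"
        by (simp add: D_def power3_eq_cube flip: powr_add)
      then show ?thesis by simp
    qed
    also have "\<dots> \<le> 324 * (3 * r powr t)"
      by (intro mult_left_mono small_square_exponents X r) (use t \<eta> in auto)
    finally show ?thesis by simp
  qed
qed

lemma weyl_stage:
  fixes \<alpha> t :: real
  assumes \<alpha>: "1/2 < \<alpha>" "\<alpha> < 1" and t: "0 < t" "t < 6 * (1 - \<alpha>)" "t < 7/2 - 3 * \<alpha>" and "0 < \<epsilon>"
  shows "\<exists>N>N0. \<exists>v. nonneg_weights v \<and>
      box_support v \<subseteq> {x. real N powr \<alpha> \<le> norm (quad_sum (x $ 1) (x $ 2) N)} \<and>
      (\<forall>a b. cbox a b \<subseteq> unit_square \<longrightarrow> \<bar>box_mass v (cbox a b) - measure lborel (cbox a b)\<bar> \<le> \<epsilon>) \<and>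
      (\<forall>z r. 0 < r \<longrightarrow> r \<le> 1 \<longrightarrow> box_mass v (square z r) \<le> 972 * r powr t)"
proof -
  define \<kappa> where "\<kappa> = 2 - 2 * \<alpha>"
  have \<kappa>: "0 < \<kappa>" "\<kappa> < 1" using \<alpha> by (auto simp: \<kappa>_def)
  have t2: "t < 2" using t(3) \<alpha> by linarith
  \<comment> \<open>One entry for each inequality on \<eta> in the Frostman estimate. The third and
    fourth are positive by the two bounds on t; the second and last because 7/2 - 3\<alpha> is below
    2 and below 3 - 2\<alpha> = 1 + \<kappa> when \<alpha> > 1/2.\<close>
  define \<eta> where "\<eta> = Min {\<kappa> / 3, \<kappa> * (2 - t) / 2, (3 * \<kappa> - t) / 3, (1 + 3 * \<kappa> - 2 * t) / 3, (1 + \<kappa> - t) / 3}"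
  have \<eta>0: "0 < \<eta>" unfolding \<eta>_def using \<kappa> t t2 by (simp add: \<kappa>_def)
  have \<eta>: "\<eta> \<le> \<kappa> / 3" "\<eta> \<le> \<kappa> * (2 - t) / 2" "\<eta> \<le> (3 * \<kappa> - t) / 3" "\<eta> \<le> (1 + 3 * \<kappa> - 2 * t) / 3" "\<eta> \<le> (1 + \<kappa> - t) / 3"
    unfolding \<eta>_def by (intro Min_le; simp)+
  have \<eta>\<kappa>: "\<eta> < \<kappa>" using \<eta>(1) \<kappa> by linarith
  obtain N1 where N1: "\<And>N q (a1::int) (a2::int) x y. N \<ge> N1 \<Longrightarrow> odd q \<Longrightarrow> coprime a2 (int q) \<Longrightarrow>
     real q \<le> real N powr (2 - 2 * \<alpha>) / 36 \<Longrightarrow> \<bar>x - a1 / q\<bar> \<le> 1 / (36 * real N) \<Longrightarrow>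
     \<bar>y - a2 / q\<bar> \<le> 1 / (36 * (real N)^2) \<Longrightarrow> real N powr \<alpha> \<le> norm (quad_sum x y N)"
    using weyl_large_near_rational[OF \<alpha>] by blast
  have ev1: "eventually (\<lambda>N. 8 * real N powr (- (\<kappa> - \<eta>)) < \<epsilon>) sequentially"
  proof -
    have "(\<lambda>N. 8 * real N powr (- (\<kappa> - \<eta>))) \<longlonglongrightarrow> 0"
      using \<eta>\<kappa> by real_asymp
    then show ?thesis using \<open>0 < \<epsilon>\<close> by (rule order_tendstoD)
  qed
  have ev2: "eventually (\<lambda>N. N > max N0 (max N1 1)) sequentially" by (rule eventually_gt_at_top)
  note ev3 = many_primes[OF \<eta>0 \<eta>\<kappa> \<kappa>(2)]
  obtain N P where N: "8 * real N powr (- (\<kappa> - \<eta>)) < \<epsilon>" "N > max N0 (max N1 1)"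
    and P: "finite P" "real N powr (\<kappa> - \<eta>) \<le> real (card P)"
    and P': "\<And>q. q \<in> P \<Longrightarrow> prime q \<and> odd q \<and> real N powr (\<kappa> - \<eta>) \<le> real q \<and> real q \<le> real N powr \<kappa> / 36"
    using eventually_happens'[OF sequentially_bot eventually_conj[OF ev1 eventually_conj[OF ev2 ev3]]] by blast
  have Npos: "1 \<le> real N" "N \<ge> N1" "N > N0" using N(2) by auto
  have "finite (rat_index P)" unfolding rat_index_def using P(1) by auto
  then obtain xs where xs: "set xs = rat_index P" "distinct xs"
    using finite_distinct_list by blast
  define v where "v = map (rat_box P (1 / (36 * real N)) (1 / (36 * (real N)^2))) xs"
  have "nonneg_weights v"
    by (auto simp: v_def rat_box_def)
  moreover have "real N powr \<alpha> \<le> norm (quad_sum (x $ 1) (x $ 2) N)" if x: "x \<in> box_support v" for x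
  proof -
    obtain q a1 a2 where q: "(q, a1, a2) \<in> rat_index P"
      "x \<in> cbox (vector [real a1 / real q - 1 / (36 * real N), real a2 / real q - 1 / (36 * (real N)^2)])
         (vector [real a1 / real q + 1 / (36 * real N), real a2 / real q + 1 / (36 * (real N)^2)])"
      using x by (auto simp: box_support_def v_def rat_box_def xs)
    have b: "\<bar>x $ 1 - real a1 / real q\<bar> \<le> 1 / (36 * real N)" "\<bar>x $ 2 - real a2 / real q\<bar> \<le> 1 / (36 * (real N)^2)"
      using q(2) by (auto simp: mem_box_cart forall_2 abs_le_iff algebra_simps)
    have "q \<in> P" "a2 \<in> {1..<q}" using q(1) by (auto simp: rat_index_def)
    then have "coprime (int a2) (int q)"
      using P'[of q] by (metis atLeastLessThan_iff coprime_commute coprime_int_iff less_le_not_le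
          nat_dvd_not_less not_one_le_zero prime_imp_coprime zero_less_iff_neq_zero)
    then show ?thesis
      using N1[of N q "int a2" "x $ 1" "int a1" "x $ 2"] Npos P'[OF \<open>q \<in> P\<close>] b by (simp add: \<kappa>_def)
  qed
  moreover have "\<bar>box_mass v (cbox a b) - measure lborel (cbox a b)\<bar> \<le> \<epsilon>" if "cbox a b \<subseteq> unit_square" for a b
  proof -
    define \<delta> where "\<delta> = real N powr (- (\<kappa> - \<eta>))"
    have N\<delta>: "1 / real N \<le> \<delta>"
      using powr_mono[of "-1" "- (\<kappa> - \<eta>)" "real N"] \<kappa> \<eta>0 Npos
      by (simp add: \<delta>_def powr_minus divide_inverse)
    have "\<bar>box_mass v (cbox a b) - measure lborel (cbox a b)\<bar> \<le> 8 * \<delta>"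
      unfolding v_def
    proof (rule rat_boxes_equidistributed[OF xs P(1)])
      show "P \<noteq> {}" using P(2) Npos by auto
      have "2 * (1 / (36 * real N)) \<le> 1 / real N" using Npos by (simp add: field_simps)
      then show "2 * (1 / (36 * real N)) \<le> \<delta>" using N\<delta> by linarith
      have "2 * (1 / (36 * (real N)^2)) \<le> 1 / real N"
        using Npos by (simp add: field_simps power2_eq_square)
      then show "2 * (1 / (36 * (real N)^2)) \<le> \<delta>" using N\<delta> by linarith
      show "0 < q \<and> 1 / q \<le> \<delta>" if "q \<in> P" for q
      proof -
        have "1 / q \<le> 1 / real N powr (\<kappa> - \<eta>)"
          using P'[OF that] Npos by (intro divide_left_mono) (auto simp: prime_gt_0_nat)
        also have "\<dots> = \<delta>" by (simp only: \<delta>_def powr_minus divide_inverse mult_1_left)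
        finally show ?thesis using P'[OF that] by (auto simp: prime_gt_0_nat)
      qed
      show "\<delta> \<le> 1" using powr_mono[of "- (\<kappa> - \<eta>)" 0 "real N"] Npos \<eta>\<kappa> by (simp add: \<delta>_def)
    qed (use Npos that in auto)
    then show ?thesis using N(1) by (simp add: \<delta>_def)
  qed
  moreover have "box_mass v (square z r) \<le> 972 * r powr t" if "0 < r" "r \<le> 1" for z r
    unfolding v_def
  proof (rule rat_boxes_frostman[OF xs P(1)])
    show "prime q \<and> real N powr (\<kappa> - \<eta>) \<le> real q \<and> real q \<le> real N powr \<kappa> / 36" if "q \<in> P" for q
      using P'[OF that] by blast
  qed (use P(2) Npos that t t2 \<kappa> \<eta>0 \<eta>\<kappa> \<eta> in \<open>auto simp: field_simps\<close>)
  ultimately show ?thesis using Npos(3) by blast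
qed

lemma norm_weyl_sum_2:
  fixes x :: "real^2"
  shows "weyl_sum 2 (\<lambda>j. x $ of_nat j) N = quad_sum (x $ 1) (x $ 2) N"
proof -
  have "(\<Sum>j=1..2. x $ of_nat j * real n ^ j) = x $ 1 * real n + x $ 2 * (real n)^2" for n
    by (simp add: numeral_2_eq_2) 
  then show ?thesis
    by (simp add: weyl_sum_def quad_sum_def atLeastLessThanSuc_atLeastAtMost)
qed

lemma large_weyl_set2_eq:
  "large_weyl_set2 \<alpha> = {x \<in> unit_square. \<exists>\<^sub>\<infinity>N. real N powr \<alpha> \<le> norm (quad_sum (x $ 1) (x $ 2) N)}"
  by (auto simp: large_weyl_set2_def norm_weyl_sum_2 square_def mem_box_cart)

text \<open>The Frostman argument needs s > 0; s = 0 is settled by exhibiting a point.\<close>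

lemma hausdorff_measure_0_nonempty:
  assumes "x \<in> A"
  shows "hausdorff_measure 0 A \<noteq> 0"
proof -
  have "1 \<le> (\<Sum>i. diam_pow 0 (U i))" if U: "delta_cover 1 A U" for U
  proof -
    obtain i where "x \<in> U i" using U assms unfolding delta_cover_def by blast
    then have "1 = (\<Sum>i\<in>{i}. diam_pow 0 (U i))" by (auto simp: diam_pow_def)
    also have "\<dots> \<le> (\<Sum>i. diam_pow 0 (U i))" by (intro sum_le_suminf) auto
    finally show ?thesis .
  qed
  then have "1 \<le> hausdorff_content 0 1 A"
    unfolding hausdorff_content_def by (intro INF_greatest) simp
  also have "\<dots> \<le> hausdorff_measure 0 A"
    unfolding hausdorff_measure_def by (intro SUP_upper) simp
  finally show ?thesis by auto
qed

lemma hausdorff_measure_large_weyl_set2_pos: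
  fixes \<alpha> s :: real
  assumes \<alpha>: "1/2 < \<alpha>" "\<alpha> < 1" and s: "0 \<le> s" "s < 6 * (1 - \<alpha>)" "s < 7/2 - 3 * \<alpha>"
  shows "hausdorff_measure s (large_weyl_set2 \<alpha>) \<noteq> 0"
proof (cases "s = 0")
  case True
  have "(0 :: real^2) \<in> large_weyl_set2 \<alpha>"
  proof -
    have "real N powr \<alpha> \<le> norm (quad_sum 0 0 N)" if "N > 0" for N
      using powr_mono[of \<alpha> 1 "real N"] that \<alpha> by (simp add: quad_sum_def del: sum.op_ivl_Suc)
    then show ?thesis
      unfolding large_weyl_set2_eq INFM_nat
      by (auto simp: square_def mem_box_cart)
  qed
  then show ?thesis using True hausdorff_measure_0_nonempty by blast
next
  case False
  \<comment> \<open>Halfway between s and the critical value, leaving strict room on both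
    sides.\<close>
  define t where "t = (s + min (6 * (1 - \<alpha>)) (7/2 - 3 * \<alpha>)) / 2"
  have t: "s < t" "t < 6 * (1 - \<alpha>)" "t < 7/2 - 3 * \<alpha>" using s by (auto simp: t_def)
  show ?thesis
  proof (rule hausdorff_measure_limsup_pos[where t = t and K = 972
        and G = "\<lambda>N. {x. real N powr \<alpha> \<le> norm (quad_sum (x $ 1) (x $ 2) N)}"])
    show "s \<le> 2" using s \<alpha> by linarith
  qed (use s t False \<alpha> in \<open>auto simp: large_weyl_set2_eq intro!: weyl_stage\<close>)
qed

lemma summable_dyadic_powr:
  fixes C y :: real
  assumes "y < 0"
  shows "summable (\<lambda>k. C * (2 ^ (k + k0)) powr y)"
proof -
  have pow: "(2 ^ n) powr y = (2 powr y) ^ n" for n :: nat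
  proof -
    have "(2 ^ n) powr y = (2 powr real n) powr y" by (simp only: powr_realpow zero_less_numeral)
    also have "\<dots> = (2 powr y) powr real n" by (simp only: powr_powr mult.commute)
    also have "\<dots> = (2 powr y) ^ n" by (rule powr_realpow) simp
    finally show ?thesis .
  qed
  have "(2 ^ (k + k0)) powr y = (2 powr y) ^ k0 * (2 powr y) ^ k" for k
    unfolding pow by (simp add: power_add)
  then have "(\<lambda>k. C * (2 ^ (k + k0)) powr y) = (\<lambda>k. (C * (2 powr y) ^ k0) * (2 powr y) ^ k)"
    by (simp add: mult.assoc)
  moreover have "2 powr y < (1::real)" using powr_less_mono[OF assms, of 2] by simp
  ultimately show ?thesis by (simp add: summable_mult summable_geometric)
qed

text \<open>The lengths N are grouped into dyadic blocks: the rectangles of all N in a block fit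
  into those of its left end, so the cost is summed over powers of 2 and any negative exponent
  suffices. Summing over every N would lose a whole power of N.\<close>

lemma hausdorff_measure_large_weyl_set2_zero:
  fixes \<alpha> s :: real
  assumes \<alpha>: "1/2 < \<alpha>" "\<alpha> < 1" and s: "0 < s" "s \<le> 2" and big: "6 * (1 - \<alpha>) < s \<or> 7/2 - 3 * \<alpha> < s"
  shows "hausdorff_measure s (large_weyl_set2 \<alpha>) = 0"
proof -
  obtain N0 where N0: "\<And>N x y. N \<ge> N0 \<Longrightarrow> real N powr \<alpha> \<le> norm (quad_sum x y N) \<Longrightarrow>
    (\<exists>(q::nat) (a1::int) (a2::int). q > 0 \<and> real q \<le> 1000 * real N powr (2 - 2 * \<alpha>) \<and>
      \<bar>x - a1 / q\<bar> \<le> 1000 * real N powr (1 - 2 * \<alpha>) / q \<and>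
      \<bar>y - a2 / q\<bar> \<le> 1000 * real N powr (- 2 * \<alpha>) / q)"
    using weyl_large_imp_rational[OF \<alpha>] by blast
  have "eventually (\<lambda>k. 1000 * (2 ^ k) powr (1 - 2 * \<alpha>) \<le> 1) sequentially"
    using \<alpha> by real_asymp
  then obtain k0 where k0: "\<And>k. k \<ge> k0 \<Longrightarrow> 1000 * (2 ^ k) powr (1 - 2 * \<alpha>) \<le> 1"
    by (auto simp: eventually_sequentially)
  \<comment> \<open>The shift by k0 makes D k <= 1 for all k. Below, Q uses the right end 2 X k of
    the block because its exponent is positive; D and D' use the left end because theirs are
    negative.\<close>
  define X :: "nat \<Rightarrow> real" where "X k = 2 ^ (k + k0)" for k
  have X: "X k \<ge> 1" for k by (simp add: X_def)
  define Q where "Q k = 1000 * (2 * X k) powr (2 - 2 * \<alpha>)" for k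
  define D where "D k = 1000 * X k powr (1 - 2 * \<alpha>)" for k
  define D' where "D' k = 1000 * X k powr (- 2 * \<alpha>)" for k
  have D1: "D k \<le> 1" for k using k0[of "k + k0"] by (simp add: D_def X_def)
  have DD': "D k = X k * D' k" for k
  proof -
    have "X k powr (1 - 2 * \<alpha>) = X k powr 1 * X k powr (- 2 * \<alpha>)"
      by (simp only: powr_add[symmetric]) simp
    then show ?thesis using X[of k] by (simp add: D_def D'_def)
  qed
  have D'0: "D' k > 0" for k using X[of k] by (simp add: D'_def)
  have D0: "D k > 0" for k using X[of k] by (simp add: D_def)
  have D'D: "D' k \<le> D k" for k using X[of k] D'0[of k] by (simp add: DD')
  have approx: "\<exists>k\<ge>m. \<exists>(q::nat) (a1::int) (a2::int). 0 < q \<and> real q \<le> Q k \<and>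
       \<bar>q * x $ 1 - a1\<bar> \<le> D k \<and> \<bar>q * x $ 2 - a2\<bar> \<le> D' k" if x: "x \<in> large_weyl_set2 \<alpha>" for x m
  proof -
    obtain N where N: "N > max N0 (2 ^ (m + k0))" "real N powr \<alpha> \<le> norm (quad_sum (x $ 1) (x $ 2) N)"
      using x unfolding large_weyl_set2_eq INFM_nat by blast
    then have "N \<ge> 1" by simp
    then obtain j where j: "2 ^ j \<le> N" "N < 2 ^ (j + 1)"
      using ex_power_ivl1[of 2 N] by auto
    have "m + k0 \<le> j"
    proof (rule ccontr)
      assume "\<not> m + k0 \<le> j"
      then have "(2::nat) ^ (j + 1) \<le> 2 ^ (m + k0)" by (intro power_increasing) auto
      then show False using j(2) N(1) by simp
    qed
    then obtain k where k: "j = k + k0" "k \<ge> m" by (metis add_le_cancel_right le_Suc_ex add.commute add.assoc nat_le_iff_add le_add1)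
    have "real (2 ^ j) \<le> real N" using j(1) by (simp only: of_nat_le_iff)
    moreover have "real N \<le> real (2 ^ (j + 1))" using j(2) by (simp only: of_nat_le_iff)
    ultimately have XN: "X k \<le> real N" "real N \<le> 2 * X k" by (simp_all add: X_def k)
    obtain q :: nat and a1 a2 :: int where q: "q > 0" "real q \<le> 1000 * real N powr (2 - 2 * \<alpha>)"
      "\<bar>x $ 1 - a1 / q\<bar> \<le> 1000 * real N powr (1 - 2 * \<alpha>) / q"
      "\<bar>x $ 2 - a2 / q\<bar> \<le> 1000 * real N powr (- 2 * \<alpha>) / q"
      using N0[OF _ N(2)] N(1) by auto
    have eq: "\<bar>q * y - a\<bar> = q * \<bar>y - a / q\<bar>" for y a :: real
    proof -
      have "q * y - a = q * (y - a / q)" using q(1) by (simp add: field_simps)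
      then show ?thesis by (simp add: abs_mult)
    qed
    have "\<bar>q * x $ 1 - a1\<bar> \<le> 1000 * real N powr (1 - 2 * \<alpha>)"
      unfolding eq using q(1,3) by (simp add: field_simps)
    also have "\<dots> \<le> D k"
      unfolding D_def using XN X[of k] \<alpha> by (intro mult_left_mono powr_mono2') auto
    finally have 1: "\<bar>q * x $ 1 - a1\<bar> \<le> D k" .
    have "\<bar>q * x $ 2 - a2\<bar> \<le> 1000 * real N powr (- 2 * \<alpha>)"
      unfolding eq using q(1,4) by (simp add: field_simps)
    also have "\<dots> \<le> D' k"
      unfolding D'_def using XN X[of k] \<alpha> by (intro mult_left_mono powr_mono2') auto
    finally have 2: "\<bar>q * x $ 2 - a2\<bar> \<le> D' k" .
    have "real q \<le> Q k"
      unfolding Q_def using XN \<alpha> by (intro order_trans[OF q(2)] mult_left_mono powr_mono2) auto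
    then show ?thesis using k(2) q(1) 1 2 by blast
  qed
  have Qs: "Q k powr (3 - s) = Q0 * X k powr ((2 - 2 * \<alpha>) * (3 - s))"
    if "Q0 = (1000 * 2 powr (2 - 2 * \<alpha>)) powr (3 - s)" for k Q0
    using X[of k] that by (simp add: Q_def powr_mult powr_powr)
  have x01: "0 \<le> x $ i \<and> x $ i \<le> 1" if "x \<in> large_weyl_set2 \<alpha>" for x i
    using that by (simp add: large_weyl_set2_def)
  show ?thesis
    using big
  proof
    assume s6: "6 * (1 - \<alpha>) < s"
    show ?thesis
    \<comment> \<open>One piece for each rectangle: the exponent of X k is (1-2\<alpha>)s +
      (2-2\<alpha>)(3-s) = 6(1-\<alpha>) - s.\<close>
    proof (rule hausdorff_measure_rational_limsup_zero[where Q = Q and D = D and D' = D'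
          and J = "\<lambda>k. 1" and L = "\<lambda>k. 2 * D k"])
      show "D' k \<le> 1" for k using D'D[of k] D1[of k] by simp
      show "D' k \<le> 2 * D k" for k using D'D[of k] D0[of k] by simp
      show "(\<lambda>k. 2 * D k) \<longlonglongrightarrow> 0"
        unfolding D_def X_def using \<alpha> by real_asymp
      have eq: "real 1 * (2 * D k) powr s * Q k powr (3 - s) =
          2000 powr s * (1000 * 2 powr (2 - 2 * \<alpha>)) powr (3 - s) * (2 ^ (k + k0)) powr (6 * (1 - \<alpha>) - s)" for k
      proof -
        have "(2 * D k) powr s = 2000 powr s * X k powr ((1 - 2 * \<alpha>) * s)"
          using X[of k] by (simp add: D_def powr_mult powr_powr flip: mult.assoc)
        moreover have "X k powr ((1 - 2 * \<alpha>) * s) * X k powr ((2 - 2 * \<alpha>) * (3 - s)) = X k powr (6 * (1 - \<alpha>) - s)"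
          by (simp add: algebra_simps flip: powr_add)
        ultimately show ?thesis by (simp add: Qs[OF refl] X_def mult_ac)
      qed
      show "summable (\<lambda>k. real 1 * (2 * D k) powr s * Q k powr (3 - s))"
        unfolding eq by (rule summable_dyadic_powr) (use s6 in simp)
    qed (use s x01 approx D1 D0 in auto)
  next
    assume s7: "7/2 - 3 * \<alpha> < s"
    show ?thesis
    \<comment> \<open>Since D = X D', slices of the short side's length number 2X: the exponent of X
      k is 1 - 2\<alpha>s + (2-2\<alpha>)(3-s) = 7 - 6\<alpha> - 2s.\<close>
    proof (rule hausdorff_measure_rational_limsup_zero[where Q = Q and D = D and D' = D'
          and J = "\<lambda>k. 2 * 2 ^ (k + k0)" and L = D'])
      show "D' k \<le> 1" for k using D'D[of k] D1[of k] by simp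
      show "2 * D k \<le> real (2 * 2 ^ (k + k0)) * D' k" for k by (simp add: DD' X_def)
      show "D' \<longlonglongrightarrow> 0"
        unfolding D'_def X_def using \<alpha> by real_asymp
      have eq: "real (2 * 2 ^ (k + k0)) * D' k powr s * Q k powr (3 - s) =
          2 * 1000 powr s * (1000 * 2 powr (2 - 2 * \<alpha>)) powr (3 - s) * (2 ^ (k + k0)) powr (7 - 6 * \<alpha> - 2 * s)" for k
      proof -
        have "D' k powr s = 1000 powr s * X k powr (- 2 * \<alpha> * s)"
          using X[of k] by (simp add: D'_def powr_mult powr_powr)
        moreover have "real (2 * 2 ^ (k + k0)) = 2 * X k powr 1"
          by (simp add: X_def)
        moreover have "X k powr 1 * (X k powr (- 2 * \<alpha> * s) * X k powr ((2 - 2 * \<alpha>) * (3 - s))) = X k powr (7 - 6 * \<alpha> - 2 * s)"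
          by (simp only: powr_add[symmetric]) (simp add: algebra_simps)
        ultimately show ?thesis by (simp add: Qs[OF refl] X_def mult_ac)
      qed
      show "summable (\<lambda>k. real (2 * 2 ^ (k + k0)) * D' k powr s * Q k powr (3 - s))"
        unfolding eq by (rule summable_dyadic_powr) (use s7 in simp)
    qed (use s x01 approx D1 D'0 in auto)
  qed
qed

theorem theorem2p1:
  fixes \<alpha> :: real
  assumes "1/2 < \<alpha>" and "\<alpha> < 1"
  shows "hausdorff_dim (large_weyl_set2 \<alpha>) =
           ennreal (if \<alpha> \<le> 5/6 then 7/2 - 3 * \<alpha> else 6 * (1 - \<alpha>))"
proof -
  define d where "d = (if \<alpha> \<le> 5/6 then 7/2 - 3 * \<alpha> else 6 * (1 - \<alpha>))"
  have d: "0 < d" "d < 2" using assms by (auto simp: d_def)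
  \<comment> \<open>The two lines cross at \<alpha> = 5/6, so the case distinction selects the
    smaller value.\<close>
  have d_min: "d \<le> 7/2 - 3 * \<alpha>" "d \<le> 6 * (1 - \<alpha>)" "d = 7/2 - 3 * \<alpha> \<or> d = 6 * (1 - \<alpha>)"
    by (auto simp: d_def)
  have "hausdorff_dim (large_weyl_set2 \<alpha>) \<le> ennreal d"
  proof (rule ennreal_le_epsilon)
    fix \<epsilon> :: real assume "0 < \<epsilon>"
    \<comment> \<open>Capped at 2 because the covering estimate assumes s <= 2; still s > d, since d
      < 2.\<close>
    define s where "s = min 2 (d + \<epsilon>)"
    have s: "d < s" "s \<le> 2" "s \<le> d + \<epsilon>" using d \<open>0 < \<epsilon>\<close> by (auto simp: s_def)
    have "hausdorff_measure s (large_weyl_set2 \<alpha>) = 0"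
      by (rule hausdorff_measure_large_weyl_set2_zero) (use assms s d d_min in auto)
    then have "hausdorff_dim (large_weyl_set2 \<alpha>) \<le> ennreal s"
      unfolding hausdorff_dim_def using s d by (intro INF_lower) auto
    also have "\<dots> \<le> ennreal d + ennreal \<epsilon>"
      using s d \<open>0 < \<epsilon>\<close> by (simp flip: ennreal_plus)
    finally show "hausdorff_dim (large_weyl_set2 \<alpha>) \<le> ennreal d + ennreal \<epsilon>" .
  qed
  moreover have "ennreal d \<le> hausdorff_dim (large_weyl_set2 \<alpha>)"
    unfolding hausdorff_dim_def
  proof (rule INF_greatest)
    fix s assume s: "s \<in> {s. 0 \<le> s \<and> hausdorff_measure s (large_weyl_set2 \<alpha>) = 0}"
    have "\<not> s < d"
      using hausdorff_measure_large_weyl_set2_pos[OF assms, of s] s d_min by auto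
    then show "ennreal d \<le> ennreal s" by (intro ennreal_leI) simp
  qed
  ultimately show ?thesis unfolding d_def by (rule antisym)
qed

end
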